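(* Let $\alpha>0$, let $w\in A^{\mathrm{restricted}}_{\infty}$, and let $\mu$ be a positive Borel measure on $\mathbb{C}$. Then there exists $\delta\in(0,1)$ such that for $p\geq1$ the following conditions are equivalent: (a) $T_{\mu}\in \mathcal{S}_{p}(F^2_{\alpha,w})$; (b) $\widetilde{\mu}\in L^p(\mathbb{C},dA)$; (c) for some (or, equivalently, any) $r\in(0,\delta)$, $\widehat{\mu}_{w,r}\in L^p(\mathbb{C},dA)$. Moreover, for $r\in(0,\delta)$, $$\|T_{\mu}\|_{\mathcal{S}_p(F^2_{\alpha,w})}\asymp\|\widetilde{\mu}\|_{L^p(\mathbb{C},dA)}\asymp\|\widehat{\mu}_{w,r}\|_{L^p(\mathbb{C},dA)},$$ where the implicit constants are independent of $\mu$.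
   Context: A weight is a non-negative locally integrable function $w$ on $\mathbb{C}$; $dA$ (and $A(\cdot)$) is Lebesgue measure on $\mathbb{C}$; $w(E):=\int_E w\,dA$; $D(z,r)$ is the disk with center $z$ and radius $r$. Squares $Q\subset\mathbb{C}$ have sides parallel to the axes, with side length $\ell(Q)$. For $1<q<\infty$ with $1/q+1/q'=1$, $w\in A_q^{\mathrm{restricted}}$ if for some (equivalently any) fixed $r>0$, $\sup_{\ell(Q)=r}\big(\frac1{A(Q)}\int_Q w\,dA\big)\big(\frac1{A(Q)}\int_Q w^{-q'/q}dA\big)^{q/q'}<\infty$; $w\in A_1^{\mathrm{restricted}}$ if for some (equivalently any) fixed $r>0$, $\sup_{\ell(Q)=r}\big(\frac1{A(Q)}\int_Q w\,dA\big)\|w^{-1}\|_{L^\infty(Q)}<\infty$ (in particular both factors are finite, so $w>0$ a.e.). Set $A_\infty^{\mathrm{restricted}}:=\bigcup_{1\le q<\infty}A_q^{\mathrm{restricted}}$. $F^2_{\alpha,w}$ is the Hilbert space of entire functions $f$ with $\|f\|^2_{F^2_{\alpha,w}}=\int_{\mathbb{C}}|f(z)|^2e^{-\alpha|z|^2}w(z)\,dA(z)<\infty$, with inner product $\langle f,g\rangle_{F^2_{\alpha,w}}=\int_{\mathbb{C}}f\overline{g}\,e^{-\alpha|z|^2}w\,dA$. $B^w_z$ is its reproducing kernel at $z$ (so $f(z)=\langle f,B^w_z\rangle_{F^2_{\alpha,w}}$), and $b^w_z:=B^w_z/\|B^w_z\|_{F^2_{\alpha,w}}$. For a positive Borel measure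 $\mu$: the Toeplitz operator is $T_\mu f(z):=\int_{\mathbb{C}}f(\xi)\overline{B^w_z(\xi)}e^{-\alpha|\xi|^2}d\mu(\xi)$, $z\in\mathbb{C}$. Being a bounded (or compact) operator on $F^2_{\alpha,w}$ includes that for every $f\in F^2_{\alpha,w}$ the integral converges absolutely for every $z$ and $T_\mu f\in F^2_{\alpha,w}$. A compact operator $T$ on a separable Hilbert space $H$, with singular values $\{s_n(T)\}_{n\ge1}$, is in the Schatten class $\mathcal{S}_p(H)$ if $\|T\|_{\mathcal{S}_p(H)}^p:=\sum_{n\ge1}s_n(T)^p<\infty$ (the norm is taken to be $+\infty$ if $T\notin\mathcal{S}_p(H)$). The average function is $\widehat{\mu}_{w,r}(z):=\mu(D(z,r))/w(D(z,r))$; the Berezin transform is $\widetilde{\mu}(z):=\int_{\mathbb{C}}|b^w_z(\xi)|^2e^{-\alpha|\xi|^2}d\mu(\xi)$. $X\asymp Y$ means $c\,Y\le X\le C\,Y$ for constants $c,C>0$ (which may depend on $\alpha,w,r,p$). *)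

theory Defs
  imports
    "HOL-Complex_Analysis.Complex_Analysis"
    "HOL-Probability.Essential_Supremum"
    "HOL-Library.Function_Algebras"
begin

section \<open>Extended non-negative powers and \<open>L\<^sup>p\<close> norms\<close>

text \<open>Only used with a positive exponent, so that \<open>\<infinity>\<close> is mapped to \<open>\<infinity>\<close>.\<close>

definition epowr :: "ennreal \<Rightarrow> real \<Rightarrow> ennreal" where
  "epowr x p = (if x = \<infinity> then \<infinity> else ennreal (enn2real x powr p))"

definition Lp_norm :: "real \<Rightarrow> (complex \<Rightarrow> ennreal) \<Rightarrow> ennreal" where
  "Lp_norm p g = epowr (\<integral>\<^sup>+ z. epowr (g z) p \<partial>lebesgue) (1 / p)"

definition in_Lp :: "real \<Rightarrow> (complex \<Rightarrow> ennreal) \<Rightarrow> bool" where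
  "in_Lp p g \<longleftrightarrow> g \<in> borel_measurable lebesgue \<and> Lp_norm p g < \<infinity>"

text \<open>\<open>X \<asymp> Y\<close> with constants that are uniform over the index set \<open>M\<close>.\<close>

definition uniformly_comparable :: "'i set \<Rightarrow> ('i \<Rightarrow> ennreal) \<Rightarrow> ('i \<Rightarrow> ennreal) \<Rightarrow> bool" where
  "uniformly_comparable M X Y \<longleftrightarrow>
     (\<exists>c>0. \<exists>C>0. \<forall>i\<in>M. ennreal c * Y i \<le> X i \<and> X i \<le> ennreal C * Y i)"


section \<open>Restricted Muckenhoupt weights\<close>

definition weight :: "(complex \<Rightarrow> real) \<Rightarrow> bool" where
  "weight w \<longleftrightarrow> (\<forall>z. 0 \<le> w z) \<and> (\<forall>K. compact K \<longrightarrow> w absolutely_integrable_on K)"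

definition weight_measure :: "(complex \<Rightarrow> real) \<Rightarrow> complex measure" where
  "weight_measure w = density lebesgue (\<lambda>z. ennreal (w z))"

text \<open>The square with lower left corner \<open>a\<close> and side length \<open>r\<close>.\<close>

definition square :: "complex \<Rightarrow> real \<Rightarrow> complex set" where
  "square a r = cbox a (a + Complex r r)"

definition average :: "complex set \<Rightarrow> (complex \<Rightarrow> ennreal) \<Rightarrow> ennreal" where
  "average Q g = (\<integral>\<^sup>+ z\<in>Q. g z \<partial>lebesgue) / emeasure lebesgue Q"

text \<open>
  Negative powers of \<open>w\<close> are inverses in \<^typ>\<open>ennreal\<close>, hence \<open>\<infinity>\<close> where \<open>w\<close> vanishes.
  In \<^typ>\<open>ennreal\<close> we have \<open>0 * \<infinity> = 0\<close>; requiring both factors to be finite excludes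
  this case, and with it weights vanishing on a set of positive measure.
\<close>

definition A_restricted :: "real \<Rightarrow> (complex \<Rightarrow> real) set" where
  "A_restricted q = {w. weight w \<and> (\<exists>r>0.
     let q' = q / (q - 1);
         avg = (\<lambda>a. average (square a r) (\<lambda>z. ennreal (w z)));
         dual = (\<lambda>a. average (square a r) (\<lambda>z. inverse (ennreal (w z powr (q' / q)))))
     in (\<forall>a. avg a < \<infinity> \<and> dual a < \<infinity>) \<and> (SUP a. avg a * epowr (dual a) (q / q')) < \<infinity>)}"

definition A1_restricted :: "(complex \<Rightarrow> real) set" where
  "A1_restricted = {w. weight w \<and> (\<exists>r>0.
     let avg = (\<lambda>a. average (square a r) (\<lambda>z. ennreal (w z)));
         dual = (\<lambda>a. esssup (restrict_space lebesgue (square a r)) (\<lambda>z. inverse (ennreal (w z))))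
     in (\<forall>a. avg a < \<infinity> \<and> dual a < \<infinity>) \<and> (SUP a. avg a * dual a) < \<infinity>)}"

definition Ainf_restricted :: "(complex \<Rightarrow> real) set" where
  "Ainf_restricted = A1_restricted \<union> (\<Union>q\<in>{1<..}. A_restricted q)"


section \<open>Schatten classes on a Hilbert space of functions\<close>

text \<open>
  A Hilbert space is given by its carrier \<open>H\<close>, a set of complex-valued functions that is
  a vector space under the pointwise operations, and its inner product \<open>ip\<close>, linear in the
  first argument. Operators are only relevant through their restriction to \<open>H\<close>.
\<close>

interpretation fun_vs: vector_space "\<lambda>(c::complex) (f::'a \<Rightarrow> complex) x. c * f x"
  by unfold_locales (auto simp: fun_eq_iff algebra_simps)

type_synonym 'a inner_product = "('a \<Rightarrow> complex) \<Rightarrow> ('a \<Rightarrow> complex) \<Rightarrow> complex"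
type_synonym 'a operator = "('a \<Rightarrow> complex) \<Rightarrow> 'a \<Rightarrow> complex"

definition ip_norm :: "'a inner_product \<Rightarrow> ('a \<Rightarrow> complex) \<Rightarrow> real" where
  "ip_norm ip f = sqrt (Re (ip f f))"

definition ip_topology :: "('a \<Rightarrow> complex) set \<Rightarrow> 'a inner_product \<Rightarrow> ('a \<Rightarrow> complex) topology" where
  "ip_topology H ip = Metric_space.mtopology H (\<lambda>f g. ip_norm ip (\<lambda>x. f x - g x))"

definition linear_operator :: "('a \<Rightarrow> complex) set \<Rightarrow> 'a operator \<Rightarrow> bool" where
  "linear_operator H T \<longleftrightarrow> T ` H \<subseteq> H \<and>
     (\<forall>f\<in>H. \<forall>g\<in>H. T (\<lambda>x. f x + g x) = (\<lambda>x. T f x + T g x)) \<and>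
     (\<forall>c. \<forall>f\<in>H. T (\<lambda>x. c * f x) = (\<lambda>x. c * T f x))"

definition compact_operator :: "('a \<Rightarrow> complex) set \<Rightarrow> 'a inner_product \<Rightarrow> 'a operator \<Rightarrow> bool" where
  "compact_operator H ip T \<longleftrightarrow> linear_operator H T \<and>
     compactin (ip_topology H ip) (ip_topology H ip closure_of (T ` {f\<in>H. ip_norm ip f \<le> 1}))"

definition adjoint_operator :: "('a \<Rightarrow> complex) set \<Rightarrow> 'a inner_product \<Rightarrow> 'a operator \<Rightarrow> 'a operator" where
  "adjoint_operator H ip T g = (THE h. h \<in> H \<and> (\<forall>f\<in>H. ip (T f) g = ip f h))"

text \<open>
  The singular values of a compact operator \<open>T\<close> are the square roots of the eigenvalues of
  \<open>T\<^sup>*T\<close>, in non-increasing order and repeated according to multiplicity; the sequence is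
  indexed from \<open>0\<close> and continued by zeros if there are only finitely many positive ones.
\<close>

definition singular_values :: "('a \<Rightarrow> complex) set \<Rightarrow> 'a inner_product \<Rightarrow> 'a operator \<Rightarrow> nat \<Rightarrow> real" where
  "singular_values H ip T = (THE s. decseq s \<and> (\<forall>n. 0 \<le> s n) \<and>
     (\<forall>t>0. finite {n. s n = t} \<and>
        card {n. s n = t} =
          fun_vs.dim {f\<in>H. adjoint_operator H ip T (T f) = (\<lambda>x. complex_of_real (t\<^sup>2) * f x)}))"

definition schatten_class :: "real \<Rightarrow> ('a \<Rightarrow> complex) set \<Rightarrow> 'a inner_product \<Rightarrow> 'a operator set" where
  "schatten_class p H ip =
     {T. compact_operator H ip T \<and> summable (\<lambda>n. singular_values H ip T n powr p)}"

definition schatten_norm :: "real \<Rightarrow> ('a \<Rightarrow> complex) set \<Rightarrow> 'a inner_product \<Rightarrow> 'a operator \<Rightarrow> ennreal" where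
  "schatten_norm p H ip T =
     (if T \<in> schatten_class p H ip
      then ennreal ((\<Sum>n. singular_values H ip T n powr p) powr (1 / p)) else \<infinity>)"


section \<open>Weighted Fock spaces\<close>

definition fock :: "real \<Rightarrow> (complex \<Rightarrow> real) \<Rightarrow> (complex \<Rightarrow> complex) set" where
  "fock \<alpha> w = {f. f holomorphic_on UNIV \<and>
     integrable lebesgue (\<lambda>z. (cmod (f z))\<^sup>2 * exp (- \<alpha> * (cmod z)\<^sup>2) * w z)}"

definition fock_ip :: "real \<Rightarrow> (complex \<Rightarrow> real) \<Rightarrow> complex inner_product" where
  "fock_ip \<alpha> w f g =
     (LINT z|lebesgue. f z * cnj (g z) * of_real (exp (- \<alpha> * (cmod z)\<^sup>2) * w z))"

definition fock_kernel :: "real \<Rightarrow> (complex \<Rightarrow> real) \<Rightarrow> complex \<Rightarrow> complex \<Rightarrow> complex" where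
  "fock_kernel \<alpha> w z = (THE g. g \<in> fock \<alpha> w \<and> (\<forall>f\<in>fock \<alpha> w. f z = fock_ip \<alpha> w f g))"

definition normalized_kernel :: "real \<Rightarrow> (complex \<Rightarrow> real) \<Rightarrow> complex \<Rightarrow> complex \<Rightarrow> complex" where
  "normalized_kernel \<alpha> w z \<xi> =
     fock_kernel \<alpha> w z \<xi> / of_real (ip_norm (fock_ip \<alpha> w) (fock_kernel \<alpha> w z))"


section \<open>Toeplitz operators, Berezin transforms and averages of a measure\<close>

definition borel_measures :: "complex measure set" where
  "borel_measures = {\<mu>. sets \<mu> = sets borel}"

definition toeplitz_integrand ::
  "real \<Rightarrow> (complex \<Rightarrow> real) \<Rightarrow> (complex \<Rightarrow> complex) \<Rightarrow> complex \<Rightarrow> complex \<Rightarrow> complex" where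
  "toeplitz_integrand \<alpha> w f z \<xi> =
     f \<xi> * cnj (fock_kernel \<alpha> w z \<xi>) * of_real (exp (- \<alpha> * (cmod \<xi>)\<^sup>2))"

definition toeplitz :: "real \<Rightarrow> (complex \<Rightarrow> real) \<Rightarrow> complex measure \<Rightarrow> complex operator" where
  "toeplitz \<alpha> w \<mu> f z = (LINT \<xi>|\<mu>. toeplitz_integrand \<alpha> w f z \<xi>)"

text \<open>
  The Bochner integral of a non-integrable function is \<open>0\<close>, so absolute convergence of the
  integrals defining the Toeplitz operator is a separate condition.
\<close>

definition toeplitz_converges :: "real \<Rightarrow> (complex \<Rightarrow> real) \<Rightarrow> complex measure \<Rightarrow> bool" where
  "toeplitz_converges \<alpha> w \<mu> \<longleftrightarrow>
     (\<forall>f\<in>fock \<alpha> w. \<forall>z. integrable \<mu> (toeplitz_integrand \<alpha> w f z))"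

definition toeplitz_in_schatten :: "real \<Rightarrow> real \<Rightarrow> (complex \<Rightarrow> real) \<Rightarrow> complex measure \<Rightarrow> bool" where
  "toeplitz_in_schatten p \<alpha> w \<mu> \<longleftrightarrow>
     toeplitz_converges \<alpha> w \<mu> \<and> toeplitz \<alpha> w \<mu> \<in> schatten_class p (fock \<alpha> w) (fock_ip \<alpha> w)"

definition toeplitz_schatten_norm :: "real \<Rightarrow> real \<Rightarrow> (complex \<Rightarrow> real) \<Rightarrow> complex measure \<Rightarrow> ennreal" where
  "toeplitz_schatten_norm p \<alpha> w \<mu> =
     (if toeplitz_converges \<alpha> w \<mu>
      then schatten_norm p (fock \<alpha> w) (fock_ip \<alpha> w) (toeplitz \<alpha> w \<mu>) else \<infinity>)"

definition berezin :: "real \<Rightarrow> (complex \<Rightarrow> real) \<Rightarrow> complex measure \<Rightarrow> complex \<Rightarrow> ennreal" where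
  "berezin \<alpha> w \<mu> z =
     (\<integral>\<^sup>+ \<xi>. ennreal ((cmod (normalized_kernel \<alpha> w z \<xi>))\<^sup>2 * exp (- \<alpha> * (cmod \<xi>)\<^sup>2)) \<partial>\<mu>)"

definition average_function ::
  "(complex \<Rightarrow> real) \<Rightarrow> real \<Rightarrow> complex measure \<Rightarrow> complex \<Rightarrow> ennreal" where
  "average_function w r \<mu> z = emeasure \<mu> (ball z r) / emeasure (weight_measure w) (ball z r)"

end

(*
  The A_q condition at a fixed scale, combined with Hoelder's inequality, gives
  (\<integral>_Q h^(1/q) dA)^q w(Q) \<le> C \<integral>_Q h w dA. For h the indicator of a smaller disk this is doubling at that
  scale; for h = |g|^2 with g entire, and the submean value property of |g|^(2/q), it is the local
  estimate |f(z)|^2 e^(-\<alpha>|z|^2) w(D(z,r)) \<le> L \<integral>_D(z,r) |f|^2 e^(-\<alpha>|.|^2) w dA. Hence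
  B_z(z) e^(-\<alpha>|z|^2) w(D(z,r)) is bounded above and below, and by Cauchy's estimate |B_z(\<xi>)| is
  comparable to its diagonal value for \<xi> close to z; so averages are dominated by the Berezin transform.

  For the other direction, the local estimate and Fubini give
  \<integral> |f|^2 e^(-\<alpha>|.|^2) d\<mu> \<le> L \<integral> |f|^2 e^(-\<alpha>|.|^2) (average of \<mu>) w dA. With f = b_z, Jensen's inequality
  and integration in z bound the Berezin transform in L^p. With f running over the eigenvectors e_n of
  T_\<mu>, Jensen's inequality and \<Sum>_n |e_n(z)|^2 \<le> B_z(z) bound \<Sum>_n \<lambda>_n^p. Conversely the Berezin
  transform at z is \<Sum>_n \<lambda>_n |<b_z, e_n>|^2 and the weights sum to at most 1, so that Jensen's inequality
  and integration in z bound its L^p norm by \<Sum>_n \<lambda>_n^p. No off-diagonal decay of the kernel is used.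
*)


theory Submission
  imports Defs "HOL-Real_Asymp.Real_Asymp"
begin

section \<open>Hilbert spaces of functions\<close>

text \<open>The kernel, the adjoint and the singular values are definite descriptions, so Riesz
  representation, completeness of the Fock space and the spectral theorem for positive compact
  operators come before any of them denotes the intended object. The measure \<open>\<mu>\<close> is
  arbitrary: it need be neither sigma-finite nor finite on disks, and the Bochner integral of a
  non-integrable function is 0. Each direction therefore begins with a qualitative fact (bounded
  averages of \<open>\<mu>\<close>, hence sigma-finiteness and a Carleson inequality whose constant
  depends on \<open>\<mu>\<close>) and only then runs the quantitative argument, whose constants do
  not involve \<open>\<mu>\<close>. Local masses are compared with \<open>v\<close>, the mass of a
  square of fixed size. Doubling at a single scale still allows exponential growth of
  \<open>v\<close>, but no more than that, and the Gaussian absorbs it. The admissible radii are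
  limited only by that scale and by the near-diagonal lower bound of the kernel, so that
  \<open>\<delta>\<close> does not depend on \<open>p\<close>.\<close>

definition scl :: "complex \<Rightarrow> ('a \<Rightarrow> complex) \<Rightarrow> 'a \<Rightarrow> complex" where
  "scl c f = (\<lambda>x. c * f x)"

lemma scl_apply [simp]: "scl c f x = c * f x"
  by (simp add: scl_def)

text \<open>No definiteness is assumed, because Cauchy-Schwarz is needed for three forms on the same
  space: the inner product, \<open>ip (T f) g\<close> for a positive operator, and
  \<open>gip \<mu>\<close>, which may vanish on nonzero functions.\<close>

locale semi_inner_form =
  fixes H :: "('a \<Rightarrow> complex) set" and B :: "'a inner_product"
  assumes zero_mem [simp]: "0 \<in> H"
    and add_mem [simp]: "\<And>f g. f \<in> H \<Longrightarrow> g \<in> H \<Longrightarrow> f + g \<in> H"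
    and scl_mem [simp]: "\<And>c f. f \<in> H \<Longrightarrow> scl c f \<in> H"
    and form_add: "\<And>f g h. f \<in> H \<Longrightarrow> g \<in> H \<Longrightarrow> h \<in> H \<Longrightarrow> B (f + g) h = B f h + B g h"
    and form_scl: "\<And>c f h. f \<in> H \<Longrightarrow> h \<in> H \<Longrightarrow> B (scl c f) h = c * B f h"
    and form_commute: "\<And>f g. f \<in> H \<Longrightarrow> g \<in> H \<Longrightarrow> B g f = cnj (B f g)"
    and form_nonneg: "\<And>f. f \<in> H \<Longrightarrow> 0 \<le> Re (B f f)"
begin

lemma diff_eq_scl: "f - g = f + scl (- 1) g"
  by (simp add: scl_def fun_eq_iff)

lemma diff_mem [simp]: "f \<in> H \<Longrightarrow> g \<in> H \<Longrightarrow> f - g \<in> H"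
  unfolding diff_eq_scl by simp

lemma form_diff: "f \<in> H \<Longrightarrow> g \<in> H \<Longrightarrow> h \<in> H \<Longrightarrow> B (f - g) h = B f h - B g h"
  unfolding diff_eq_scl by (simp add: form_add form_scl)

lemma form_add_right: "f \<in> H \<Longrightarrow> g \<in> H \<Longrightarrow> h \<in> H \<Longrightarrow> B h (f + g) = B h f + B h g"
  by (metis add_mem complex_cnj_add form_add form_commute)

lemma form_scl_right: "f \<in> H \<Longrightarrow> h \<in> H \<Longrightarrow> B h (scl c f) = cnj c * B h f"
  by (metis complex_cnj_mult form_commute form_scl scl_mem)

lemma form_diff_right: "f \<in> H \<Longrightarrow> g \<in> H \<Longrightarrow> h \<in> H \<Longrightarrow> B h (f - g) = B h f - B h g"
  unfolding diff_eq_scl by (simp add: form_add_right form_scl_right)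

lemma form_zero [simp]: "h \<in> H \<Longrightarrow> B 0 h = 0" "h \<in> H \<Longrightarrow> B h 0 = 0"
  using form_diff[of 0 0 h] form_diff_right[of 0 0 h] by simp_all

lemma form_self: "f \<in> H \<Longrightarrow> B f f = of_real (Re (B f f))"
  using form_commute[of f f] by (simp add: complex_eq_iff)

text \<open>Completing the square in this expansion yields Cauchy-Schwarz, the lengths of the
  residuals in the spectral theorem and the variational step of the Riesz theorem.\<close>

lemma form_diff_scl_self:
  assumes "f \<in> H" "g \<in> H"
  shows "Re (B (f - scl c g) (f - scl c g)) = Re (B f f) - 2 * Re (cnj c * B f g) + (cmod c)\<^sup>2 * Re (B g g)"
proof -
  have "B (f - scl c g) (f - scl c g) = B f f - cnj c * B f g - (c * B g f - c * cnj c * B g g)"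
    using assms by (simp add: form_diff form_diff_right form_scl form_scl_right algebra_simps)
  also have "B g f = cnj (B f g)"
    using assms form_commute by blast
  also have "c * cnj (B f g) = cnj (cnj c * B f g)"
    by simp
  also have "c * cnj c * B g g = of_real ((cmod c)\<^sup>2 * Re (B g g))"
    by (simp only: complex_norm_square[symmetric] of_real_mult form_self[OF assms(2), symmetric])
  finally have *: "B (f - scl c g) (f - scl c g) =
      B f f - cnj c * B f g - (cnj (cnj c * B f g) - of_real ((cmod c)\<^sup>2 * Re (B g g)))" .
  show ?thesis
    by (simp only: * minus_complex.sel cnj.sel Re_complex_of_real)
qed

lemma Cauchy_Schwarz:
  assumes "f \<in> H" "g \<in> H"
  shows "(cmod (B f g))\<^sup>2 \<le> Re (B f f) * Re (B g g)"
proof (cases "Re (B g g) = 0")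
  case True
  \<comment> \<open>With \<open>B g g = 0\<close> the expansion along \<open>g\<close> is affine in
    \<open>t\<close>, and an affine function that is nonnegative everywhere is constant.\<close>
  have nn: "0 \<le> Re (B f f) - 2 * t * (cmod (B f g))\<^sup>2" for t :: real
  proof -
    have re: "Re (cnj (of_real t * B f g) * B f g) = t * (cmod (B f g))\<^sup>2"
      unfolding cmod_power2 by (simp add: power2_eq_square algebra_simps)
    have "0 \<le> Re (B (f - scl (of_real t * B f g) g) (f - scl (of_real t * B f g) g))"
      using assms form_nonneg by simp
    also have "\<dots> = Re (B f f) - 2 * t * (cmod (B f g))\<^sup>2"
      using form_diff_scl_self[OF assms, of "of_real t * B f g"] True re by simp
    finally show ?thesis .
  qed
  have "cmod (B f g) = 0"
  proof (rule ccontr)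
    assume ne: "cmod (B f g) \<noteq> 0"
    \<comment> \<open>At this \<open>t\<close> the affine function takes the value -1.\<close>
    show False
      using nn[of "(Re (B f f) + 1) / (2 * (cmod (B f g))\<^sup>2)"] ne by simp
  qed
  then show ?thesis using True by simp
next
  case False
  \<comment> \<open>The coefficient \<open>?c\<close> is the one for which
    \<open>f - scl ?c g\<close> is shortest.\<close>
  let ?b = "Re (B g g)" let ?c = "B f g / of_real ?b"
  have b: "?b > 0"
    using False form_nonneg[OF assms(2)] by linarith
  have e: "(cmod ?c)\<^sup>2 = (cmod (B f g))\<^sup>2 / ?b\<^sup>2"
    by (simp add: norm_divide power_divide)
  have e2: "Re (cnj ?c * B f g) = (cmod (B f g))\<^sup>2 / ?b"
  proof -
    have "cnj ?c * B f g = (B f g * cnj (B f g)) / of_real ?b" by simp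
    also have "\<dots> = of_real ((cmod (B f g))\<^sup>2 / ?b)"
      by (simp only: complex_norm_square[symmetric] of_real_divide)
    finally show ?thesis by (simp only: Re_complex_of_real)
  qed
  have "0 \<le> Re (B (f - scl ?c g) (f - scl ?c g))"
    using assms form_nonneg by simp
  also have "\<dots> = Re (B f f) - (cmod (B f g))\<^sup>2 / ?b"
    unfolding form_diff_scl_self[OF assms] e e2 using b by (simp add: power2_eq_square field_simps)
  finally show ?thesis using b by (simp add: field_simps)
qed

end

text \<open>Nonnegativity and invariance under sign are asked of all functions, not only of those in
  \<open>H\<close>, because \<open>Metric_space\<close> demands a nonnegative symmetric distance for
  arbitrary arguments.\<close>

locale function_inner_space = semi_inner_form H ip for H :: "('a \<Rightarrow> complex) set" and ip +
  assumes ip_nonneg_all: "\<And>f. 0 \<le> Re (ip f f)"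
    and ip_uminus_all: "\<And>f. ip (- f) (- f) = ip f f"
    and ip_definite: "\<And>f. f \<in> H \<Longrightarrow> Re (ip f f) = 0 \<Longrightarrow> f = 0"
begin

abbreviation nrm :: "('a \<Rightarrow> complex) \<Rightarrow> real" where "nrm f \<equiv> ip_norm ip f"

lemma nrm_nonneg [simp]: "0 \<le> nrm f"
  by (simp add: ip_norm_def ip_nonneg_all)

lemma nrm_sq: "(nrm f)\<^sup>2 = Re (ip f f)"
  by (simp add: ip_norm_def ip_nonneg_all)

lemma ip_self: "f \<in> H \<Longrightarrow> ip f f = of_real ((nrm f)\<^sup>2)"
  using form_self nrm_sq by simp

lemma nrm_eq_0_iff: "f \<in> H \<Longrightarrow> nrm f = 0 \<longleftrightarrow> f = 0"
  using nrm_sq[of f] ip_definite[of f] by (auto simp: ip_norm_def)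

lemma nrm_zero [simp]: "nrm 0 = 0"
  by (simp add: nrm_eq_0_iff)

lemma cmod_ip_le: "f \<in> H \<Longrightarrow> g \<in> H \<Longrightarrow> cmod (ip f g) \<le> nrm f * nrm g"
  using Cauchy_Schwarz[of f g] by (simp add: nrm_sq[symmetric] flip: power_mult_distrib)

lemma nrm_scl: "f \<in> H \<Longrightarrow> nrm (scl c f) = cmod c * nrm f"
proof -
  assume f: "f \<in> H"
  have "ip (scl c f) (scl c f) = (c * cnj c) * ip f f"
    using f by (simp add: form_scl form_scl_right)
  also have "\<dots> = of_real ((cmod c * nrm f)\<^sup>2)"
    by (simp only: complex_norm_square[symmetric] of_real_mult power_mult_distrib ip_self[OF f])
  finally have "(nrm (scl c f))\<^sup>2 = (cmod c * nrm f)\<^sup>2"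
    by (simp only: nrm_sq Re_complex_of_real)
  then show ?thesis by simp
qed

lemma nrm_add_sq: "f \<in> H \<Longrightarrow> g \<in> H \<Longrightarrow> (nrm (f + g))\<^sup>2 = (nrm f)\<^sup>2 + 2 * Re (ip f g) + (nrm g)\<^sup>2"
  by (simp add: nrm_sq form_add form_add_right form_commute[of f g])

lemma nrm_diff_sq: "f \<in> H \<Longrightarrow> g \<in> H \<Longrightarrow> (nrm (f - g))\<^sup>2 = (nrm f)\<^sup>2 - 2 * Re (ip f g) + (nrm g)\<^sup>2"
  by (simp add: nrm_sq form_diff form_diff_right form_commute[of f g])

lemma nrm_triangle: "f \<in> H \<Longrightarrow> g \<in> H \<Longrightarrow> nrm (f + g) \<le> nrm f + nrm g"
proof -
  assume fg: "f \<in> H" "g \<in> H"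
  have "(nrm (f + g))\<^sup>2 \<le> (nrm f + nrm g)\<^sup>2"
    using cmod_ip_le[OF fg] complex_Re_le_cmod[of "ip f g"] nrm_add_sq[OF fg]
    by (simp add: power2_sum)
  then show ?thesis by (rule power2_le_imp_le) simp
qed

lemma nrm_diff_commute: "nrm (f - g) = nrm (g - f)"
  using ip_uminus_all[of "f - g"] by (simp add: ip_norm_def)

lemma nrm_triangle_sub: "f \<in> H \<Longrightarrow> g \<in> H \<Longrightarrow> nrm f \<le> nrm g + nrm (f - g)"
  using nrm_triangle[of g "f - g"] by simp

lemma nrm_diff_triangle: "f \<in> H \<Longrightarrow> g \<in> H \<Longrightarrow> h \<in> H \<Longrightarrow> nrm (f - h) \<le> nrm (f - g) + nrm (g - h)"
  using nrm_triangle[of "f - g" "g - h"] by simp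

lemma Metric_space_ndist: "Metric_space H (\<lambda>f g. nrm (\<lambda>x. f x - g x))"
proof (rule Metric_space.intro)
  fix f g h
  show "0 \<le> nrm (\<lambda>x. f x - g x)" by (rule nrm_nonneg)
  show "nrm (\<lambda>x. f x - g x) = nrm (\<lambda>x. g x - f x)"
    using nrm_diff_commute[of f g] by (simp only: fun_diff_def)
  assume "f \<in> H" "g \<in> H"
  then have eq: "nrm (f - g) = 0 \<longleftrightarrow> f = g"
    by (simp add: nrm_eq_0_iff)
  show "nrm (\<lambda>x. f x - g x) = 0 \<longleftrightarrow> f = g"
    using eq by (simp only: fun_diff_def)
  assume "h \<in> H"
  show "nrm (\<lambda>x. f x - h x) \<le> nrm (\<lambda>x. f x - g x) + nrm (\<lambda>x. g x - h x)"
    using nrm_diff_triangle[OF \<open>f \<in> H\<close> \<open>g \<in> H\<close> \<open>h \<in> H\<close>] by (simp only: fun_diff_def)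
qed

lemma limit_unique:
  assumes "\<And>n. \<sigma> n \<in> H" "f \<in> H" "g \<in> H"
    and "(\<lambda>n. nrm (\<sigma> n - f)) \<longlonglongrightarrow> 0" "(\<lambda>n. nrm (\<sigma> n - g)) \<longlonglongrightarrow> 0"
  shows "f = g"
proof -
  have "(\<lambda>n. nrm (\<sigma> n - f) + nrm (\<sigma> n - g)) \<longlonglongrightarrow> 0"
    using tendsto_add[OF assms(4,5)] by simp
  moreover have "nrm (f - g) \<le> nrm (\<sigma> n - f) + nrm (\<sigma> n - g)" for n
    using nrm_diff_triangle[of f "\<sigma> n" g] nrm_diff_commute[of f "\<sigma> n"] assms by simp
  ultimately have "nrm (f - g) \<le> 0"
    by (meson LIMSEQ_le_const)
  then have "nrm (f - g) = 0"
    using nrm_nonneg[of "f - g"] by linarith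
  then show ?thesis
    using nrm_eq_0_iff[of "f - g"] assms by simp
qed

lemma ip_tendsto:
  assumes "\<And>n. \<sigma> n \<in> H" "f \<in> H" "h \<in> H" "(\<lambda>n. nrm (\<sigma> n - f)) \<longlonglongrightarrow> 0"
  shows "(\<lambda>n. ip (\<sigma> n) h) \<longlonglongrightarrow> ip f h"
proof (rule LIM_zero_cancel, rule tendsto_norm_zero_cancel, rule tendsto_sandwich[OF _ _ tendsto_const])
  show "(\<lambda>n. nrm (\<sigma> n - f) * nrm h) \<longlonglongrightarrow> 0"
    using tendsto_mult_right[OF assms(4), of "nrm h"] by simp
  show "\<forall>\<^sub>F n in sequentially. norm (ip (\<sigma> n) h - ip f h) \<le> nrm (\<sigma> n - f) * nrm h"
    using assms by (auto simp: form_diff[symmetric] intro!: always_eventually cmod_ip_le)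
qed auto

lemma nrm_tendsto:
  assumes "\<And>n. \<sigma> n \<in> H" "f \<in> H" "(\<lambda>n. nrm (\<sigma> n - f)) \<longlonglongrightarrow> 0"
  shows "(\<lambda>n. nrm (\<sigma> n)) \<longlonglongrightarrow> nrm f"
proof (rule LIM_zero_cancel, rule tendsto_rabs_zero_cancel, rule tendsto_sandwich[OF _ _ tendsto_const])
  show "\<forall>\<^sub>F n in sequentially. \<bar>nrm (\<sigma> n) - nrm f\<bar> \<le> nrm (\<sigma> n - f)"
  proof (intro always_eventually allI)
    fix n
    show "\<bar>nrm (\<sigma> n) - nrm f\<bar> \<le> nrm (\<sigma> n - f)"
      using nrm_triangle_sub[of "\<sigma> n" f] nrm_triangle_sub[of f "\<sigma> n"]
        nrm_diff_commute[of f "\<sigma> n"] assms by (simp add: abs_le_iff)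
  qed
  show "(\<lambda>n. nrm (\<sigma> n - f)) \<longlonglongrightarrow> 0" by fact
qed auto

end

lemma tendsto_0_squeeze:
  fixes u v :: "nat \<Rightarrow> real"
  assumes "v \<longlonglongrightarrow> 0" "\<And>n. 0 \<le> u n" "\<And>n. u n \<le> v n"
  shows "u \<longlonglongrightarrow> 0"
  by (rule tendsto_sandwich[OF _ _ tendsto_const assms(1)]) (auto simp: assms)

text \<open>Needed to resolve the description in \<open>singular_values\<close>. Superlevel sets of
  a decreasing sequence are initial segments, so their cardinalities determine the sequence, and
  each cardinality is a sum of multiplicities over finitely many positive values.\<close>

lemma decseq_eq_if_same_multiplicities:
  fixes s s' :: "nat \<Rightarrow> real"
  assumes dec: "decseq s" "decseq s'" and nonneg: "\<And>n. 0 \<le> s n" "\<And>n. 0 \<le> s' n"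
    and lim: "s \<longlonglongrightarrow> 0"
    and mult: "\<And>t. t > 0 \<Longrightarrow> finite {n. s' n = t} \<and> card {n. s' n = t} = card {n. s n = t}"
  shows "s' = s"
proof -
  have initial: "{n. t \<le> u n} = {..<card {n. t \<le> u n}}"
    if "decseq u" "finite {n. t \<le> u n}" for u :: "nat \<Rightarrow> real" and t
  proof -
    have "\<exists>k. {n. t \<le> u n} = {..<k}"
    proof (cases "\<exists>n. u n < t")
      case True
      define k where "k = (LEAST n. u n < t)"
      have "u k < t" using True unfolding k_def by (rule LeastI_ex)
      then have "{n. t \<le> u n} = {..<k}"
      proof (intro set_eqI iffI)
        fix n assume "n \<in> {n. t \<le> u n}"
        then show "n \<in> {..<k}"
          using decseqD[OF that(1), of k n] \<open>u k < t\<close> by (cases "k \<le> n") auto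
      next
        fix n assume "n \<in> {..<k}"
        then show "n \<in> {n. t \<le> u n}"
          using not_less_Least[of n "\<lambda>n. u n < t"] by (simp add: k_def not_less)
      qed
      then show ?thesis by blast
    next
      case False
      then have "{n. t \<le> u n} = UNIV" by (auto simp: not_less)
      then show ?thesis using that(2) by simp
    qed
    then show ?thesis by (metis card_lessThan)
  qed
  have fin: "finite {n. t \<le> s n}" if "t > 0" for t
  proof -
    have "\<forall>\<^sub>F n in sequentially. s n < t" using lim that by (rule order_tendstoD)
    then obtain N where "\<And>n. n \<ge> N \<Longrightarrow> s n < t" by (auto simp: eventually_sequentially)
    then have "{n. t \<le> s n} \<subseteq> {..<N}"
      by (intro subsetI) (metis lessThan_iff linorder_not_le mem_Collect_eq)
    then show ?thesis using finite_subset by blast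
  qed
  \<comment> \<open>No limit is assumed for \<open>s'\<close>: a value that it takes has positive
    multiplicity and is therefore a value of \<open>s\<close>, so at or above \<open>t\<close> only
    the finitely many values in \<open>V\<close> occur.\<close>
  have same: "finite {n. t \<le> s' n} \<and> card {n. t \<le> s' n} = card {n. t \<le> s n}" if t: "t > 0" for t
  proof -
    define V where "V = s ` {n. t \<le> s n}"
    have V: "finite V" "\<And>u. u \<in> V \<Longrightarrow> t \<le> u" using fin[OF t] by (auto simp: V_def)
    have e1: "{n. t \<le> s n} = (\<Union>u\<in>V. {n. s n = u})" by (auto simp: V_def)
    have e2: "{n. t \<le> s' n} = (\<Union>u\<in>V. {n. s' n = u})"
    proof
      show "{n. t \<le> s' n} \<subseteq> (\<Union>u\<in>V. {n. s' n = u})"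
      proof
        fix n assume "n \<in> {n. t \<le> s' n}"
        then have n: "t \<le> s' n" by simp
        have "finite {m. s' m = s' n}" "card {m. s' m = s' n} = card {m. s m = s' n}"
          using mult[of "s' n"] n t by auto
        moreover have "n \<in> {m. s' m = s' n}" by simp
        ultimately have "{m. s m = s' n} \<noteq> {}" by (metis card.empty card_0_eq empty_iff)
        then obtain m where "s m = s' n" by blast
        then have "s' n \<in> V" using n unfolding V_def by (metis imageI mem_Collect_eq)
        then show "n \<in> (\<Union>u\<in>V. {n. s' n = u})" by simp
      qed
      show "(\<Union>u\<in>V. {n. s' n = u}) \<subseteq> {n. t \<le> s' n}" using V by auto
    qed
    have finm: "finite {n. s' n = u}" "finite {n. s n = u}" if "u \<in> V" for u
      using mult[of u] V(2)[OF that] t fin[of u] by (auto elim: rev_finite_subset)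
    have "card {n. t \<le> s' n} = (\<Sum>u\<in>V. card {n. s' n = u})"
      unfolding e2 by (rule card_UN_disjoint) (use V finm in auto)
    also have "\<dots> = (\<Sum>u\<in>V. card {n. s n = u})"
      by (rule sum.cong) (use mult V t in force)+
    also have "\<dots> = card {n. t \<le> s n}"
      unfolding e1 by (rule card_UN_disjoint[symmetric]) (use V finm in auto)
    finally show ?thesis unfolding e2 using V finm by auto
  qed
  have iff: "t \<le> s' n \<longleftrightarrow> t \<le> s n" if "t > 0" for t n
    using initial[OF dec(2), of t] initial[OF dec(1), of t] same[OF that] fin[OF that]
    by (metis mem_Collect_eq)
  show ?thesis
  proof
    fix n
    show "s' n = s n"
    proof (rule antisym)
      show "s' n \<le> s n" using iff[of "s' n" n] nonneg(1)[of n] by force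
      show "s n \<le> s' n" using iff[of "s n" n] nonneg(2)[of n] by force
    qed
  qed
qed

lemma linear_operatorD:
  assumes "linear_operator H T"
  shows "f \<in> H \<Longrightarrow> T f \<in> H" "f \<in> H \<Longrightarrow> g \<in> H \<Longrightarrow> T (f + g) = T f + T g"
    "f \<in> H \<Longrightarrow> T (scl c f) = scl c (T f)"
  using assms unfolding linear_operator_def plus_fun_def scl_def by blast+

lemma scl_zero [simp]: "scl 0 f = 0" "scl c 0 = 0"
  by (simp_all add: fun_eq_iff)

section \<open>Compact operators\<close>

context function_inner_space
begin

lemma compact_operator_subsequence:
  assumes T: "compact_operator H ip T" and \<sigma>: "\<And>n. \<sigma> n \<in> H" "\<And>n. nrm (\<sigma> n) \<le> 1"
  obtains r g where "strict_mono (r :: nat \<Rightarrow> nat)" "g \<in> H" "(\<lambda>n. nrm (T (\<sigma> (r n)) - g)) \<longlonglongrightarrow> 0"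
proof -
  interpret M: Metric_space H "\<lambda>f g. nrm (\<lambda>x. f x - g x)" by (rule Metric_space_ndist)
  define A where "A = T ` {f\<in>H. nrm f \<le> 1}"
  have "A \<subseteq> H"
    using T linear_operatorD(1)[of H T] by (auto simp: A_def compact_operator_def)
  then have sub: "A \<subseteq> M.mtopology closure_of A" by (intro closure_of_subset) simp
  have "compactin M.mtopology (M.mtopology closure_of A)"
    using T by (simp add: compact_operator_def ip_topology_def A_def)
  moreover have "range (\<lambda>n. T (\<sigma> n)) \<subseteq> M.mtopology closure_of A"
    using sub \<sigma> by (auto simp: A_def)
  ultimately obtain l r where lr: "strict_mono (r :: nat \<Rightarrow> nat)"
      "limitin M.mtopology ((\<lambda>n. T (\<sigma> n)) \<circ> r) l sequentially"
    unfolding M.compactin_sequentially by blast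
  then have "l \<in> H" "(\<lambda>n. nrm (\<lambda>x. T (\<sigma> (r n)) x - l x)) \<longlonglongrightarrow> 0"
    unfolding M.limitin_metric_dist_null by (simp_all add: o_def)
  then show thesis
    using that[OF lr(1)] by (simp add: fun_diff_def)
qed

text \<open>Compact sets are metrically bounded, and \<open>0 = T 0\<close> lies in the image of the
  unit ball, so a bound on the diameter of that image bounds its norms.\<close>

lemma compact_operator_bounded:
  assumes T: "compact_operator H ip T"
  obtains M where "0 \<le> M" "\<And>f. f \<in> H \<Longrightarrow> nrm (T f) \<le> M * nrm f"
proof -
  have lin: "linear_operator H T" using T by (simp add: compact_operator_def)
  note Tm = linear_operatorD[OF lin]
  interpret M: Metric_space H "\<lambda>f g. nrm (\<lambda>x. f x - g x)" by (rule Metric_space_ndist)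
  define A where "A = T ` {f\<in>H. nrm f \<le> 1}"
  have "A \<subseteq> H" using Tm(1) by (auto simp: A_def)
  then have sub: "A \<subseteq> M.mtopology closure_of A" by (intro closure_of_subset) simp
  have "compactin M.mtopology (M.mtopology closure_of A)"
    using T by (simp add: compact_operator_def ip_topology_def A_def)
  then have "M.mbounded (M.mtopology closure_of A)" by (rule M.compactin_imp_mbounded)
  then obtain b where b: "\<And>f g. f \<in> A \<Longrightarrow> g \<in> A \<Longrightarrow> nrm (\<lambda>x. f x - g x) \<le> b"
    using sub unfolding M.mbounded_alt by blast
  have T0: "T 0 = 0" using Tm(3)[of 0 0] by simp
  have "0 \<in> A" unfolding A_def by (rule image_eqI[of _ _ 0]) (simp_all add: T0)
  have b1: "nrm (T f) \<le> b" if "f \<in> H" "nrm f \<le> 1" for f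
    using b[of "T f" 0] that \<open>0 \<in> A\<close> by (simp add: A_def)
  have b0: "0 \<le> b" using b1[of 0] by (simp add: T0)
  have "nrm (T f) \<le> b * nrm f" if f: "f \<in> H" for f
  proof (cases "nrm f = 0")
    case True
    then show ?thesis using nrm_eq_0_iff[OF f] T0 by simp
  next
    case False
    let ?c = "of_real (1 / nrm f) :: complex"
    have c: "cmod ?c = 1 / nrm f"
      by (simp add: norm_divide)
    have "nrm (T (scl ?c f)) \<le> b"
      using False f c by (intro b1) (simp_all add: nrm_scl)
    then have "1 / nrm f * nrm (T f) \<le> b"
      using f c by (simp only: Tm nrm_scl)
    then show ?thesis using False nrm_nonneg[of f] by (simp add: field_simps)
  qed
  then show thesis using that b0 by blast
qed

lemma form_sum:
  assumes "finite A" "\<And>v. v \<in> A \<Longrightarrow> g v \<in> H" "h \<in> H"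
  shows "(\<Sum>v\<in>A. g v) \<in> H \<and> ip (\<Sum>v\<in>A. g v) h = (\<Sum>v\<in>A. ip (g v) h)"
  using assms(1,2) by (induction A rule: finite_induct) (auto simp: form_add assms(3))

end

section \<open>The spectral theorem for positive compact operators\<close>

locale positive_compact_operator = function_inner_space H ip
  for H :: "('a \<Rightarrow> complex) set" and ip +
  fixes T :: "'a operator"
  assumes compact: "compact_operator H ip T"
    and symmetric: "\<And>f g. f \<in> H \<Longrightarrow> g \<in> H \<Longrightarrow> ip (T f) g = ip f (T g)"
    and positive: "\<And>f. f \<in> H \<Longrightarrow> 0 \<le> Re (ip (T f) f)"
begin

lemma linear: "linear_operator H T"
  using compact by (simp add: compact_operator_def)

lemmas T_mem [simp] = linear_operatorD(1)[OF linear]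
lemmas T_add = linear_operatorD(2)[OF linear]
lemmas T_scl = linear_operatorD(3)[OF linear]

lemma T_zero [simp]: "T 0 = 0"
  using T_scl[of 0 0] by simp

lemma T_diff: "f \<in> H \<Longrightarrow> g \<in> H \<Longrightarrow> T (f - g) = T f - T g"
  unfolding diff_eq_scl by (simp add: T_add T_scl)

abbreviation quad :: "('a \<Rightarrow> complex) \<Rightarrow> real" where "quad f \<equiv> Re (ip (T f) f)"

text \<open>Positivity makes Cauchy-Schwarz available for the form of \<open>T\<close>, even if
  \<open>T\<close> has a kernel.\<close>

lemma semi_inner_form_T: "semi_inner_form H (\<lambda>f g. ip (T f) g)"
proof
  fix f g assume "f \<in> H" "g \<in> H"
  then show "ip (T g) f = cnj (ip (T f) g)"
    using symmetric[of f g] form_commute[of f "T g"] by simp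
qed (simp_all add: T_add T_scl form_add form_scl positive)

text \<open>Cauchy-Schwarz for the form of \<open>T\<close> at the pair \<open>f\<close>,
  \<open>T f\<close>, whose mixed term is the squared norm of \<open>T f\<close>.\<close>

lemma nrm_T_power4_le: "f \<in> H \<Longrightarrow> (nrm (T f)) ^ 4 \<le> quad f * quad (T f)"
  using semi_inner_form.Cauchy_Schwarz[OF semi_inner_form_T, of f "T f"]
  by (simp add: ip_self power_mult[symmetric] flip: of_real_power)

section \<open>Maximising the quadratic form on orthogonal complements\<close>

definition perp :: "('a \<Rightarrow> complex) set \<Rightarrow> ('a \<Rightarrow> complex) set" where
  "perp S = {f \<in> H. \<forall>e\<in>S. ip f e = 0}"

text \<open>The largest eigenvalue of \<open>T\<close> on the complement of \<open>S\<close>, once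
  \<open>S\<close> consists of eigenvectors. The supremum runs over the ball rather than the sphere,
  so that it is 0 and not undefined when the complement is trivial.\<close>

definition top_val :: "('a \<Rightarrow> complex) set \<Rightarrow> real" where
  "top_val S = Sup (quad ` {f \<in> perp S. nrm f \<le> 1})"

lemma quad_bdd_above: "bdd_above (quad ` {f \<in> perp S. nrm f \<le> 1})"
proof -
  obtain M where M: "0 \<le> M" "\<And>f. f \<in> H \<Longrightarrow> nrm (T f) \<le> M * nrm f"
    using compact_operator_bounded[OF compact] by blast
  have "quad f \<le> M" if "f \<in> H" "nrm f \<le> 1" for f
  proof -
    have "quad f \<le> nrm (T f) * nrm f"
      using cmod_ip_le[of "T f" f] complex_Re_le_cmod[of "ip (T f) f"] that by simp
    also have "\<dots> \<le> M * nrm f * nrm f" using M(2)[OF that(1)] by (intro mult_right_mono) auto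
    also have "\<dots> \<le> M * 1 * 1" using that M(1) by (intro mult_mono) auto
    finally show ?thesis by simp
  qed
  then show ?thesis by (auto simp: bdd_above_def perp_def)
qed

lemma zero_in_perp [simp]: "S \<subseteq> H \<Longrightarrow> 0 \<in> perp S"
  by (auto simp: perp_def)

lemma top_val_nonneg: "S \<subseteq> H \<Longrightarrow> 0 \<le> top_val S"
  unfolding top_val_def by (rule cSUP_upper2[OF quad_bdd_above, of 0]) auto

lemma top_val_antimono: "S' \<subseteq> H \<Longrightarrow> S \<subseteq> S' \<Longrightarrow> top_val S' \<le> top_val S"
  unfolding top_val_def
  by (rule cSUP_subset_mono[OF _ quad_bdd_above]) (auto simp: perp_def intro!: exI[of _ 0])

lemma quad_le_top_val:
  assumes "S \<subseteq> H" "f \<in> perp S"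
  shows "quad f \<le> top_val S * (nrm f)\<^sup>2"
proof (cases "nrm f = 0")
  case True
  then have "f = 0" using assms nrm_eq_0_iff by (auto simp: perp_def)
  then show ?thesis by simp
next
  case False
  let ?c = "of_real (1 / nrm f) :: complex"
  have c: "cmod ?c = 1 / nrm f" by (simp add: norm_divide)
  have f: "f \<in> H" using assms by (simp add: perp_def)
  have m: "scl ?c f \<in> perp S" "nrm (scl ?c f) \<le> 1"
    using assms False f c by (auto simp: perp_def form_scl nrm_scl subset_iff)
  have "quad (scl ?c f) \<le> top_val S"
    unfolding top_val_def by (rule cSUP_upper[OF _ quad_bdd_above]) (use m in auto)
  also have "quad (scl ?c f) = quad f / (nrm f)\<^sup>2"
    using f by (simp add: T_scl form_scl form_scl_right power2_eq_square)
  finally show ?thesis using False nrm_nonneg[of f] by (simp add: field_simps)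
qed

lemma T_perp:
  assumes "\<And>e. e \<in> S \<Longrightarrow> \<exists>c. T e = scl c e" "S \<subseteq> H" "f \<in> perp S"
  shows "T f \<in> perp S"
proof -
  have "ip (T f) e = 0" if e: "e \<in> S" for e
  proof -
    obtain c where "T e = scl c e" using assms(1)[OF e] by blast
    then show ?thesis using assms e symmetric[of f e] by (auto simp: perp_def form_scl_right subset_iff)
  qed
  then show ?thesis using assms(3) by (simp add: perp_def)
qed

text \<open>In \<open>nrm_T_power4_le\<close> the factor \<open>quad (T f)\<close> is at most
  \<open>top_val S\<close> times the squared norm of \<open>T f\<close>, because \<open>T f\<close>
  stays in \<open>perp S\<close>; one squared norm then cancels. The factor \<open>quad f\<close>
  that remains is what turns maximising sequences into approximate eigenvectors.\<close>

lemma nrm_T_sq_le: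
  assumes "\<And>e. e \<in> S \<Longrightarrow> \<exists>c. T e = scl c e" "S \<subseteq> H" "f \<in> perp S"
  shows "(nrm (T f))\<^sup>2 \<le> top_val S * quad f"
proof (cases "nrm (T f) = 0")
  case True
  then show ?thesis using assms(3) positive[of f] top_val_nonneg[OF assms(2)] by (simp add: perp_def)
next
  case False
  have f: "f \<in> H" using assms(3) by (simp add: perp_def)
  have "(nrm (T f))\<^sup>2 * (nrm (T f))\<^sup>2 \<le> quad f * quad (T f)"
    using nrm_T_power4_le[OF f] by (simp add: power4_eq_xxxx power2_eq_square algebra_simps)
  also have "\<dots> \<le> quad f * (top_val S * (nrm (T f))\<^sup>2)"
    using quad_le_top_val[OF assms(2) T_perp[OF assms]] positive[OF f] by (intro mult_left_mono)
  finally have "(nrm (T f))\<^sup>2 * (nrm (T f))\<^sup>2 \<le> (top_val S * quad f) * (nrm (T f))\<^sup>2"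
    by (simp add: algebra_simps)
  then show ?thesis by (rule mult_right_le_imp_le) (use False in simp)
qed

text \<open>A maximising sequence for the quadratic form on the unit ball of \<open>perp S\<close> is asymptotically
  an eigenvector, so that it converges as soon as its image under \<open>T\<close> does.\<close>

lemma top_val_attained:
  assumes S: "\<And>e. e \<in> S \<Longrightarrow> \<exists>c. T e = scl c e" "S \<subseteq> H"
  shows "\<exists>e\<in>perp S. T e = scl (of_real (top_val S)) e \<and>
    (if top_val S > 0 then nrm e = 1 else e = 0)"
proof (cases "top_val S > 0")
  case False
  then have "top_val S = 0" using top_val_nonneg[OF S(2)] by simp
  then show ?thesis using S(2) by (intro bexI[of _ 0]) auto
next
  case True
  define L where "L = top_val S"
  have L: "L > 0" using True by (simp add: L_def)
  have "\<exists>f. f \<in> perp S \<and> nrm f \<le> 1 \<and> L - 1 / real (Suc n) < quad f" for n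
  proof -
    have "L - 1 / real (Suc n) < Sup (quad ` {f \<in> perp S. nrm f \<le> 1})"
      by (simp add: L_def top_val_def)
    moreover have "{f \<in> perp S. nrm f \<le> 1} \<noteq> {}" using S(2) by (auto intro!: exI[of _ 0])
    ultimately show ?thesis
      by (subst (asm) less_cSup_iff) (use quad_bdd_above in auto)
  qed
  then obtain \<sigma> where \<sigma>: "\<And>n. \<sigma> n \<in> perp S" "\<And>n. nrm (\<sigma> n) \<le> 1"
      "\<And>n. L - 1 / real (Suc n) < quad (\<sigma> n)"
    by metis
  have \<sigma>H: "\<sigma> n \<in> H" for n using \<sigma>(1) by (simp add: perp_def)
  have upper: "quad (\<sigma> n) \<le> L" for n
    unfolding L_def top_val_def by (rule cSUP_upper[OF _ quad_bdd_above]) (use \<sigma> in auto)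
  have near: "nrm (T (\<sigma> n) - scl (of_real L) (\<sigma> n)) \<le> sqrt (L / real (Suc n))" for n
  proof (rule real_le_rsqrt)
    have "Re (ip (T (\<sigma> n)) (scl (of_real L) (\<sigma> n))) = L * quad (\<sigma> n)"
      using \<sigma>H by (simp add: form_scl_right)
    then have "(nrm (T (\<sigma> n) - scl (of_real L) (\<sigma> n)))\<^sup>2 =
        (nrm (T (\<sigma> n)))\<^sup>2 - 2 * (L * quad (\<sigma> n)) + L\<^sup>2 * (nrm (\<sigma> n))\<^sup>2"
      using \<sigma>H L by (simp add: nrm_diff_sq nrm_scl power_mult_distrib)
    \<comment> \<open>\<open>nrm_T_sq_le\<close> replaces the squared norm of the image by
      \<open>L * quad\<close>, and the whole collapses to \<open>L * (L - quad)\<close>, which the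
      choice of the sequence makes small.\<close>
    also have "\<dots> \<le> L * quad (\<sigma> n) - 2 * (L * quad (\<sigma> n)) + L\<^sup>2 * 1\<^sup>2"
      using nrm_T_sq_le[OF S \<sigma>(1)[of n]] \<sigma>(2)[of n] L
      by (intro add_mono diff_mono mult_left_mono power_mono) (auto simp: L_def)
    also have "\<dots> = L * (L - quad (\<sigma> n))" by (simp add: power2_eq_square algebra_simps)
    also have "\<dots> \<le> L * (1 / real (Suc n))"
      using \<sigma>(3)[of n] L by (intro mult_left_mono) auto
    finally show "(nrm (T (\<sigma> n) - scl (of_real L) (\<sigma> n)))\<^sup>2 \<le> L / real (Suc n)" by simp
  qed
  have lim0: "(\<lambda>n. sqrt (L / real (Suc n))) \<longlonglongrightarrow> 0"
  proof -
    have "(\<lambda>n. L / real (Suc n)) \<longlonglongrightarrow> 0" by real_asymp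
    from tendsto_real_sqrt[OF this] show ?thesis by simp
  qed
  obtain r g where r: "strict_mono (r :: nat \<Rightarrow> nat)" and g: "g \<in> H"
      and conv: "(\<lambda>n. nrm (T (\<sigma> (r n)) - g)) \<longlonglongrightarrow> 0"
    by (rule compact_operator_subsequence[where \<sigma> = \<sigma>, OF compact \<sigma>H \<sigma>(2)])
  \<comment> \<open>The images converge to \<open>g\<close> and differ from \<open>L\<close> times
    the vectors by little, so the only possible limit of the vectors is
    \<open>g / L\<close>.\<close>
  define e where "e = scl (of_real (1 / L)) g"
  have eH: "e \<in> H" using g by (simp add: e_def)
  have Le: "scl (of_real L) e = g"
    using L by (simp add: e_def scl_def fun_eq_iff)
  have "(\<lambda>n. sqrt (L / real (Suc (r n)))) \<longlonglongrightarrow> 0"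
    using LIMSEQ_subseq_LIMSEQ[OF lim0 r] unfolding o_def .
  from tendsto_mult_left[OF tendsto_add[OF this conv], of "1 / L"]
  have "(\<lambda>n. 1 / L * (sqrt (L / real (Suc (r n))) + nrm (T (\<sigma> (r n)) - g))) \<longlonglongrightarrow> 0"
    unfolding add_0_left mult_zero_right .
  moreover have "nrm (\<sigma> (r n) - e) \<le> 1 / L * (sqrt (L / real (Suc (r n))) + nrm (T (\<sigma> (r n)) - g))" for n
  proof -
    have "scl (of_real L) (\<sigma> (r n) - e) = scl (of_real L) (\<sigma> (r n)) - g"
      by (simp add: Le[symmetric] fun_eq_iff algebra_simps)
    moreover have "nrm (scl (of_real L) (\<sigma> (r n) - e)) = L * nrm (\<sigma> (r n) - e)"
      using nrm_scl[OF diff_mem[OF \<sigma>H eH]] L by simp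
    ultimately have "L * nrm (\<sigma> (r n) - e) = nrm (scl (of_real L) (\<sigma> (r n)) - g)"
      by metis
    also have "nrm (scl (of_real L) (\<sigma> (r n)) - g) \<le>
        nrm (scl (of_real L) (\<sigma> (r n)) - T (\<sigma> (r n))) + nrm (T (\<sigma> (r n)) - g)"
      using \<sigma>H g by (intro nrm_diff_triangle) auto
    also have "\<dots> \<le> sqrt (L / real (Suc (r n))) + nrm (T (\<sigma> (r n)) - g)"
      using near[of "r n"] nrm_diff_commute[of "T (\<sigma> (r n))"] by simp
    finally show ?thesis using L by (simp add: pos_le_divide_eq mult.commute)
  qed
  ultimately have conv_e: "(\<lambda>n. nrm (\<sigma> (r n) - e)) \<longlonglongrightarrow> 0"
    using tendsto_0_squeeze[where u = "\<lambda>n. nrm (\<sigma> (r n) - e)"] nrm_nonneg by blast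
  have "e \<in> perp S"
  proof -
    have "ip e s = 0" if s: "s \<in> S" for s
    proof -
      have "(\<lambda>n. ip (\<sigma> (r n)) s) \<longlonglongrightarrow> ip e s"
        using \<sigma>H eH s S(2) conv_e by (intro ip_tendsto) auto
      moreover have "(\<lambda>n. ip (\<sigma> (r n)) s) = (\<lambda>_. 0)"
        using \<sigma>(1) s by (auto simp: perp_def)
      ultimately show ?thesis by (simp add: LIMSEQ_const_iff)
    qed
    then show ?thesis using eH by (simp add: perp_def)
  qed
  have "T e = g"
  proof -
    obtain M where M: "0 \<le> M" "\<And>f. f \<in> H \<Longrightarrow> nrm (T f) \<le> M * nrm f"
      using compact_operator_bounded[OF compact] by blast
    have "(\<lambda>n. nrm (T (\<sigma> (r n)) - T e)) \<longlonglongrightarrow> 0"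
    proof (rule tendsto_sandwich[OF _ _ tendsto_const])
      show "(\<lambda>n. M * nrm (\<sigma> (r n) - e)) \<longlonglongrightarrow> 0"
        using tendsto_mult_left[OF conv_e, of M] by simp
      show "\<forall>\<^sub>F n in sequentially. nrm (T (\<sigma> (r n)) - T e) \<le> M * nrm (\<sigma> (r n) - e)"
        using \<sigma>H eH M(2)[of "\<sigma> (r _) - e"] by (auto simp: T_diff)
    qed auto
    then show ?thesis
      using limit_unique[of "\<lambda>n. T (\<sigma> (r n))" "T e" g] \<sigma>H eH g conv by simp
  qed
  \<comment> \<open>Length at most one passes to the limit. Conversely the images have norm at least
    \<open>quad\<close>, which tends to \<open>L\<close>, while their limit \<open>g\<close> has
    norm \<open>L * nrm e\<close>.\<close>
  have "nrm e = 1"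
  proof (rule antisym)
    show "nrm e \<le> 1"
      using nrm_tendsto[OF _ eH conv_e] \<sigma>H \<sigma>(2) by (auto intro: LIMSEQ_le_const2)
    have "(\<lambda>n. nrm (T (\<sigma> (r n)))) \<longlonglongrightarrow> nrm g"
      using nrm_tendsto[OF _ g conv] \<sigma>H by simp
    moreover have "(\<lambda>n. L - 1 / real (Suc (r n))) \<longlonglongrightarrow> L - 0"
    proof -
      have "(\<lambda>n. 1 / real (Suc n)) \<longlonglongrightarrow> 0" by real_asymp
      from tendsto_diff[OF tendsto_const LIMSEQ_subseq_LIMSEQ[OF this r]] show ?thesis
        by (simp add: o_def)
    qed
    moreover have "L - 1 / real (Suc (r n)) \<le> nrm (T (\<sigma> (r n)))" for n
    proof -
      have "quad (\<sigma> (r n)) \<le> nrm (T (\<sigma> (r n))) * nrm (\<sigma> (r n))"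
        using cmod_ip_le[of "T (\<sigma> (r n))" "\<sigma> (r n)"] complex_Re_le_cmod \<sigma>H
        by (meson T_mem order_trans)
      also have "\<dots> \<le> nrm (T (\<sigma> (r n))) * 1" using \<sigma>(2) by (intro mult_left_mono) auto
      finally show ?thesis using \<sigma>(3)[of "r n"] by simp
    qed
    ultimately have "L \<le> nrm g" by (auto intro: LIMSEQ_le)
    also have "nrm g = L * nrm e" using L eH by (simp add: Le[symmetric] nrm_scl)
    finally show "1 \<le> nrm e" using L by simp
  qed
  then show ?thesis
    using \<open>e \<in> perp S\<close> \<open>T e = g\<close> Le True by (intro bexI[of _ e]) (auto simp: L_def)
qed

end

section \<open>Eigenvalues and eigenvectors by successive maximisation\<close>

context positive_compact_operator
begin

text \<open>Once the supremum is \<open>0\<close> the vector is \<open>0\<close>, so that an operator of finite rank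
  gets a sequence of eigenvalues that is padded by zeros.\<close>

definition top_vec :: "('a \<Rightarrow> complex) set \<Rightarrow> 'a \<Rightarrow> complex" where
  "top_vec S = (SOME e. e \<in> perp S \<and> T e = scl (of_real (top_val S)) e \<and>
    (if top_val S > 0 then nrm e = 1 else e = 0))"

primrec eigs :: "nat \<Rightarrow> ('a \<Rightarrow> complex) set" where
  "eigs 0 = {}"
| "eigs (Suc n) = insert (top_vec (eigs n)) (eigs n)"

definition eigvec :: "nat \<Rightarrow> 'a \<Rightarrow> complex" where "eigvec n = top_vec (eigs n)"

definition eigval :: "nat \<Rightarrow> real" where "eigval n = top_val (eigs n)"

lemma top_vec:
  assumes "\<And>e. e \<in> S \<Longrightarrow> \<exists>c. T e = scl c e" "S \<subseteq> H"
  shows "top_vec S \<in> perp S" "T (top_vec S) = scl (of_real (top_val S)) (top_vec S)"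
    "if top_val S > 0 then nrm (top_vec S) = 1 else top_vec S = 0"
  using someI_ex[of "\<lambda>e. e \<in> perp S \<and> T e = scl (of_real (top_val S)) e \<and>
    (if top_val S > 0 then nrm e = 1 else e = 0)"] top_val_attained[OF assms]
  unfolding top_vec_def by blast+

lemma eigs: "(\<forall>e\<in>eigs n. \<exists>c. T e = scl c e) \<and> eigs n \<subseteq> H"
proof (induction n)
  case (Suc n)
  have "\<exists>c. T e = scl c e" if "e \<in> eigs (Suc n)" for e
  proof (cases "e = top_vec (eigs n)")
    case True
    then show ?thesis using top_vec(2)[of "eigs n"] Suc by blast
  next
    case False
    then show ?thesis using Suc that by (simp del: scl_apply)
  qed
  moreover have "top_vec (eigs n) \<in> H" using top_vec(1)[of "eigs n"] Suc unfolding perp_def by blast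
  ultimately show ?case using Suc by (simp del: scl_apply)
qed simp

lemma eigs_mono: "m \<le> n \<Longrightarrow> eigs m \<subseteq> eigs n"
  by (induction n) (auto simp: le_Suc_eq)

lemma eigvec_in_eigs: "m < n \<Longrightarrow> eigvec m \<in> eigs n"
  using eigs_mono[of "Suc m" n] by (auto simp: eigvec_def)

lemma eigs_eq: "eigs n = eigvec ` {..<n}"
  by (induction n) (auto simp: eigvec_def lessThan_Suc)

lemma eigvec_mem [simp]: "eigvec n \<in> H"
  and T_eigvec: "T (eigvec n) = scl (of_real (eigval n)) (eigvec n)"
  and nrm_eigvec: "nrm (eigvec n) = (if eigval n > 0 then 1 else 0)"
  and eigvec_eq_0: "eigval n = 0 \<Longrightarrow> eigvec n = 0"
  using top_vec[of "eigs n"] eigs[of n] by (auto simp: perp_def eigvec_def eigval_def split: if_splits)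

lemma ip_eigvec_neq: "m \<noteq> n \<Longrightarrow> ip (eigvec m) (eigvec n) = 0"
proof (induction m n rule: linorder_wlog)
  case (le m n)
  have "eigvec n \<in> perp (eigs n)"
    using top_vec(1)[of "eigs n"] eigs[of n] by (auto simp: eigvec_def)
  then have "ip (eigvec n) (eigvec m) = 0"
    using eigvec_in_eigs[of m n] le by (auto simp: perp_def)
  then show ?case using form_commute[of "eigvec n" "eigvec m"] by simp
next
  case (sym m n)
  then show ?case using form_commute[of "eigvec n" "eigvec m"] by (metis complex_cnj_zero eigvec_mem)
qed

lemma eigval_nonneg [simp]: "0 \<le> eigval n"
  using eigs[of n] by (simp add: eigval_def top_val_nonneg)

lemma decseq_eigval: "decseq eigval"
  unfolding decseq_def eigval_def by (intro allI impI top_val_antimono eigs_mono eigs[THEN conjunct2])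

text \<open>Takes the place of normalisation: an eigenvector is either a unit vector or, in the
  padding, zero, and then the coefficient vanishes as well.\<close>

lemma ip_eigvec_self: "ip f (eigvec n) * ip (eigvec n) (eigvec n) = ip f (eigvec n)" if "f \<in> H"
proof (cases "eigval n = 0")
  case True
  then show ?thesis using eigvec_eq_0[of n] that by simp
next
  case False
  then have "0 < eigval n" using eigval_nonneg[of n] by (simp add: less_le)
  then have "nrm (eigvec n) = 1" using nrm_eigvec[of n] by simp
  then show ?thesis by (simp add: ip_self)
qed

text \<open>If the eigenvalues stayed above some \<open>L > 0\<close>, the images of the orthonormal
  eigenvectors would be pairwise at distance at least \<open>L\<close>, and no subsequence of them
  could converge.\<close>

lemma eigval_tendsto_0: "eigval \<longlonglongrightarrow> 0"
proof -
  obtain L where L: "eigval \<longlonglongrightarrow> L" "\<And>n. L \<le> eigval n"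
    using decseq_convergent[OF decseq_eigval, of 0] by auto
  have "L = 0"
  proof (rule ccontr)
    assume "L \<noteq> 0"
    moreover have "0 \<le> L" by (rule LIMSEQ_le_const[OF L(1)]) auto
    ultimately have pos: "L > 0" by simp
    then have ev: "eigval n > 0" for n using L(2)[of n] by linarith
    then have n1: "nrm (eigvec n) = 1" for n using nrm_eigvec[of n] by simp
    obtain r g where r: "strict_mono (r :: nat \<Rightarrow> nat)" and g: "g \<in> H"
      and conv: "(\<lambda>n. nrm (T (eigvec (r n)) - g)) \<longlonglongrightarrow> 0"
      by (rule compact_operator_subsequence[where \<sigma> = eigvec, OF compact eigvec_mem eq_refl[OF n1]])
    have "\<forall>\<^sub>F n in sequentially. nrm (T (eigvec (r n)) - g) < L / 2"
      using conv pos by (intro order_tendstoD) auto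
    then obtain N where N: "\<And>n. n \<ge> N \<Longrightarrow> nrm (T (eigvec (r n)) - g) < L / 2"
      by (auto simp: eventually_sequentially)
    let ?a = "r N" let ?b = "r (Suc N)"
    have ab: "?a \<noteq> ?b" using strict_monoD[OF r, of N "Suc N"] by simp
    have "(nrm (T (eigvec ?a) - T (eigvec ?b)))\<^sup>2 = (eigval ?a)\<^sup>2 + (eigval ?b)\<^sup>2"
      using ip_eigvec_neq[OF ab] n1
      by (simp add: nrm_diff_sq T_eigvec form_scl form_scl_right nrm_scl)
    moreover have "L\<^sup>2 \<le> (eigval ?a)\<^sup>2" using L(2) pos by (intro power_mono) auto
    ultimately have "L\<^sup>2 \<le> (nrm (T (eigvec ?a) - T (eigvec ?b)))\<^sup>2"
      using zero_le_power2[of "eigval ?b"] by linarith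
    then have "L \<le> nrm (T (eigvec ?a) - T (eigvec ?b))"
      using pos by (simp add: power2_le_iff_abs_le)
    also have "\<dots> \<le> nrm (T (eigvec ?a) - g) + nrm (g - T (eigvec ?b))"
      using g by (intro nrm_diff_triangle) auto
    also have "\<dots> < L / 2 + L / 2"
      using N[of N] N[of "Suc N"] nrm_diff_commute[of g] by (intro add_strict_mono) auto
    finally show False by simp
  qed
  then show ?thesis using L by simp
qed

text \<open>What is left of \<open>f\<close> after projecting away the first \<open>n\<close>
  eigenvectors. By orthogonality the coefficients of \<open>f\<close> itself may be used, instead of
  those of the previous residual; padding vectors subtract nothing.\<close>

primrec res :: "('a \<Rightarrow> complex) \<Rightarrow> nat \<Rightarrow> 'a \<Rightarrow> complex" where
  "res f 0 = f"
| "res f (Suc n) = res f n - scl (ip f (eigvec n)) (eigvec n)"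

lemma res_mem [simp]: "f \<in> H \<Longrightarrow> res f n \<in> H"
  by (induction n) auto

lemma ip_res: "f \<in> H \<Longrightarrow> ip (res f n) (eigvec k) = (if k < n then 0 else ip f (eigvec k))"
proof (induction n)
  case (Suc n)
  have "ip (res f (Suc n)) (eigvec k) = ip (res f n) (eigvec k) - ip f (eigvec n) * ip (eigvec n) (eigvec k)"
    using Suc.prems by (simp add: form_diff form_scl)
  then show ?case
    using ip_eigvec_self[of f n] ip_eigvec_neq[of n k] Suc
    by (cases "k = n") (simp_all add: less_Suc_eq del: minus_apply scl_apply)
qed simp

lemma res_perp: "f \<in> H \<Longrightarrow> res f n \<in> perp (eigs n)"
  by (auto simp: perp_def eigs_eq ip_res)

lemma quad_perp_le: "f \<in> perp (eigs n) \<Longrightarrow> quad f \<le> eigval n * (nrm f)\<^sup>2"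
  unfolding eigval_def using quad_le_top_val eigs by blast

lemma nrm_res_sq: "f \<in> H \<Longrightarrow> (nrm (res f n))\<^sup>2 = (nrm f)\<^sup>2 - (\<Sum>k<n. (cmod (ip f (eigvec k)))\<^sup>2)"
proof (induction n)
  case (Suc n)
  let ?c = "ip f (eigvec n)"
  have "Re (cnj ?c * ?c) = (cmod ?c)\<^sup>2"
    by (metis Re_complex_of_real complex_norm_square mult.commute)
  moreover have "(cmod ?c)\<^sup>2 * Re (ip (eigvec n) (eigvec n)) = (cmod ?c)\<^sup>2"
    using nrm_eigvec[of n] eigvec_eq_0[of n] eigval_nonneg[of n] Suc.prems
    by (cases "eigval n = 0") (auto simp: nrm_sq[symmetric])
  moreover have "(nrm (res f (Suc n)))\<^sup>2 = (nrm (res f n))\<^sup>2 - 2 * Re (cnj ?c * ?c) +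
      (cmod ?c)\<^sup>2 * Re (ip (eigvec n) (eigvec n))"
    using form_diff_scl_self[of "res f n" "eigvec n" ?c] Suc.prems by (simp add: nrm_sq ip_res)
  ultimately have "(nrm (res f (Suc n)))\<^sup>2 = (nrm (res f n))\<^sup>2 - (cmod ?c)\<^sup>2" by linarith
  then show ?case using Suc by (simp del: minus_apply scl_apply)
qed simp

lemma Bessel: "f \<in> H \<Longrightarrow> (\<Sum>k<n. (cmod (ip f (eigvec k)))\<^sup>2) \<le> (nrm f)\<^sup>2"
  using nrm_res_sq[of f n] zero_le_power2[of "nrm (res f n)"] by linarith

lemma quad_res:
  "f \<in> H \<Longrightarrow> quad (res f n) = quad f - (\<Sum>k<n. eigval k * (cmod (ip f (eigvec k)))\<^sup>2)"
proof (induction n)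
  case (Suc n)
  let ?c = "ip f (eigvec n)"
  interpret TF: semi_inner_form H "\<lambda>f g. ip (T f) g" by (rule semi_inner_form_T)
  have e1: "Re (cnj ?c * ?c) = (cmod ?c)\<^sup>2"
    by (metis Re_complex_of_real complex_norm_square mult.commute)
  have e2: "(cmod ?c)\<^sup>2 * Re (ip (eigvec n) (eigvec n)) = (cmod ?c)\<^sup>2"
    using nrm_eigvec[of n] eigvec_eq_0[of n] eigval_nonneg[of n] Suc.prems
    by (cases "eigval n = 0") (auto simp: nrm_sq[symmetric])
  have "ip (T (res f n)) (eigvec n) = of_real (eigval n) * ?c"
    using Suc.prems by (simp add: symmetric T_eigvec form_scl_right ip_res)
  then have e3: "Re (cnj ?c * ip (T (res f n)) (eigvec n)) = eigval n * (cmod ?c)\<^sup>2"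
    unfolding cmod_power2 by (simp add: power2_eq_square algebra_simps)
  have e4: "(cmod ?c)\<^sup>2 * quad (eigvec n) = eigval n * (cmod ?c)\<^sup>2"
    using e2 by (auto simp: T_eigvec form_scl)
  have "quad (res f (Suc n)) = quad (res f n) - 2 * Re (cnj ?c * ip (T (res f n)) (eigvec n)) +
      (cmod ?c)\<^sup>2 * quad (eigvec n)"
    using TF.form_diff_scl_self[of "res f n" "eigvec n" ?c] Suc.prems by simp
  then have "quad (res f (Suc n)) = quad (res f n) - eigval n * (cmod ?c)\<^sup>2"
    using e3 e4 by linarith
  then show ?case using Suc by (simp del: minus_apply scl_apply)
qed simp

text \<open>The error of a partial sum is \<open>quad\<close> of a residual. It is nonnegative, and
  at most \<open>eigval n\<close> times the squared norm of \<open>f\<close> since the residual is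
  orthogonal to the first \<open>n\<close> eigenvectors.\<close>

lemma quad_sums: "f \<in> H \<Longrightarrow> (\<lambda>k. eigval k * (cmod (ip f (eigvec k)))\<^sup>2) sums quad f"
  unfolding sums_def
proof (rule LIM_zero_cancel, rule tendsto_rabs_zero_cancel, rule tendsto_sandwich[OF _ _ tendsto_const])
  assume f: "f \<in> H"
  show "(\<lambda>n. eigval n * (nrm f)\<^sup>2) \<longlonglongrightarrow> 0"
    using tendsto_mult_right[OF eigval_tendsto_0, of "(nrm f)\<^sup>2"] by simp
  show "\<forall>\<^sub>F n in sequentially. \<bar>(\<Sum>k<n. eigval k * (cmod (ip f (eigvec k)))\<^sup>2) - quad f\<bar> \<le> eigval n * (nrm f)\<^sup>2"
  proof (intro always_eventually allI)
    fix n
    have "quad (res f n) \<le> eigval n * (nrm (res f n))\<^sup>2" using f by (simp add: quad_perp_le res_perp)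
    also have "\<dots> \<le> eigval n * (nrm f)\<^sup>2"
      using nrm_res_sq[OF f, of n] by (intro mult_left_mono) (auto intro: sum_nonneg)
    finally show "\<bar>(\<Sum>k<n. eigval k * (cmod (ip f (eigvec k)))\<^sup>2) - quad f\<bar> \<le> eigval n * (nrm f)\<^sup>2"
      using quad_res[OF f, of n] positive[of "res f n"] f by simp
  qed
qed auto

text \<open>The expansion gives \<open>quad f = 0\<close>, and \<open>nrm_T_power4_le\<close> turns
  this into \<open>T f = 0\<close>.\<close>

lemma eq_0_if_orthogonal:
  assumes "f \<in> H" "\<And>k. ip f (eigvec k) = 0"
  shows "T f = 0"
proof -
  have "(\<lambda>k. 0) sums quad f" using quad_sums[OF assms(1)] by (simp add: assms(2))
  then have "quad f = 0" by (rule sums_unique2[OF _ sums_zero])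
  then have "(nrm (T f)) ^ 4 \<le> 0"
    using nrm_T_power4_le[OF assms(1)] by simp
  then have "nrm (T f) = 0" using nrm_nonneg[of "T f"] by (simp add: power_le_zero_eq)
  then show ?thesis using assms(1) nrm_eq_0_iff by simp
qed

lemma adjoint_operator_eq: "g \<in> H \<Longrightarrow> adjoint_operator H ip T g = T g"
  unfolding adjoint_operator_def
proof (rule the_equality)
  assume g: "g \<in> H"
  show "T g \<in> H \<and> (\<forall>f\<in>H. ip (T f) g = ip f (T g))" using g symmetric by simp
  fix h assume h: "h \<in> H \<and> (\<forall>f\<in>H. ip (T f) g = ip f h)"
  then have "ip (h - T g) h = ip (h - T g) (T g)" using g symmetric[of "h - T g" g] by simp
  then have "ip (h - T g) (h - T g) = 0" using g h by (simp add: form_diff_right)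
  then have "h - T g = 0" using g h by (intro ip_definite) auto
  then show "h = T g" by simp
qed

lemma finite_eigval_eq: "t > 0 \<Longrightarrow> finite {n. eigval n = t}"
proof -
  assume t: "t > 0"
  have "\<forall>\<^sub>F n in sequentially. eigval n < t" using eigval_tendsto_0 t by (rule order_tendstoD)
  then obtain N where "\<And>n. n \<ge> N \<Longrightarrow> eigval n < t" by (auto simp: eventually_sequentially)
  then have "{n. eigval n = t} \<subseteq> {..<N}"
    by (intro subsetI) (metis lessThan_iff linorder_not_le mem_Collect_eq less_irrefl)
  then show ?thesis using finite_subset by blast
qed

text \<open>Since the adjoint is \<open>T\<close>, this is the eigenspace of \<open>T\<close>
  squared. A member has coefficients only along eigenvectors with eigenvalue \<open>t\<close>; after
  these finitely many are subtracted, the rest is orthogonal to all eigenvectors, so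
  \<open>T\<close> kills it, while \<open>T\<close> squared multiplies it by the positive number
  \<open>t^2\<close>.\<close>

lemma dim_eigenspace:
  assumes t: "t > 0"
  shows "fun_vs.dim {f\<in>H. adjoint_operator H ip T (T f) = (\<lambda>x. of_real (t\<^sup>2) * f x)} = card {n. eigval n = t}"
proof -
  define E where "E = {f\<in>H. T (T f) = scl (of_real (t\<^sup>2)) f}"
  have E: "{f\<in>H. adjoint_operator H ip T (T f) = (\<lambda>x. of_real (t\<^sup>2) * f x)} = E"
    by (auto simp: E_def adjoint_operator_eq scl_def)
  have EH: "f \<in> H" and ET: "T (T f) = scl (of_real (t\<^sup>2)) f" if "f \<in> E" for f
    using that unfolding E_def mem_Collect_eq by blast+
  have EI: "f \<in> E" if "f \<in> H" "T (T f) = scl (of_real (t\<^sup>2)) f" for f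
    using that unfolding E_def mem_Collect_eq by blast
  define I where "I = {n. eigval n = t}"
  define B where "B = eigvec ` I"
  have fin: "finite I" using finite_eigval_eq[OF t] by (simp add: I_def)
  have one: "ip (eigvec n) (eigvec n) = 1" if "n \<in> I" for n
    using nrm_eigvec[of n] that t by (simp add: I_def ip_self)
  have inj: "inj_on eigvec I"
    by (rule inj_onI) (metis ip_eigvec_neq one zero_neq_one)
  have BE: "B \<subseteq> E"
  proof -
    have TT: "T (T (eigvec n)) = scl (of_real (t\<^sup>2)) (eigvec n)" if n: "n \<in> I" for n
    proof -
      have "eigval n = t" using n unfolding I_def by blast
      then have "T (eigvec n) = scl (of_real t) (eigvec n)" using T_eigvec[of n] by metis
      then have "T (T (eigvec n)) = scl (of_real t) (scl (of_real t) (eigvec n))"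
        using T_scl[OF eigvec_mem] by metis
      also have "\<dots> = scl (of_real (t\<^sup>2)) (eigvec n)" by (simp add: fun_eq_iff power2_eq_square)
      finally show ?thesis .
    qed
    show ?thesis
    proof
      fix f assume "f \<in> B"
      then obtain n where f: "f = eigvec n" "n \<in> I" unfolding B_def by (rule imageE)
      show "f \<in> E" unfolding f(1) by (intro EI eigvec_mem TT[OF f(2)])
    qed
  qed
  \<comment> \<open>Symmetry moves \<open>T\<close> squared onto the eigenvector. Both
    \<open>t\<close> and \<open>eigval k\<close> are nonnegative, so different values have different
    squares.\<close>
  have coeff: "ip f (eigvec k) = 0" if f: "f \<in> E" and k: "k \<notin> I" for f k
  proof -
    note fH = EH[OF f]
    have "of_real (t\<^sup>2) * ip f (eigvec k) = ip (T (T f)) (eigvec k)"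
      unfolding ET[OF f] by (rule form_scl[OF fH eigvec_mem, symmetric])
    also have "\<dots> = of_real ((eigval k)\<^sup>2) * ip f (eigvec k)"
    proof -
      have "T (T (eigvec k)) = scl (of_real (eigval k)) (scl (of_real (eigval k)) (eigvec k))"
        by (simp only: T_eigvec T_scl eigvec_mem)
      moreover have "ip (T (T f)) (eigvec k) = ip f (T (T (eigvec k)))"
        by (simp only: symmetric T_mem fH eigvec_mem)
      ultimately show ?thesis
        by (simp only: form_scl_right fH scl_mem eigvec_mem complex_cnj_complex_of_real
            power2_eq_square of_real_mult mult.assoc)
    qed
    finally have "of_real (t\<^sup>2 - (eigval k)\<^sup>2) * ip f (eigvec k) = 0" by (simp add: algebra_simps)
    moreover have "t\<^sup>2 \<noteq> (eigval k)\<^sup>2" using k t eigval_nonneg[of k] unfolding I_def by (metis mem_Collect_eq power2_eq_imp_eq less_imp_le)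
    ultimately show ?thesis by (metis mult_eq_0_iff of_real_eq_0_iff eq_iff_diff_eq_0)
  qed
  have "E \<subseteq> fun_vs.span B"
  proof
    fix f assume f: "f \<in> E"
    note fH = EH[OF f]
    have "\<exists>m. \<forall>n\<in>I. n < m" using fin by (simp only: finite_nat_set_iff_bounded)
    then obtain m where m0: "\<forall>n\<in>I. n < m" by (rule exE)
    have m: "n < m" if "n \<in> I" for n using m0 that by (rule bspec)
    \<comment> \<open>Both claims survive each step: for an index outside \<open>I\<close> the
      coefficient is zero, and for one inside \<open>I\<close> the subtracted vector lies in
      \<open>E\<close> and in the span.\<close>
    have "res f n \<in> E \<and> f - res f n \<in> fun_vs.span B" for n
    proof (induction n)
      case 0
      show ?case using f fun_vs.span_zero[of B] by (simp only: res.simps diff_self simp_thms)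
    next
      case (Suc n)
      show ?case
      proof (cases "n \<in> I")
        case False
        then show ?thesis using coeff[OF f False] Suc by (simp only: res.simps scl_zero diff_zero)
      next
        case True
        have eE: "eigvec n \<in> E" "eigvec n \<in> B" using True BE by (auto simp: B_def)
        have "res f (Suc n) \<in> E"
        proof (rule EI)
          have "T (T (res f (Suc n))) = T (T (res f n)) - scl (ip f (eigvec n)) (T (T (eigvec n)))"
            using fH by (simp add: T_diff T_scl)
          also have "\<dots> = scl (of_real (t\<^sup>2)) (res f (Suc n))"
            unfolding ET[OF eE(1)] ET[OF conjunct1[OF Suc]] by (simp add: fun_eq_iff algebra_simps)
          finally show "T (T (res f (Suc n))) = scl (of_real (t\<^sup>2)) (res f (Suc n))" .
        qed (use fH in simp)
        moreover have "scl (ip f (eigvec n)) (eigvec n) \<in> fun_vs.span B"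
          unfolding scl_def by (intro fun_vs.span_scale fun_vs.span_base eE)
        then have "(f - res f n) + scl (ip f (eigvec n)) (eigvec n) \<in> fun_vs.span B"
          by (rule fun_vs.span_add[OF conjunct2[OF Suc]])
        moreover have "f - res f (Suc n) = (f - res f n) + scl (ip f (eigvec n)) (eigvec n)"
          by (simp only: res.simps diff_diff_eq2 add_diff_eq diff_add_eq)
        ultimately show ?thesis by (simp only:)
      qed
    qed
    note r = this[of m]
    have "ip (res f m) (eigvec k) = 0" for k
      using m[of k] coeff[OF f, of k] fH by (cases "k \<in> I") (auto simp: ip_res)
    then have "T (res f m) = 0" using fH by (intro eq_0_if_orthogonal) auto
    then have "scl (of_real (t\<^sup>2)) (res f m) = 0" using ET[OF conjunct1[OF r]] by simp
    from fun_cong[OF this] have "of_real (t\<^sup>2) * res f m x = 0" for x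
      by (simp only: scl_apply zero_fun_apply)
    then have "res f m x = 0" for x using t by simp
    then have "res f m = 0" by (simp add: fun_eq_iff)
    then show "f \<in> fun_vs.span B" using conjunct2[OF r] by (simp only: diff_zero)
  qed
  moreover have "\<not> fun_vs.dependent B"
  proof (rule fun_vs.independent_if_scalars_zero)
    show "finite B" using fin by (simp add: B_def)
    fix c v assume 0: "(\<Sum>v\<in>B. (\<lambda>x. c v * v x)) = 0" and v: "v \<in> B"
    have vH: "v \<in> H" and BH: "\<And>u. u \<in> B \<Longrightarrow> u \<in> H" using v by (auto simp: B_def)
    have "ip (\<Sum>v\<in>B. scl (c v) v) v = (\<Sum>u\<in>B. ip (scl (c u) u) v)"
      using form_sum[of B "\<lambda>v. scl (c v) v" v] \<open>finite B\<close> BH vH by auto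
    also have "\<dots> = (\<Sum>u\<in>B. if u = v then c v else 0)"
    proof (rule sum.cong[OF refl])
      fix u assume u: "u \<in> B"
      obtain i j where ij: "i \<in> I" "j \<in> I" "u = eigvec i" "v = eigvec j" using u v by (auto simp: B_def)
      show "ip (scl (c u) u) v = (if u = v then c v else 0)"
        using ij one ip_eigvec_neq[of i j] by (cases "i = j") (auto simp: form_scl inj_on_eq_iff[OF inj])
    qed
    also have "\<dots> = c v" using \<open>finite B\<close> v by simp
    finally show "c v = 0" using 0 vH by (simp add: scl_def)
  qed
  ultimately have "fun_vs.dim E = card B"
    using BE fun_vs.dim_unique by blast
  then show ?thesis unfolding E using card_image[OF inj] by (simp add: B_def I_def)
qed

lemma singular_values_eq: "singular_values H ip T = eigval"
  unfolding singular_values_def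
proof (rule the_equality)
  show "decseq eigval \<and> (\<forall>n. 0 \<le> eigval n) \<and> (\<forall>t>0. finite {n. eigval n = t} \<and>
      card {n. eigval n = t} =
        fun_vs.dim {f \<in> H. adjoint_operator H ip T (T f) = (\<lambda>x. complex_of_real (t\<^sup>2) * f x)})"
    using decseq_eigval finite_eigval_eq dim_eigenspace by simp
  fix s :: "nat \<Rightarrow> real"
  assume s: "decseq s \<and> (\<forall>n. 0 \<le> s n) \<and> (\<forall>t>0. finite {n. s n = t} \<and>
      card {n. s n = t} =
        fun_vs.dim {f \<in> H. adjoint_operator H ip T (T f) = (\<lambda>x. complex_of_real (t\<^sup>2) * f x)})"
  show "s = eigval"
    by (rule decseq_eq_if_same_multiplicities[OF decseq_eigval])
      (use s eigval_tendsto_0 dim_eigenspace in auto)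
qed

end

section \<open>Riesz representation\<close>

locale function_hilbert_space = function_inner_space H ip for H :: "('a \<Rightarrow> complex) set" and ip +
  assumes complete: "\<And>\<sigma>. (\<And>n. \<sigma> n \<in> H) \<Longrightarrow>
    (\<And>\<epsilon>. \<epsilon> > 0 \<Longrightarrow> \<exists>N. \<forall>m\<ge>N. \<forall>n\<ge>N. nrm (\<sigma> m - \<sigma> n) < \<epsilon>) \<Longrightarrow>
    \<exists>f\<in>H. (\<lambda>n. nrm (\<sigma> n - f)) \<longlonglongrightarrow> 0"
begin

text \<open>The representing vector is a rescaling of the point \<open>u\<close> of least norm on
  the affine hyperplane where \<open>\<phi>\<close> equals 1.\<close>

lemma Riesz_representation:
  assumes add: "\<And>f g. f \<in> H \<Longrightarrow> g \<in> H \<Longrightarrow> \<phi> (f + g) = \<phi> f + \<phi> g"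
    and scale: "\<And>c f. f \<in> H \<Longrightarrow> \<phi> (scl c f) = c * \<phi> f"
    and bounded: "\<And>f. f \<in> H \<Longrightarrow> cmod (\<phi> f) \<le> C * nrm f"
  shows "\<exists>g\<in>H. \<forall>f\<in>H. \<phi> f = ip f g"
proof (cases "\<forall>f\<in>H. \<phi> f = 0")
  case True
  then show ?thesis by (intro bexI[of _ 0]) auto
next
  case False
  then obtain f0 where f0: "f0 \<in> H" "\<phi> f0 \<noteq> 0" by blast
  have diff: "\<phi> (f - g) = \<phi> f - \<phi> g" if "f \<in> H" "g \<in> H" for f g
    using that unfolding diff_eq_scl by (simp add: add scale)
  define A where "A = {f\<in>H. \<phi> f = 1}"
  have "scl (1 / \<phi> f0) f0 \<in> A" using f0 by (simp add: A_def scale)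
  then have ne: "nrm ` A \<noteq> {}" by blast
  have bdd: "bdd_below (nrm ` A)" by (rule bdd_belowI[of _ 0]) auto
  define d where "d = Inf (nrm ` A)"
  have d_le: "d \<le> nrm f" if "f \<in> A" for f
    unfolding d_def using bdd that by (intro cInf_lower) auto
  have d0: "0 \<le> d" unfolding d_def using ne by (intro cInf_greatest) auto
  have "\<exists>f\<in>A. nrm f < d + 1 / real (Suc n)" for n
    using cInf_lessD[OF ne, of "d + 1 / real (Suc n)"] by (auto simp: d_def)
  then obtain \<sigma> where \<sigma>: "\<And>n. \<sigma> n \<in> A" "\<And>n. nrm (\<sigma> n) < d + 1 / real (Suc n)" by metis
  have \<sigma>H: "\<sigma> n \<in> H" "\<phi> (\<sigma> n) = 1" for n using \<sigma>(1)[of n] by (auto simp: A_def)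
  \<comment> \<open>An upper bound for the excess of the squared norm of \<open>\<sigma> n\<close>
    over its infimum.\<close>
  define b where "b n = (d + 1 / real (Suc n))\<^sup>2 - d\<^sup>2" for n
  have lim_d: "(\<lambda>n. d + 1 / real (Suc n)) \<longlonglongrightarrow> d"
  proof -
    have "(\<lambda>n. 1 / real (Suc n)) \<longlonglongrightarrow> 0" by real_asymp
    from tendsto_add[OF tendsto_const this, of d] show ?thesis by simp
  qed
  from tendsto_diff[OF tendsto_power[OF this, of 2] tendsto_const, of "d\<^sup>2"]
  have b: "b \<longlonglongrightarrow> 0" unfolding b_def by simp
  \<comment> \<open>Parallelogram law: the midpoint of \<open>f\<close> and \<open>g\<close> still
    lies in \<open>A\<close>, hence has norm at least \<open>d\<close>. It makes the minimising
    sequence Cauchy.\<close>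
  have par: "(nrm (f - g))\<^sup>2 \<le> 2 * ((nrm f)\<^sup>2 - d\<^sup>2) + 2 * ((nrm g)\<^sup>2 - d\<^sup>2)" if "f \<in> A" "g \<in> A" for f g
  proof -
    have fg: "f \<in> H" "g \<in> H" using that by (auto simp: A_def)
    have "scl (1 / 2) (f + g) \<in> A" using that by (auto simp: A_def scale add)
    then have "d \<le> nrm (f + g) / 2" using d_le[of "scl (1 / 2) (f + g)"] fg by (simp add: nrm_scl norm_divide)
    then have "(2 * d)\<^sup>2 \<le> (nrm (f + g))\<^sup>2" using d0 by (intro power_mono) auto
    then show ?thesis using nrm_add_sq[OF fg] nrm_diff_sq[OF fg] by (simp add: power2_eq_square)
  qed
  have \<sigma>b: "(nrm (\<sigma> n))\<^sup>2 - d\<^sup>2 \<le> b n" for n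
    unfolding b_def using \<sigma>(2)[of n] by (intro diff_right_mono power_mono) auto
  have cauchy: "\<exists>N. \<forall>m\<ge>N. \<forall>n\<ge>N. nrm (\<sigma> m - \<sigma> n) < \<epsilon>" if \<epsilon>: "\<epsilon> > 0" for \<epsilon>
  proof -
    have "\<forall>\<^sub>F n in sequentially. b n < \<epsilon>\<^sup>2 / 4" using b \<epsilon> by (intro order_tendstoD) auto
    then obtain N where N: "\<And>n. n \<ge> N \<Longrightarrow> b n < \<epsilon>\<^sup>2 / 4" by (auto simp: eventually_sequentially)
    have "nrm (\<sigma> m - \<sigma> n) < \<epsilon>" if "m \<ge> N" "n \<ge> N" for m n
    proof -
      have "(nrm (\<sigma> m - \<sigma> n))\<^sup>2 < \<epsilon>\<^sup>2"
        using par[OF \<sigma>(1)[of m] \<sigma>(1)[of n]] \<sigma>b[of m] \<sigma>b[of n] N[OF that(1)] N[OF that(2)] by simp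
      then show ?thesis using \<epsilon> by (simp add: power_less_imp_less_base)
    qed
    then show ?thesis by blast
  qed
  obtain u where u: "u \<in> H" "(\<lambda>n. nrm (\<sigma> n - u)) \<longlonglongrightarrow> 0"
    using complete[of \<sigma>] \<sigma>H(1) cauchy by blast
  have phi_u: "\<phi> u = 1"
  proof -
    have "(\<lambda>n. cmod (\<phi> (\<sigma> n) - \<phi> u)) \<longlonglongrightarrow> 0"
    proof (rule tendsto_sandwich[OF _ _ tendsto_const])
      show "(\<lambda>n. C * nrm (\<sigma> n - u)) \<longlonglongrightarrow> 0" using tendsto_mult_left[OF u(2), of C] by simp
      show "\<forall>\<^sub>F n in sequentially. cmod (\<phi> (\<sigma> n) - \<phi> u) \<le> C * nrm (\<sigma> n - u)"
        using bounded[of "\<sigma> _ - u"] \<sigma>H(1) u(1) by (auto simp: diff)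
    qed auto
    then show ?thesis using \<sigma>H by (simp add: LIMSEQ_const_iff)
  qed
  have uA: "u \<in> A" using u phi_u by (simp add: A_def)
  have nrm_u: "nrm u = d"
  proof (rule antisym)
    note lim_d
    moreover have "(\<lambda>n. nrm (\<sigma> n)) \<longlonglongrightarrow> nrm u" using \<sigma>H u by (intro nrm_tendsto) auto
    ultimately show "nrm u \<le> d" using \<sigma>(2) by (intro LIMSEQ_le) (auto intro: less_imp_le)
  qed (rule d_le[OF uA])
  have orth: "ip u h = 0" if h: "h \<in> H" "\<phi> h = 0" for h
  proof -
    let ?w = "ip u h"
    \<comment> \<open>Moving \<open>u\<close> by \<open>t * ip u h\<close> along \<open>h\<close>
      keeps it in \<open>A\<close>. Minimality compares a term linear in \<open>t\<close> with a
      quadratic one, and letting \<open>t\<close> tend to 0 removes the linear term.\<close>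
    have ineq: "2 * (cmod ?w)\<^sup>2 \<le> t * ((cmod ?w)\<^sup>2 * (nrm h)\<^sup>2)" if t: "t > 0" for t :: real
    proof -
      let ?c = "of_real t * ?w"
      have "u - scl ?c h \<in> A" using u h phi_u by (simp add: A_def diff scale)
      then have "(nrm u)\<^sup>2 \<le> (nrm (u - scl ?c h))\<^sup>2" using d_le nrm_u d0 by (intro power_mono) auto
      also have "\<dots> = (nrm u)\<^sup>2 - 2 * Re (cnj ?c * ?w) + (cmod ?c)\<^sup>2 * (nrm h)\<^sup>2"
        using form_diff_scl_self[OF u(1) h(1), of ?c] by (simp only: nrm_sq)
      also have "Re (cnj ?c * ?w) = t * (cmod ?w)\<^sup>2"
        unfolding cmod_power2 by (simp add: power2_eq_square algebra_simps)
      also have "(cmod ?c)\<^sup>2 = t * (t * (cmod ?w)\<^sup>2)"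
        using t by (simp add: norm_mult power2_eq_square)
      finally have "t * (2 * (cmod ?w)\<^sup>2) \<le> t * (t * ((cmod ?w)\<^sup>2 * (nrm h)\<^sup>2))"
        by (simp add: algebra_simps)
      then show ?thesis using t by simp
    qed
    have "2 * (cmod ?w)\<^sup>2 \<le> 0"
    proof (rule LIMSEQ_le_const)
      have "(\<lambda>n. 1 / real (Suc n)) \<longlonglongrightarrow> 0" by real_asymp
      from tendsto_mult_right[OF this, of "(cmod ?w)\<^sup>2 * (nrm h)\<^sup>2"]
      show "(\<lambda>n. 1 / real (Suc n) * ((cmod ?w)\<^sup>2 * (nrm h)\<^sup>2)) \<longlonglongrightarrow> 0" by simp
      show "\<exists>N. \<forall>n\<ge>N. 2 * (cmod ?w)\<^sup>2 \<le> 1 / real (Suc n) * ((cmod ?w)\<^sup>2 * (nrm h)\<^sup>2)"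
        by (intro exI[of _ 0] allI impI ineq) simp
    qed
    then show ?thesis by simp
  qed
  have u0: "nrm u > 0"
    using bounded[OF u(1)] phi_u nrm_nonneg[of u] by (cases "nrm u = 0") (auto simp: less_le)
  \<comment> \<open>The factor is forced by \<open>\<phi> u = 1\<close>, which must equal
    \<open>ip u g\<close>.\<close>
  define g where "g = scl (of_real (1 / (nrm u)\<^sup>2)) u"
  have "\<phi> f = ip f g" if f: "f \<in> H" for f
  proof -
    let ?h = "f - scl (\<phi> f) u"
    have "?h \<in> H" "\<phi> ?h = 0" using f u phi_u by (auto simp: diff scale)
    then have "ip u ?h = 0" by (rule orth)
    then have "ip ?h u = 0" using form_commute[of u ?h] u f by simp
    then have "ip f u = \<phi> f * of_real ((nrm u)\<^sup>2)"
      using f u by (simp add: form_diff form_scl ip_self)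
    then show ?thesis using f u u0 by (simp add: g_def form_scl_right)
  qed
  moreover have "g \<in> H" using u by (simp add: g_def)
  ultimately show ?thesis by blast
qed

end

section \<open>Integral inequalities\<close>

lemma epowr_ennreal: "0 \<le> t \<Longrightarrow> epowr (ennreal t) p = ennreal (t powr p)"
  by (simp add: epowr_def)

lemma epowr_top [simp]: "epowr \<infinity> p = \<infinity>" "epowr top p = top"
  by (simp_all add: epowr_def)

lemma epowr_zero [simp]: "epowr 0 p = 0"
  by (simp add: epowr_def)

lemma epowr_mono: "0 \<le> p \<Longrightarrow> x \<le> y \<Longrightarrow> epowr x p \<le> epowr y p"
  by (cases x; cases y) (auto simp: epowr_ennreal top_unique intro: ennreal_leI powr_mono2)

lemma epowr_mult: "0 < p \<Longrightarrow> epowr (x * y) p = epowr x p * epowr y p"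
proof (cases x; cases y)
  fix a b assume "0 < p" "x = ennreal a" "0 \<le> a" "y = ennreal b" "0 \<le> b"
  then show ?thesis by (simp add: epowr_ennreal powr_mult ennreal_mult[symmetric])
next
  fix a assume "0 < p" "x = ennreal a" "0 \<le> a" "y = top"
  then show ?thesis by (cases "a = 0") (auto simp: epowr_ennreal ennreal_mult_top)
next
  fix b assume "0 < p" "x = top" "y = ennreal b" "0 \<le> b"
  then show ?thesis by (cases "b = 0") (auto simp: epowr_ennreal ennreal_top_mult)
qed (simp add: ennreal_top_mult)

lemma epowr_epowr: "p \<noteq> 0 \<Longrightarrow> epowr (epowr x p) (1 / p) = x" "p \<noteq> 0 \<Longrightarrow> epowr (epowr x (1 / p)) p = x"
  by (cases x; auto simp: epowr_ennreal powr_powr)+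

lemma epowr_less_top_iff [simp]: "epowr x p < top \<longleftrightarrow> x < top"
  by (cases x) (auto simp: epowr_ennreal)

lemma measurable_epowr [measurable]:
  assumes [measurable]: "f \<in> borel_measurable M"
  shows "(\<lambda>x. epowr (f x) p) \<in> borel_measurable M"
  unfolding epowr_def by measurable

text \<open>Young's inequality with exponents \<open>p\<close> and \<open>p / (p - 1)\<close>: the
  graph of the power lies above its tangent at \<open>a\<close>. The negative constant of the
  tangent is moved to the right, so that the inequality carries over to \<open>ennreal\<close>,
  where subtraction is truncated.\<close>

lemma powr_tangent_le:
  fixes t a p :: real
  assumes "0 \<le> t" "0 < a" "1 \<le> p"
  shows "p * a powr (p - 1) * t \<le> t powr p + (p - 1) * a powr p"
proof (cases "p = 1")
  case True
  then show ?thesis using assms by simp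
next
  case False
  then have p: "p > 1" using assms by simp
  have "t * a powr (p - 1) \<le> t powr p / p + (a powr (p - 1)) powr (p / (p - 1)) / (p / (p - 1))"
    using p assms by (intro Youngs_inequality) (auto simp: field_simps)
  also have "(a powr (p - 1)) powr (p / (p - 1)) = a powr p" using p by (simp add: powr_powr)
  finally show ?thesis using p by (simp add: field_simps)
qed

text \<open>Jensen's inequality, obtained by integrating the tangent line of \<open>t \<mapsto> t\<^sup>p\<close> at the mean value.\<close>

lemma nn_integral_epowr_ge:
  fixes Y p :: real
  assumes h: "h \<in> borel_measurable M" and Y: "0 < Y" "emeasure M (space M) \<le> ennreal Y" and p: "1 \<le> p"
  shows "epowr (\<integral>\<^sup>+x. h x \<partial>M) p \<le> ennreal (Y powr (p - 1)) * (\<integral>\<^sup>+x. epowr (h x) p \<partial>M)"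
proof -
  let ?J = "\<integral>\<^sup>+x. epowr (h x) p \<partial>M"
  have tangent: "ennreal (p * a powr (p - 1)) * u \<le> epowr u p + ennreal ((p - 1) * a powr p)"
    if "0 < a" for a u
  proof (cases u)
    case (real t)
    then show ?thesis
      using powr_tangent_le[of t a p] that p
      by (simp add: epowr_ennreal ennreal_mult[symmetric] ennreal_plus[symmetric] del: ennreal_plus)
  qed simp
  have int: "ennreal (p * a powr (p - 1)) * (\<integral>\<^sup>+x. h x \<partial>M) \<le> ?J + ennreal ((p - 1) * a powr p * Y)"
    if a: "0 < a" for a
  proof -
    have "ennreal (p * a powr (p - 1)) * (\<integral>\<^sup>+x. h x \<partial>M) = (\<integral>\<^sup>+x. ennreal (p * a powr (p - 1)) * h x \<partial>M)"
      using h by (simp add: nn_integral_cmult)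
    also have "\<dots> \<le> (\<integral>\<^sup>+x. epowr (h x) p + ennreal ((p - 1) * a powr p) \<partial>M)"
      by (intro nn_integral_mono tangent a)
    also have "\<dots> = ?J + ennreal ((p - 1) * a powr p) * emeasure M (space M)"
      using h by (simp add: nn_integral_add)
    also have "\<dots> \<le> ?J + ennreal ((p - 1) * a powr p) * ennreal Y"
      using Y by (intro add_left_mono mult_left_mono) auto
    finally show ?thesis using p Y by (simp add: ennreal_mult)
  qed
  show ?thesis
  proof (cases "?J = top")
    case True
    then show ?thesis using Y by (simp add: ennreal_mult_top)
  next
    case False
    then obtain J where J: "?J = ennreal J" "0 \<le> J" by (cases "?J") auto
    \<comment> \<open>Finiteness also comes from a tangent line, the one at 1.\<close>
    have "(\<integral>\<^sup>+x. h x \<partial>M) \<noteq> top"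
      using int[of 1] p by (auto simp: J ennreal_mult_top top_unique)
    then obtain A where A: "(\<integral>\<^sup>+x. h x \<partial>M) = ennreal A" "0 \<le> A" by (cases "\<integral>\<^sup>+x. h x \<partial>M") auto
    show ?thesis
    proof (cases "A = 0")
      case False
      \<comment> \<open>The mean of \<open>h\<close> if the mass is \<open>Y\<close>. As
        \<open>Y\<close> is only an upper bound for the mass, sub-probability measures are covered
        by \<open>Y = 1\<close>.\<close>
      define a where "a = A / Y"
      have a: "a > 0" using A Y False by (simp add: a_def)
      have "ennreal (p * a powr (p - 1) * A) \<le> ennreal (J + (p - 1) * a powr p * Y)"
        using int[OF a] p J Y A by (simp add: ennreal_mult'' ennreal_plus)
      then have le: "p * a powr (p - 1) * A \<le> J + (p - 1) * a powr p * Y"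
        using p J Y A by (subst (asm) ennreal_le_iff) auto
      have "a powr (p - 1) * A = a powr p * Y"
        using A False Y by (simp add: a_def powr_diff)
      then have eq: "p * a powr (p - 1) * A = p * (a powr p * Y)" by (simp only: mult.assoc)
      have "p * (a powr p * Y) \<le> J + (p - 1) * (a powr p * Y)"
        using le unfolding mult.assoc eq[unfolded mult.assoc] .
      then have "a powr p * Y \<le> J" unfolding left_diff_distrib mult_1 by linarith
      moreover have "a powr p * Y = A powr p / Y powr (p - 1)"
        using A Y by (simp add: a_def powr_divide powr_diff)
      ultimately have "A powr p / Y powr (p - 1) \<le> J" by simp
      then have "A powr p \<le> Y powr (p - 1) * J" using Y by (simp add: pos_divide_le_eq mult.commute)
      then show ?thesis unfolding A J using A J by (simp add: epowr_ennreal ennreal_mult[symmetric] ennreal_leI)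
    qed (simp add: A)
  qed
qed

section \<open>Area and pointwise bounds for entire functions\<close>

lemma emeasure_lborel_ball_complex:
  "0 \<le> r \<Longrightarrow> emeasure lborel (ball (z::complex) r) = ennreal (pi * r\<^sup>2)"
  by (simp add: emeasure_ball unit_ball_vol_2)

text \<open>Circles of radius \<open>r / 2\<close> about points of the half disk stay where
  \<open>B\<close> bounds \<open>g\<close>, so the derivative is at most \<open>2 * B / r\<close>
  there.\<close>

lemma Cauchy_Lipschitz:
  assumes g: "g holomorphic_on UNIV" and r: "0 < r"
    and B: "\<And>\<xi>. \<xi> \<in> cball z r \<Longrightarrow> cmod (g \<xi>) \<le> B" and \<xi>: "dist z \<xi> \<le> r / 2"
  shows "cmod (g \<xi> - g z) \<le> 2 * B / r * dist z \<xi>"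
proof -
  have holo: "g holomorphic_on A" for A using g holomorphic_on_subset by blast
  have "cmod (g \<xi> - g z) \<le> 2 * B / r * cmod (\<xi> - z)"
  proof (rule field_differentiable_bound[OF convex_cball[of z "r / 2"]])
    show "(g has_field_derivative deriv g x) (at x within cball z (r / 2))" for x
      using g by (meson UNIV_I has_field_derivative_at_within holomorphic_derivI open_UNIV)
    fix x assume x: "x \<in> cball z (r / 2)"
    have "norm ((deriv ^^ 1) g x) \<le> fact 1 * B / (r / 2) ^ 1"
    proof (rule Cauchy_inequality)
      show "continuous_on (cball x (r / 2)) g" by (rule holomorphic_on_imp_continuous_on[OF holo])
      fix y assume "cmod (x - y) = r / 2"
      then have "dist z y \<le> r" using x dist_triangle[of z y x] by (simp add: dist_norm)
      then show "cmod (g y) \<le> B" using B by simp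
    qed (use r holo in auto)
    then show "norm (deriv g x) \<le> 2 * B / r" by (simp add: field_simps)
  qed (use \<xi> r in auto)
  then show ?thesis by (simp add: dist_norm norm_minus_commute)
qed

text \<open>The point maximising \<open>\<bar>g\<bar>\<^sup>s (r - \<bar>\<xi> - z\<bar>)\<^sup>2\<close> replaces the subharmonicity of \<open>\<bar>g\<bar>\<^sup>s\<close>: near it \<open>g\<close> is
  controlled by its value there, so that the Cauchy estimate bounds \<open>\<bar>g\<bar>\<close> from below on a disk of
  comparable size.\<close>

lemma powr_submean:
  fixes s :: real
  assumes s: "0 < s"
  shows "\<exists>c>0. \<forall>g z r. g holomorphic_on UNIV \<longrightarrow> 0 < r \<longrightarrow>
    ennreal (c * r\<^sup>2 * cmod (g z) powr s) \<le> (\<integral>\<^sup>+\<xi>\<in>ball z r. ennreal (cmod (g \<xi>) powr s) \<partial>lborel)"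
proof -
  \<comment> \<open>On the disk of radius \<open>d / 2\<close> about the maximum point the weight
    drops from \<open>d^2\<close> to at least \<open>d^2 / 4\<close>. The power of
    \<open>|g|\<close> can therefore grow by a factor 4 at most, and \<open>|g|\<close> by
    \<open>M\<close>.\<close>
  define M where "M = (4::real) powr (1 / s)"
  have M1: "1 \<le> M" unfolding M_def using s by (intro ge_one_powr_ge_zero) auto
  have Ms: "M powr s = 4" unfolding M_def using s by (simp add: powr_powr)
  define c where "c = (1 / 2) powr s * (pi / (8 * M)\<^sup>2)"
  have c: "c > 0" using M1 by (simp add: c_def)
  have "ennreal (c * r\<^sup>2 * cmod (g z) powr s) \<le> (\<integral>\<^sup>+\<xi>\<in>ball z r. ennreal (cmod (g \<xi>) powr s) \<partial>lborel)"
    if g: "g holomorphic_on UNIV" and r: "0 < r" for g z r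
  proof (cases "g z = 0")
    case True
    then show ?thesis by simp
  next
    case False
    define \<Phi> where "\<Phi> \<xi> = cmod (g \<xi>) powr s * (r - dist z \<xi>)\<^sup>2" for \<xi>
    have cg: "continuous_on A g" for A using g holomorphic_on_imp_continuous_on continuous_on_subset by blast
    have "continuous_on (cball z r) \<Phi>"
      unfolding \<Phi>_def by (intro continuous_intros continuous_on_powr' cg) (use s in auto)
    then obtain \<xi>0 where \<xi>0: "\<xi>0 \<in> cball z r" "\<And>\<xi>. \<xi> \<in> cball z r \<Longrightarrow> \<Phi> \<xi> \<le> \<Phi> \<xi>0"
      using continuous_attains_sup[of "cball z r" \<Phi>] r by auto
    define d where "d = r - dist z \<xi>0"
    have "0 < \<Phi> z" using False r by (simp add: \<Phi>_def)
    also have \<Phi>z: "\<Phi> z \<le> \<Phi> \<xi>0" using \<xi>0 r by simp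
    finally have pos: "0 < \<Phi> \<xi>0" .
    then have d: "0 < d" using \<xi>0(1) by (auto simp: \<Phi>_def d_def less_le)
    have g0: "g \<xi>0 \<noteq> 0" using pos by (auto simp: \<Phi>_def)
    let ?m = "cmod (g \<xi>0)"
    have bound: "cmod (g \<xi>) \<le> M * ?m" if "\<xi> \<in> cball \<xi>0 (d / 2)" for \<xi>
    proof -
      have dd: "d / 2 \<le> r - dist z \<xi>"
        using that dist_triangle[of z \<xi> \<xi>0] by (simp add: d_def)
      then have "\<xi> \<in> cball z r" using d by simp
      then have "cmod (g \<xi>) powr s * (r - dist z \<xi>)\<^sup>2 \<le> ?m powr s * d\<^sup>2"
        using \<xi>0(2)[of \<xi>] by (simp add: \<Phi>_def d_def)
      moreover have "cmod (g \<xi>) powr s * (d / 2)\<^sup>2 \<le> cmod (g \<xi>) powr s * (r - dist z \<xi>)\<^sup>2"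
        using dd d by (intro mult_left_mono power_mono) auto
      ultimately have "cmod (g \<xi>) powr s * (d / 2)\<^sup>2 \<le> ?m powr s * d\<^sup>2" by linarith
      then have "cmod (g \<xi>) powr s \<le> 4 * ?m powr s"
        using d by (simp add: power2_eq_square field_simps)
      also have "\<dots> = (M * ?m) powr s" using M1 by (simp add: powr_mult Ms)
      finally show ?thesis using powr_less_mono2[OF s, of "M * ?m" "cmod (g \<xi>)"] M1 by (force simp: not_le[symmetric])
    qed
    \<comment> \<open>The Lipschitz constant is \<open>4 * M * ?m / d\<close>, so at distance
      \<open>\<rho>\<close> the value has changed by at most \<open>?m / 2\<close>.\<close>
    define \<rho> where "\<rho> = d / (8 * M)"
    have \<rho>: "0 < \<rho>" "\<rho> \<le> d / 8" using d M1 by (auto simp: \<rho>_def field_simps)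
    have lower: "?m / 2 \<le> cmod (g \<xi>)" if "\<xi> \<in> ball \<xi>0 \<rho>" for \<xi>
    proof -
      have "cmod (g \<xi> - g \<xi>0) \<le> 2 * (M * ?m) / (d / 2) * dist \<xi>0 \<xi>"
        using that \<rho> d by (intro Cauchy_Lipschitz[OF g _ bound]) auto
      also have "\<dots> \<le> 2 * (M * ?m) / (d / 2) * \<rho>"
        using that d M1 by (intro mult_left_mono) auto
      also have "\<dots> = ?m / 2" using d M1 by (simp add: \<rho>_def field_simps)
      finally show ?thesis using norm_triangle_ineq2[of "g \<xi>0" "g \<xi>"] by (simp add: norm_minus_commute)
    qed
    have sub: "ball \<xi>0 \<rho> \<subseteq> ball z r"
    proof
      fix x assume "x \<in> ball \<xi>0 \<rho>"
      then show "x \<in> ball z r" using dist_triangle[of z x \<xi>0] \<rho> d by (simp add: d_def)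
    qed
    have "c * r\<^sup>2 * cmod (g z) powr s = c * \<Phi> z" by (simp add: \<Phi>_def)
    also have "\<dots> \<le> c * \<Phi> \<xi>0" using \<Phi>z c by simp
    also have "\<dots> = (?m / 2) powr s * (pi * \<rho>\<^sup>2)"
      by (simp add: c_def \<Phi>_def \<rho>_def d_def[symmetric] powr_divide power_divide powr_one_eq_one)
    finally have "ennreal (c * r\<^sup>2 * cmod (g z) powr s) \<le> ennreal ((?m / 2) powr s) * emeasure lborel (ball \<xi>0 \<rho>)"
      using \<rho> by (simp add: emeasure_lborel_ball_complex ennreal_mult[symmetric] ennreal_leI)
    also have "\<dots> = (\<integral>\<^sup>+\<xi>\<in>ball \<xi>0 \<rho>. ennreal ((?m / 2) powr s) \<partial>lborel)"
      by (simp add: nn_integral_cmult_indicator)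
    also have "\<dots> \<le> (\<integral>\<^sup>+\<xi>\<in>ball z r. ennreal (cmod (g \<xi>) powr s) \<partial>lborel)"
      using lower sub s by (intro nn_integral_mono) (auto simp: indicator_def intro!: ennreal_leI powr_mono2)
    finally show ?thesis .
  qed
  then show ?thesis using c by blast
qed

text \<open>Fatou's lemma makes the sublevel sets closed. Unlike Tonelli's theorem this works for
  every measure, so averages and Berezin transforms are measurable before anything is known about
  \<open>\<mu>\<close>.\<close>

lemma nn_integral_lower_semicontinuous_measurable:
  fixes F :: "'a::{first_countable_topology, t2_space} \<Rightarrow> 'b \<Rightarrow> ennreal"
  assumes meas: "\<And>z. F z \<in> borel_measurable M"
    and lsc: "\<And>zs z \<xi>. zs \<longlonglongrightarrow> z \<Longrightarrow> F z \<xi> \<le> liminf (\<lambda>n. F (zs n) \<xi>)"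
  shows "(\<lambda>z. \<integral>\<^sup>+\<xi>. F z \<xi> \<partial>M) \<in> borel_measurable borel"
proof (rule borel_measurableI_le)
  fix y
  have "closed {z. (\<integral>\<^sup>+\<xi>. F z \<xi> \<partial>M) \<le> y}"
    unfolding closed_sequential_limits
  proof (intro allI impI, elim conjE)
    fix zs z assume zs: "\<forall>n. zs n \<in> {z. (\<integral>\<^sup>+\<xi>. F z \<xi> \<partial>M) \<le> y}" "zs \<longlonglongrightarrow> z"
    have "(\<integral>\<^sup>+\<xi>. F z \<xi> \<partial>M) \<le> (\<integral>\<^sup>+\<xi>. liminf (\<lambda>n. F (zs n) \<xi>) \<partial>M)"
      by (intro nn_integral_mono lsc zs(2))
    also have "\<dots> \<le> liminf (\<lambda>n. \<integral>\<^sup>+\<xi>. F (zs n) \<xi> \<partial>M)"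
      by (intro nn_integral_liminf meas)
    also have "\<dots> \<le> liminf (\<lambda>n. y)"
      using zs(1) by (intro Liminf_mono) auto
    finally show "z \<in> {z. (\<integral>\<^sup>+\<xi>. F z \<xi> \<partial>M) \<le> y}" by (simp add: Liminf_const)
  qed
  then show "{z \<in> space borel. (\<integral>\<^sup>+\<xi>. F z \<xi> \<partial>M) \<le> y} \<in> sets borel" by simp
qed

text \<open>The indicator of an open disk is lower semicontinuous in the center. Only an inclusion
  of sigma-algebras is asked for, since \<open>weight_measure\<close> lives on Lebesgue
  sets.\<close>

lemma emeasure_ball_measurable:
  fixes M :: "complex measure"
  assumes "sets borel \<subseteq> sets M"
  shows "(\<lambda>z. emeasure M (ball z r)) \<in> borel_measurable borel"
proof -
  have b: "ball z r \<in> sets M" for z using assms by (auto intro: borel_open)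
  have "(\<lambda>z. \<integral>\<^sup>+\<xi>. indicator (ball z r) \<xi> \<partial>M) \<in> borel_measurable borel"
  proof (rule nn_integral_lower_semicontinuous_measurable)
    fix zs and z \<xi> :: complex assume zs: "zs \<longlonglongrightarrow> z"
    show "(indicator (ball z r) \<xi> :: ennreal) \<le> liminf (\<lambda>n. indicator (ball (zs n) r) \<xi>)"
    proof (cases "\<xi> \<in> ball z r")
      case True
      have "(\<lambda>n. dist (zs n) \<xi>) \<longlonglongrightarrow> dist z \<xi>" by (intro tendsto_intros zs)
      then have "\<forall>\<^sub>F n in sequentially. dist (zs n) \<xi> < r" using True by (intro order_tendstoD) auto
      then have "\<forall>\<^sub>F n in sequentially. (1::ennreal) \<le> indicator (ball (zs n) r) \<xi>"
        by eventually_elim auto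
      then show ?thesis using Liminf_bounded True by (metis (mono_tags) indicator_simps(1))
    qed simp
  qed (use b in simp)
  then show ?thesis using b by simp
qed

text \<open>Tonelli's theorem for the symmetric kernel
  \<open>dist \<xi> \<eta> < \<rho>\<close>.\<close>

lemma nn_integral_ball_swap:
  fixes m n :: "complex measure"
  assumes m: "sigma_finite_measure m" "sets m = sets borel" and n: "sigma_finite_measure n" "sets n = sets borel"
    and \<phi>: "\<phi> \<in> borel_measurable borel" and \<psi>: "\<psi> \<in> borel_measurable borel"
  shows "(\<integral>\<^sup>+\<xi>. \<phi> \<xi> * (\<integral>\<^sup>+\<eta>\<in>ball \<xi> \<rho>. \<psi> \<eta> \<partial>n) \<partial>m) = (\<integral>\<^sup>+\<eta>. \<psi> \<eta> * (\<integral>\<^sup>+\<xi>\<in>ball \<eta> \<rho>. \<phi> \<xi> \<partial>m) \<partial>n)"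
proof -
  interpret pair_sigma_finite m n using m n by (simp add: pair_sigma_finite_def)
  have sp: "sets (m \<Otimes>\<^sub>M n) = sets (borel :: (complex \<times> complex) measure)"
    by (rule trans[OF sets_pair_measure_cong[OF m(2) n(2)] arg_cong[OF borel_prod, of sets]])
  have "open {p :: complex \<times> complex. dist (fst p) (snd p) < \<rho>}"
    by (intro open_Collect_less continuous_intros)
  then have D: "{p. dist (fst p) (snd p) < \<rho>} \<in> sets (m \<Otimes>\<^sub>M n)" unfolding sp by (rule borel_open)
  have \<phi>m: "\<phi> \<in> borel_measurable m" and \<psi>n: "\<psi> \<in> borel_measurable n"
    using \<phi> \<psi> m n by (simp_all cong: measurable_cong_sets)
  have M: "(\<lambda>p. \<phi> (fst p) * \<psi> (snd p) * indicator {p. dist (fst p) (snd p) < \<rho>} p) \<in> borel_measurable (m \<Otimes>\<^sub>M n)"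
    using D \<phi>m \<psi>n by measurable
  have b: "ball x \<rho> \<in> sets m" "ball x \<rho> \<in> sets n" for x using m n by auto
  have "(\<integral>\<^sup>+\<xi>. \<phi> \<xi> * (\<integral>\<^sup>+\<eta>\<in>ball \<xi> \<rho>. \<psi> \<eta> \<partial>n) \<partial>m) =
      (\<integral>\<^sup>+\<xi>. \<integral>\<^sup>+\<eta>. \<phi> \<xi> * \<psi> \<eta> * indicator {p. dist (fst p) (snd p) < \<rho>} (\<xi>, \<eta>) \<partial>n \<partial>m)"
  proof (rule nn_integral_cong)
    fix \<xi>
    have "\<phi> \<xi> * (\<integral>\<^sup>+\<eta>\<in>ball \<xi> \<rho>. \<psi> \<eta> \<partial>n) = (\<integral>\<^sup>+\<eta>. \<phi> \<xi> * (\<psi> \<eta> * indicator (ball \<xi> \<rho>) \<eta>) \<partial>n)"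
      using \<psi>n b by (intro nn_integral_cmult[symmetric]) auto
    then show "\<phi> \<xi> * (\<integral>\<^sup>+\<eta>\<in>ball \<xi> \<rho>. \<psi> \<eta> \<partial>n) =
      (\<integral>\<^sup>+\<eta>. \<phi> \<xi> * \<psi> \<eta> * indicator {p. dist (fst p) (snd p) < \<rho>} (\<xi>, \<eta>) \<partial>n)"
      by (simp add: indicator_def mult.assoc)
  qed
  also have "\<dots> = (\<integral>\<^sup>+\<eta>. \<integral>\<^sup>+\<xi>. \<phi> \<xi> * \<psi> \<eta> * indicator {p. dist (fst p) (snd p) < \<rho>} (\<xi>, \<eta>) \<partial>m \<partial>n)"
    using Fubini'[of "\<lambda>\<xi> \<eta>. \<phi> \<xi> * \<psi> \<eta> * indicator {p. dist (fst p) (snd p) < \<rho>} (\<xi>, \<eta>)"] M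
    by (simp add: case_prod_beta')
  also have "\<dots> = (\<integral>\<^sup>+\<eta>. \<psi> \<eta> * (\<integral>\<^sup>+\<xi>\<in>ball \<eta> \<rho>. \<phi> \<xi> \<partial>m) \<partial>n)"
  proof (rule nn_integral_cong)
    fix \<eta>
    have "\<psi> \<eta> * (\<integral>\<^sup>+\<xi>\<in>ball \<eta> \<rho>. \<phi> \<xi> \<partial>m) = (\<integral>\<^sup>+\<xi>. \<psi> \<eta> * (\<phi> \<xi> * indicator (ball \<eta> \<rho>) \<xi>) \<partial>m)"
      using \<phi>m b by (intro nn_integral_cmult[symmetric]) auto
    then show "(\<integral>\<^sup>+\<xi>. \<phi> \<xi> * \<psi> \<eta> * indicator {p. dist (fst p) (snd p) < \<rho>} (\<xi>, \<eta>) \<partial>m) =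
       \<psi> \<eta> * (\<integral>\<^sup>+\<xi>\<in>ball \<eta> \<rho>. \<phi> \<xi> \<partial>m)"
      by (simp add: indicator_def dist_commute mult.assoc mult.left_commute)
  qed
  finally show ?thesis .
qed

lemma ball_in_borel [measurable, simp]: "ball (z::complex) r \<in> sets borel"
  by (rule borel_open) simp

lemma le_suminf_ennreal: "f n \<le> suminf f" for f :: "nat \<Rightarrow> ennreal"
  using sum_le_suminf[of f "{n}"] by simp

section \<open>Weights satisfying a Muckenhoupt condition at one scale\<close>

text \<open>Local integrability yields measurability only of the cut-offs of \<open>w\<close> to
  disks; \<open>w\<close> is their pointwise limit.\<close>

lemma weight_measurable:
  assumes "weight w"
  shows "w \<in> borel_measurable lebesgue"
proof (rule borel_measurable_LIMSEQ_real)
  fix z :: complex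
  obtain N :: nat where N: "norm z \<le> real N" using real_arch_simple by blast
  have "\<forall>\<^sub>F n in sequentially. indicator (cball 0 (real n)) z *\<^sub>R w z = w z"
    using eventually_ge_at_top[of N] by eventually_elim (use N in auto)
  then show "(\<lambda>n. indicator (cball 0 (real n)) z *\<^sub>R w z) \<longlonglongrightarrow> w z"
    by (rule tendsto_eventually)
next
  fix n
  have "w absolutely_integrable_on cball 0 (real n)" using assms by (simp add: weight_def)
  then show "(\<lambda>z. indicator (cball 0 (real n)) z *\<^sub>R w z) \<in> borel_measurable lebesgue"
    unfolding set_integrable_def by (rule borel_measurable_integrable)
qed

text \<open>The measure \<open>w dA\<close> restricted to Borel sets, which is the form needed for Fubini's theorem.\<close>

definition borel_weight_measure :: "(complex \<Rightarrow> real) \<Rightarrow> complex measure" where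
  "borel_weight_measure w = distr (weight_measure w) borel (\<lambda>x. x)"

lemma sets_borel_weight_measure [simp, measurable_cong]: "sets (borel_weight_measure w) = sets borel"
  by (simp add: borel_weight_measure_def)

lemma space_borel_weight_measure [simp]: "space (borel_weight_measure w) = UNIV"
  by (simp add: borel_weight_measure_def)

lemma nn_integral_borel_weight_measure:
  assumes "weight w" and f: "f \<in> borel_measurable borel"
  shows "(\<integral>\<^sup>+x. f x \<partial>borel_weight_measure w) = (\<integral>\<^sup>+x. ennreal (w x) * f x \<partial>lebesgue)"
proof -
  have m: "(\<lambda>x. x) \<in> measurable (weight_measure w) borel"
    by (simp add: weight_measure_def measurable_completion)
  have "(\<integral>\<^sup>+x. f x \<partial>borel_weight_measure w) = (\<integral>\<^sup>+x. f x \<partial>weight_measure w)"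
    unfolding borel_weight_measure_def using m f by (subst nn_integral_distr) auto
  also have "\<dots> = (\<integral>\<^sup>+x. ennreal (w x) * f x \<partial>lebesgue)"
    unfolding weight_measure_def
    by (rule nn_integral_density)
      (use weight_measurable[OF assms(1)] f in \<open>auto intro: measurable_completion\<close>)
  finally show ?thesis .
qed

lemma emeasure_borel_weight_measure:
  assumes "weight w" "A \<in> sets borel"
  shows "emeasure (borel_weight_measure w) A = (\<integral>\<^sup>+x\<in>A. ennreal (w x) \<partial>lebesgue)"
proof -
  have "emeasure (borel_weight_measure w) A = (\<integral>\<^sup>+x. indicator A x \<partial>borel_weight_measure w)"
    using assms by simp
  also have "\<dots> = (\<integral>\<^sup>+x\<in>A. ennreal (w x) \<partial>lebesgue)"
    using assms by (subst nn_integral_borel_weight_measure) auto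
  finally show ?thesis .
qed

lemma emeasure_weight_measure_eq:
  assumes "weight w" "A \<in> sets borel"
  shows "emeasure (weight_measure w) A = emeasure (borel_weight_measure w) A"
  unfolding emeasure_borel_weight_measure[OF assms] weight_measure_def
  using assms weight_measurable[OF assms(1)] by (subst emeasure_density) auto

lemma emeasure_borel_weight_measure_bounded:
  assumes "weight w" "bounded A" "A \<in> sets borel"
  shows "emeasure (borel_weight_measure w) A < top"
proof -
  obtain r where "\<forall>x\<in>A. norm x \<le> r" using assms(2) unfolding bounded_iff by (elim exE)
  then have r: "A \<subseteq> cball 0 r" by auto
  have "w absolutely_integrable_on cball 0 r" using assms by (simp add: weight_def)
  then have "integrable lebesgue (\<lambda>x. indicator (cball 0 r) x *\<^sub>R w x)"
    by (simp add: set_integrable_def)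
  then have fin: "(\<integral>\<^sup>+x. ennreal (indicator (cball 0 r) x *\<^sub>R w x) \<partial>lebesgue) < top"
    using integrableD(2)[of lebesgue "\<lambda>x. indicator (cball 0 r) x *\<^sub>R w x"] assms(1)
    by (simp add: weight_def less_top integrable_iff_bounded)
  have "emeasure (borel_weight_measure w) A \<le> (\<integral>\<^sup>+x. ennreal (indicator (cball 0 r) x *\<^sub>R w x) \<partial>lebesgue)"
    unfolding emeasure_borel_weight_measure[OF assms(1,3)]
    using r by (intro nn_integral_mono) (auto simp: indicator_def)
  also note fin
  finally show ?thesis .
qed

lemma sigma_finite_if_finite_on_balls:
  fixes m :: "complex measure"
  assumes s: "sets m = sets borel" and "\<And>n::nat. emeasure m (ball 0 (real n)) < top"
  shows "sigma_finite_measure m"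
proof
  have sp: "space m = UNIV" using sets_eq_imp_space_eq[OF s] by simp
  have "z \<in> (\<Union>n. ball 0 (real n))" for z :: complex
    using reals_Archimedean2[of "norm z"] by auto
  then show "\<exists>A. countable A \<and> A \<subseteq> sets m \<and> \<Union> A = space m \<and> (\<forall>a\<in>A. emeasure m a \<noteq> \<infinity>)"
    using assms sp by (intro exI[of _ "range (\<lambda>n::nat. ball 0 (real n))"]) (auto simp: less_top[symmetric])
qed

text \<open>Dominating the exponential by weighted indicators of the disks of integer radii leaves a
  convergent series of areas, the same for all centers.\<close>

lemma nn_integral_exp_dist_bounded:
  "\<exists>E>0. \<forall>z::complex. (\<integral>\<^sup>+\<eta>. ennreal (exp (- dist z \<eta>)) \<partial>lborel) \<le> ennreal E"
proof -
  define a where "a n = exp (- real n) * (pi * (real n + 1)\<^sup>2)" for n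
  have "a \<in> O(\<lambda>n. inverse (real n ^ 2))" unfolding a_def by real_asymp
  then have sum: "summable a"
    by (rule summable_comparison_test_bigo[rotated]) (use inverse_power_summable[of 2] in simp)
  have "(\<integral>\<^sup>+\<eta>. ennreal (exp (- dist z \<eta>)) \<partial>lborel) \<le> ennreal (suminf a + 1)" for z :: complex
  proof -
    let ?f = "\<lambda>n \<eta>. ennreal (exp (- real n)) * indicator (ball z (real n + 1)) \<eta>"
    have "ennreal (exp (- dist z \<eta>)) \<le> (\<Sum>n. ?f n \<eta>)" for \<eta>
    proof -
      define n where "n = nat \<lfloor>dist z \<eta>\<rfloor>"
      have "real n = of_int \<lfloor>dist z \<eta>\<rfloor>" by (simp add: n_def)
      then have n: "real n \<le> dist z \<eta>" "dist z \<eta> < real n + 1"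
        using floor_correct[of "dist z \<eta>"] by simp_all
      have "ennreal (exp (- dist z \<eta>)) \<le> ?f n \<eta>" using n by (simp add: ennreal_leI)
      also have "\<dots> \<le> (\<Sum>n. ?f n \<eta>)" by (rule le_suminf_ennreal)
      finally show ?thesis .
    qed
    then have "(\<integral>\<^sup>+\<eta>. ennreal (exp (- dist z \<eta>)) \<partial>lborel) \<le> (\<integral>\<^sup>+\<eta>. (\<Sum>n. ?f n \<eta>) \<partial>lborel)"
      by (intro nn_integral_mono)
    also have "\<dots> = (\<Sum>n. \<integral>\<^sup>+\<eta>. ?f n \<eta> \<partial>lborel)" by (intro nn_integral_suminf) auto
    also have "\<dots> = (\<Sum>n. ennreal (a n))"
      by (intro suminf_cong)
        (simp add: nn_integral_cmult_indicator emeasure_lborel_ball_complex ennreal_mult[symmetric] a_def)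
    also have "\<dots> = ennreal (suminf a)" by (rule suminf_ennreal2[OF _ sum]) (simp add: a_def)
    also have "\<dots> \<le> ennreal (suminf a + 1)" by (intro ennreal_leI) simp
    finally show ?thesis .
  qed
  moreover have "0 < suminf a + 1" using suminf_nonneg[OF sum] by (simp add: a_def add_nonneg_pos)
  ultimately show ?thesis by blast
qed

text \<open>The set \<open>Q z\<close> is a square with center \<open>z\<close>; the condition \<open>muckenhoupt\<close> combines the \<open>A\<^sub>q\<close>
  inequality with Hoelder's inequality and covers \<open>q = 1\<close>. The real number \<open>t\<close> stands for the integral
  on its left, which may be infinite.\<close>

locale restricted_weight =
  fixes \<alpha> :: real and w :: "complex \<Rightarrow> real" and q C R :: real and Q :: "complex \<Rightarrow> complex set"
  assumes \<alpha>: "0 < \<alpha>" and w: "weight w" and q: "1 \<le> q" and C: "0 < C" and R: "0 < R"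
    and ball_Q: "\<And>z. ball z R \<subseteq> Q z"
    and Q_sets [measurable]: "\<And>z. Q z \<in> sets borel"
    and W_Q: "\<And>z. 0 < emeasure (borel_weight_measure w) (Q z)" "\<And>z. emeasure (borel_weight_measure w) (Q z) < top"
    and muckenhoupt: "\<And>z h t. h \<in> borel_measurable borel \<Longrightarrow> (\<And>x. 0 \<le> h x) \<Longrightarrow> 0 \<le> t \<Longrightarrow>
      ennreal t \<le> (\<integral>\<^sup>+x\<in>Q z. ennreal (h x powr (1 / q)) \<partial>lborel) \<Longrightarrow>
      ennreal (t powr q) * emeasure (borel_weight_measure w) (Q z) \<le>
        ennreal C * (\<integral>\<^sup>+x\<in>Q z. ennreal (h x) \<partial>borel_weight_measure w)"
begin

abbreviation W :: "complex measure" where "W \<equiv> borel_weight_measure w"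

text \<open>The yardstick for local masses. By \<open>v_le_W_ball\<close> and
  \<open>W_ball_le_v\<close>, the mass of a concentric disk of fixed radius at most \<open>R\<close>
  may replace it up to constants.\<close>

definition v :: "complex \<Rightarrow> real" where "v z = measure W (Q z)"

lemma emeasure_W_Q: "emeasure W (Q z) = ennreal (v z)"
  using W_Q(2)[of z] by (simp add: v_def emeasure_eq_ennreal_measure)

lemma v_pos: "0 < v z"
  using W_Q(1)[of z] by (simp add: emeasure_W_Q)

lemma emeasure_W_ball: "emeasure W (ball z r) = ennreal (measure W (ball z r))"
  using emeasure_borel_weight_measure_bounded[OF w, of "ball z r"] by (simp add: emeasure_eq_ennreal_measure)

lemma W_ball_finite: "emeasure W (ball z r) < top"
  by (simp add: emeasure_W_ball)

lemma sigma_finite_W: "sigma_finite_measure W"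
  by (rule sigma_finite_if_finite_on_balls) (auto simp: W_ball_finite)

section \<open>Doubling and exponential growth\<close>

lemma W_ball_le_v: "r \<le> R \<Longrightarrow> measure W (ball z r) \<le> v z"
proof -
  assume "r \<le> R"
  then have "emeasure W (ball z r) \<le> emeasure W (Q z)"
    using ball_Q[of z] by (intro emeasure_mono) (auto simp: subset_iff)
  then show ?thesis using v_pos[of z] by (simp add: emeasure_W_ball emeasure_W_Q)
qed

text \<open>An indicator is unchanged by the power \<open>1 / q\<close>, so the area of the disk can
  serve as \<open>t\<close> in \<open>muckenhoupt\<close>.\<close>

lemma v_le_W_ball:
  assumes "0 < \<rho>" "ball \<zeta> \<rho> \<subseteq> Q z"
  shows "(pi * \<rho>\<^sup>2) powr q * v z \<le> C * measure W (ball \<zeta> \<rho>)"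
proof -
  have "ennreal ((pi * \<rho>\<^sup>2) powr q) * emeasure W (Q z) \<le> ennreal C * (\<integral>\<^sup>+x\<in>Q z. ennreal (indicator (ball \<zeta> \<rho>) x) \<partial>W)"
  proof (rule muckenhoupt)
    have "(\<integral>\<^sup>+x\<in>Q z. ennreal ((indicator (ball \<zeta> \<rho>) x) powr (1 / q)) \<partial>lborel) = (\<integral>\<^sup>+x. indicator (ball \<zeta> \<rho>) x \<partial>lborel)"
      using assms(2) q by (intro nn_integral_cong) (auto simp: indicator_def)
    also have "\<dots> = ennreal (pi * \<rho>\<^sup>2)" using assms by (simp add: emeasure_lborel_ball_complex)
    finally show "ennreal (pi * \<rho>\<^sup>2) \<le> (\<integral>\<^sup>+x\<in>Q z. ennreal ((indicator (ball \<zeta> \<rho>) x) powr (1 / q)) \<partial>lborel)" by simp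
  qed auto
  also have "(\<integral>\<^sup>+x\<in>Q z. ennreal (indicator (ball \<zeta> \<rho>) x) \<partial>W) = (\<integral>\<^sup>+x. indicator (ball \<zeta> \<rho>) x \<partial>W)"
    using assms(2) by (intro nn_integral_cong) (auto simp: indicator_def)
  also have "\<dots> = ennreal (measure W (ball \<zeta> \<rho>))" by (simp add: emeasure_W_ball)
  finally show ?thesis using C v_pos[of z]
    by (simp add: emeasure_W_Q ennreal_mult[symmetric])
qed

text \<open>The constant of one doubling step of length \<open>R / 2\<close>. The maximum with 1
  makes its powers increasing and its logarithm nonnegative.\<close>

definition D :: real where "D = max 1 (C / (pi * (R / 2)\<^sup>2) powr q)"

lemma D: "1 \<le> D"
  by (simp add: D_def)

lemma v_doubling: "dist z \<zeta> \<le> R / 2 \<Longrightarrow> v z \<le> D * v \<zeta>"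
proof -
  assume d: "dist z \<zeta> \<le> R / 2"
  have "ball \<zeta> (R / 2) \<subseteq> ball z R"
  proof
    fix x assume "x \<in> ball \<zeta> (R / 2)"
    then show "x \<in> ball z R" using d dist_triangle[of z x \<zeta>] by simp
  qed
  then have "(pi * (R / 2)\<^sup>2) powr q * v z \<le> C * measure W (ball \<zeta> (R / 2))"
    using ball_Q[of z] R by (intro v_le_W_ball) auto
  also have "\<dots> \<le> C * v \<zeta>" using W_ball_le_v[of "R / 2" \<zeta>] C R by simp
  finally have "v z \<le> C / (pi * (R / 2)\<^sup>2) powr q * v \<zeta>" using R by (simp add: field_simps)
  also have "\<dots> \<le> D * v \<zeta>" using v_pos[of \<zeta>] by (intro mult_right_mono) (auto simp: D_def)
  finally show ?thesis .
qed

lemma v_doubling_power: "dist z \<zeta> \<le> real n * (R / 2) \<Longrightarrow> v z \<le> D ^ n * v \<zeta>"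
proof (induction n arbitrary: \<zeta>)
  case (Suc n)
  \<comment> \<open>The last stop before \<open>\<zeta>\<close> on the segment from
    \<open>z\<close>: within \<open>n\<close> steps of \<open>z\<close> and one step of
    \<open>\<zeta>\<close>.\<close>
  define \<zeta>' where "\<zeta>' = z + of_real (real n / real (Suc n)) * (\<zeta> - z)"
  have "z - \<zeta>' = - (of_real (real n / real (Suc n)) * (\<zeta> - z))" by (simp add: \<zeta>'_def)
  then have "dist z \<zeta>' = real n / real (Suc n) * dist z \<zeta>"
    by (simp add: dist_norm norm_mult norm_minus_commute del: of_real_divide)
  also have "\<dots> \<le> real n / real (Suc n) * (real (Suc n) * (R / 2))"
    by (rule mult_left_mono[OF Suc.prems]) simp
  finally have "dist z \<zeta>' \<le> real n * (R / 2)" by simp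
  then have "v z \<le> D ^ n * v \<zeta>'" by (rule Suc.IH)
  also have "v \<zeta>' \<le> D * v \<zeta>"
  proof (rule v_doubling)
    have "\<zeta>' - \<zeta> = of_real (1 / real (Suc n)) * (z - \<zeta>)"
      by (simp add: \<zeta>'_def field_simps del: of_nat_Suc) (simp add: algebra_simps)
    then have "dist \<zeta>' \<zeta> = 1 / real (Suc n) * dist z \<zeta>"
      by (simp add: dist_norm norm_mult del: of_real_divide)
    also have "\<dots> \<le> 1 / real (Suc n) * (real (Suc n) * (R / 2))"
      by (rule mult_left_mono[OF Suc.prems]) simp
    finally show "dist \<zeta>' \<zeta> \<le> R / 2" by simp
  qed
  finally show ?case using D by (simp add: algebra_simps)
qed simp

text \<open>The exponential rate at which one step of length \<open>R / 2\<close> costs the factor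
  \<open>D\<close>, that is, \<open>exp (k * (R / 2)) = D\<close>.\<close>

definition k :: real where "k = 2 * ln D / R"

lemma k_nonneg: "0 \<le> k"
  using D R by (simp add: k_def)

text \<open>Rounding the number of doubling steps up costs the additional factor
  \<open>D\<close>.\<close>

lemma v_exp_growth: "v z \<le> D * exp (k * dist z \<zeta>) * v \<zeta>"
proof -
  define n where "n = nat \<lceil>2 * dist z \<zeta> / R\<rceil>"
  have n: "2 * dist z \<zeta> / R \<le> real n" "real n \<le> 2 * dist z \<zeta> / R + 1"
  proof -
    have "real n = of_int \<lceil>2 * dist z \<zeta> / R\<rceil>" using R by (simp add: n_def)
    then show "2 * dist z \<zeta> / R \<le> real n" "real n \<le> 2 * dist z \<zeta> / R + 1"
      using ceiling_correct[of "2 * dist z \<zeta> / R"] by linarith+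
  qed
  have "v z \<le> D ^ n * v \<zeta>" using n(1) R by (intro v_doubling_power) (simp add: field_simps)
  also have "D ^ n = exp (ln D * real n)" using D by (simp add: exp_of_nat2_mult)
  also have "\<dots> \<le> exp (ln D * (2 * dist z \<zeta> / R + 1))" using n(2) D by (simp add: mult_left_mono)
  also have "\<dots> = D * exp (k * dist z \<zeta>)"
    using D by (simp add: k_def distrib_left exp_add mult.commute)
  finally show ?thesis using v_pos[of \<zeta>] by simp
qed

text \<open>A Gaussian beats the exponential growth of \<open>v\<close>. Smearing the integral over
  disks of radius \<open>R\<close> reduces it to masses of disks, the only information available
  about \<open>W\<close>. The bound later serves as a norm estimate for the test function in
  \<open>kernel_bounds\<close>.\<close>

lemma gauss_bound: "\<exists>G>0. \<forall>z. (\<integral>\<^sup>+\<xi>. ennreal (exp (- \<alpha> * (dist z \<xi>)\<^sup>2)) \<partial>W) \<le> ennreal (G * v z)"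
proof -
  obtain E where E: "E > 0" "\<And>z::complex. (\<integral>\<^sup>+\<eta>. ennreal (exp (- dist z \<eta>)) \<partial>lborel) \<le> ennreal E"
    using nn_integral_exp_dist_bounded by blast
  \<comment> \<open>From completing the square in \<open>-\<alpha> * t^2 + (k + 1) * t\<close>. The
    rate \<open>k\<close> pays for the growth of \<open>v\<close>, and the extra 1 is left over for
    integrability.\<close>
  define b where "b = exp ((k + 1)\<^sup>2 / (4 * \<alpha>))"
  \<comment> \<open>The factor \<open>exp ((k + 1) * R)\<close> is the loss in replacing
    \<open>dist z \<xi>\<close> by \<open>dist z \<eta>\<close> for \<open>\<xi>\<close> in the disk
    about \<open>\<eta>\<close>.\<close>
  define G0 where "G0 = b * exp ((k + 1) * R) * D"
  define G where "G = G0 * E / (pi * R\<^sup>2)"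
  have b: "0 < b" by (simp add: b_def)
  have G0: "0 < G0" using b D by (simp add: G0_def)
  have quad: "exp (- \<alpha> * t\<^sup>2) \<le> b * exp (- (k + 1) * t)" for t
  proof -
    have "0 \<le> \<alpha> * (t - (k + 1) / (2 * \<alpha>))\<^sup>2" using \<alpha> by simp
    also have "\<dots> = \<alpha> * t\<^sup>2 - (k + 1) * t + (k + 1)\<^sup>2 / (4 * \<alpha>)"
      using \<alpha> by (simp add: power2_eq_square field_simps)
    finally show ?thesis by (simp add: b_def exp_add[symmetric] algebra_simps)
  qed
  have "(\<integral>\<^sup>+\<xi>. ennreal (exp (- \<alpha> * (dist z \<xi>)\<^sup>2)) \<partial>W) \<le> ennreal (G * v z)" for z
  proof -
    let ?\<phi> = "\<lambda>\<xi>. ennreal (exp (- \<alpha> * (dist z \<xi>)\<^sup>2))"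
    have \<phi>m: "?\<phi> \<in> borel_measurable borel" by measurable
    have A: "(\<integral>\<^sup>+\<eta>\<in>ball \<xi> R. 1 \<partial>lborel) = ennreal (pi * R\<^sup>2)" for \<xi> :: complex
      using R by (simp add: emeasure_lborel_ball_complex)
    have "(\<integral>\<^sup>+\<xi>. ?\<phi> \<xi> \<partial>W) * ennreal (pi * R\<^sup>2) = (\<integral>\<^sup>+\<xi>. ?\<phi> \<xi> * (\<integral>\<^sup>+\<eta>\<in>ball \<xi> R. 1 \<partial>lborel) \<partial>W)"
      unfolding A by (rule nn_integral_multc[symmetric]) measurable
    also have "\<dots> = (\<integral>\<^sup>+\<eta>. 1 * (\<integral>\<^sup>+\<xi>\<in>ball \<eta> R. ?\<phi> \<xi> \<partial>W) \<partial>lborel)"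
      by (rule nn_integral_ball_swap[OF sigma_finite_W _ sigma_finite_lborel _ \<phi>m]) auto
    also have "\<dots> \<le> (\<integral>\<^sup>+\<eta>. ennreal (G0 * v z) * ennreal (exp (- dist z \<eta>)) \<partial>lborel)"
    proof (rule nn_integral_mono)
      fix \<eta>
      have "exp (- \<alpha> * (dist z \<xi>)\<^sup>2) \<le> b * exp ((k + 1) * R) * exp (- (k + 1) * dist z \<eta>)"
        if "\<xi> \<in> ball \<eta> R" for \<xi>
      proof -
        have "dist z \<eta> - R \<le> dist z \<xi>"
          using that dist_triangle[of z \<eta> \<xi>] by (simp add: dist_commute)
        then have "- (k + 1) * dist z \<xi> \<le> - (k + 1) * (dist z \<eta> - R)"
          using k_nonneg by (intro mult_left_mono_neg) auto
        then have "b * exp (- (k + 1) * dist z \<xi>) \<le> b * exp (- (k + 1) * (dist z \<eta> - R))" using b by simp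
        also have "\<dots> = b * exp ((k + 1) * R) * exp (- (k + 1) * dist z \<eta>)"
          by (simp add: exp_add[symmetric] algebra_simps)
        finally show ?thesis using quad[of "dist z \<xi>"] by linarith
      qed
      then have "(\<integral>\<^sup>+\<xi>\<in>ball \<eta> R. ?\<phi> \<xi> \<partial>W) \<le>
          (\<integral>\<^sup>+\<xi>. ennreal (b * exp ((k + 1) * R) * exp (- (k + 1) * dist z \<eta>)) * indicator (ball \<eta> R) \<xi> \<partial>W)"
        by (intro nn_integral_mono) (auto simp: indicator_def intro!: ennreal_leI)
      also have "\<dots> = ennreal (b * exp ((k + 1) * R) * exp (- (k + 1) * dist z \<eta>) * measure W (ball \<eta> R))"
        using b by (simp add: nn_integral_cmult_indicator emeasure_W_ball ennreal_mult[symmetric])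
      also have "\<dots> \<le> ennreal (G0 * v z * exp (- dist z \<eta>))"
      proof (rule ennreal_leI)
        have "measure W (ball \<eta> R) \<le> D * exp (k * dist z \<eta>) * v z"
          using W_ball_le_v[of R \<eta>] v_exp_growth[of \<eta> z] by (simp add: dist_commute)
        then have "b * exp ((k + 1) * R) * exp (- (k + 1) * dist z \<eta>) * measure W (ball \<eta> R) \<le>
            b * exp ((k + 1) * R) * exp (- (k + 1) * dist z \<eta>) * (D * exp (k * dist z \<eta>) * v z)"
          using b by (intro mult_left_mono) auto
        also have "\<dots> = G0 * v z * (exp (- (k + 1) * dist z \<eta>) * exp (k * dist z \<eta>))"
          by (simp add: G0_def)
        also have "exp (- (k + 1) * dist z \<eta>) * exp (k * dist z \<eta>) = exp (- dist z \<eta>)"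
          by (simp add: exp_add[symmetric] algebra_simps)
        finally show "b * exp ((k + 1) * R) * exp (- (k + 1) * dist z \<eta>) * measure W (ball \<eta> R) \<le>
            G0 * v z * exp (- dist z \<eta>)" .
      qed
      finally show "1 * (\<integral>\<^sup>+\<xi>\<in>ball \<eta> R. ?\<phi> \<xi> \<partial>W) \<le> ennreal (G0 * v z) * ennreal (exp (- dist z \<eta>))"
        using G0 v_pos[of z] by (simp add: ennreal_mult)
    qed
    also have "\<dots> \<le> ennreal (G0 * v z) * ennreal E"
      by (subst nn_integral_cmult) (auto intro!: mult_left_mono E)
    also have "\<dots> = ennreal (G * v z) * ennreal (pi * R\<^sup>2)"
      using G0 v_pos[of z] E(1) R by (simp add: G_def ennreal_mult[symmetric])
    finally have "ennreal (pi * R\<^sup>2) * (\<integral>\<^sup>+\<xi>. ?\<phi> \<xi> \<partial>W) \<le> ennreal (pi * R\<^sup>2) * ennreal (G * v z)"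
      by (simp only: mult.commute)
    then show ?thesis using R by (subst (asm) ennreal_mult_le_mult_iff) auto
  qed
  moreover have "G > 0" using G0 E R by (simp add: G_def)
  ultimately show ?thesis by blast
qed

section \<open>Local estimate for entire functions\<close>

definition sq :: "(complex \<Rightarrow> complex) \<Rightarrow> complex \<Rightarrow> real" where
  "sq f \<xi> = (cmod (f \<xi>))\<^sup>2 * exp (- \<alpha> * (cmod \<xi>)\<^sup>2)"

lemma sq_nonneg [simp]: "0 \<le> sq f \<xi>"
  by (simp add: sq_def)

text \<open>The zero-free factor makes \<open>\<bar>f\<bar>\<^sup>2 exp (- \<alpha> \<bar>\<xi>\<bar>\<^sup>2)\<close> comparable near \<open>z\<close> to the square of the modulus of
  an entire function.\<close>

definition twist :: "(complex \<Rightarrow> complex) \<Rightarrow> complex \<Rightarrow> complex \<Rightarrow> complex" where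
  "twist f z \<xi> = f \<xi> * exp (of_real (\<alpha> * (cmod z)\<^sup>2 / 2) - of_real \<alpha> * \<xi> * cnj z)"

text \<open>The difference \<open>|\<xi>|^2 - |z - \<xi>|^2\<close> is the real part of an affine
  function of \<open>\<xi>\<close>, so recentering the Gaussian at \<open>z\<close> amounts to
  multiplying \<open>f\<close> by a zero-free entire function.\<close>

lemma cmod_twist_sq: "(cmod (twist f z \<xi>))\<^sup>2 = sq f \<xi> * exp (\<alpha> * (dist z \<xi>)\<^sup>2)"
proof -
  have "(dist z \<xi>)\<^sup>2 = (cmod z)\<^sup>2 + (cmod \<xi>)\<^sup>2 - 2 * Re (\<xi> * cnj z)"
    unfolding dist_norm cmod_power2 by (simp add: power2_eq_square algebra_simps)
  note d = this
  have e: "- \<alpha> * (cmod \<xi>)\<^sup>2 + \<alpha> * (dist z \<xi>)\<^sup>2 = \<alpha> * (cmod z)\<^sup>2 / 2 * 2 - \<alpha> * Re (\<xi> * cnj z) * 2"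
    unfolding d by (simp add: algebra_simps)
  have "(exp (\<alpha> * (cmod z)\<^sup>2 / 2 - \<alpha> * Re (\<xi> * cnj z)))\<^sup>2 = exp (- \<alpha> * (cmod \<xi>)\<^sup>2 + \<alpha> * (dist z \<xi>)\<^sup>2)"
    unfolding e by (simp add: power2_eq_square exp_add[symmetric] algebra_simps)
  moreover have "cmod (exp (of_real (\<alpha> * (cmod z)\<^sup>2 / 2) - of_real \<alpha> * \<xi> * cnj z)) =
      exp (\<alpha> * (cmod z)\<^sup>2 / 2 - \<alpha> * Re (\<xi> * cnj z))"
    by (simp add: mult.assoc)
  ultimately have "(cmod (exp (of_real (\<alpha> * (cmod z)\<^sup>2 / 2) - of_real \<alpha> * \<xi> * cnj z)))\<^sup>2 =
      exp (- \<alpha> * (cmod \<xi>)\<^sup>2 + \<alpha> * (dist z \<xi>)\<^sup>2)" by (simp only:)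
  then show ?thesis
    by (simp only: twist_def norm_mult power_mult_distrib sq_def exp_add mult.assoc)
qed

lemma cmod_twist_self: "(cmod (twist f z z))\<^sup>2 = sq f z"
  by (simp add: cmod_twist_sq)

lemma twist_holomorphic: "f holomorphic_on UNIV \<Longrightarrow> twist f z holomorphic_on UNIV"
  unfolding twist_def by (intro holomorphic_intros)

lemma sq_measurable: "f holomorphic_on UNIV \<Longrightarrow> sq f \<in> borel_measurable borel"
proof -
  assume "f holomorphic_on UNIV"
  then have "continuous_on UNIV f" by (rule holomorphic_on_imp_continuous_on)
  then have [measurable]: "f \<in> borel_measurable borel" by (rule borel_measurable_continuous_onI)
  show ?thesis unfolding sq_def[abs_def] by measurable
qed

lemma local_estimate:
  assumes \<rho>: "0 < \<rho>" "\<rho> \<le> R"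
  shows "\<exists>L>0. \<forall>f z. f holomorphic_on UNIV \<longrightarrow>
    ennreal (sq f z * v z) \<le> ennreal L * (\<integral>\<^sup>+\<xi>\<in>ball z \<rho>. ennreal (sq f \<xi>) \<partial>W)"
proof -
  obtain c where c: "c > 0" "\<And>g z r. g holomorphic_on UNIV \<Longrightarrow> 0 < r \<Longrightarrow>
      ennreal (c * r\<^sup>2 * cmod (g z) powr (2 / q)) \<le> (\<integral>\<^sup>+\<xi>\<in>ball z r. ennreal (cmod (g \<xi>) powr (2 / q)) \<partial>lborel)"
    using powr_submean[of "2 / q"] q by auto
  define L where "L = C * exp (\<alpha> * \<rho>\<^sup>2) / (c * \<rho>\<^sup>2) powr q"
  have "ennreal (sq f z * v z) \<le> ennreal L * (\<integral>\<^sup>+\<xi>\<in>ball z \<rho>. ennreal (sq f \<xi>) \<partial>W)"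
    if f: "f holomorphic_on UNIV" for f z
  proof -
    \<comment> \<open>The cut-off confines the integrals over \<open>Q z\<close> in
      \<open>muckenhoupt\<close> to the disk of radius \<open>\<rho>\<close>.\<close>
    define h where "h \<xi> = (cmod (twist f z \<xi>))\<^sup>2 * indicator (ball z \<rho>) \<xi>" for \<xi>
    \<comment> \<open>The lower bound for the integral of \<open>h powr (1 / q)\<close> given by
      \<open>powr_submean\<close> with exponent \<open>2 / q\<close>. Raising it to the power
      \<open>q\<close> restores the square of the modulus at \<open>z\<close>.\<close>
    define t where "t = c * \<rho>\<^sup>2 * cmod (twist f z z) powr (2 / q)"
    have "continuous_on UNIV (twist f z)" by (intro holomorphic_on_imp_continuous_on twist_holomorphic f)
    then have [measurable]: "twist f z \<in> borel_measurable borel" by (rule borel_measurable_continuous_onI)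
    note sq_measurable[OF f, measurable]
    have hm: "h \<in> borel_measurable borel" unfolding h_def[abs_def] by measurable
    have bQ: "ball z \<rho> \<subseteq> Q z" using ball_Q[of z] \<rho> by auto
    have pw: "x\<^sup>2 powr (1 / q) = x powr (2 / q)" if "0 \<le> x" for x :: real
      using that q by (cases "x = 0") (simp_all add: powr_powr flip: powr_numeral)
    have "ennreal t \<le> (\<integral>\<^sup>+\<xi>\<in>ball z \<rho>. ennreal (cmod (twist f z \<xi>) powr (2 / q)) \<partial>lborel)"
      unfolding t_def by (intro c(2) twist_holomorphic f \<rho>)
    also have "\<dots> = (\<integral>\<^sup>+x\<in>Q z. ennreal (h x powr (1 / q)) \<partial>lborel)"
      using bQ q by (intro nn_integral_cong) (auto simp: h_def indicator_def pw)
    finally have "ennreal (t powr q) * emeasure W (Q z) \<le> ennreal C * (\<integral>\<^sup>+x\<in>Q z. ennreal (h x) \<partial>W)"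
      using c(1) by (intro muckenhoupt[OF hm]) (auto simp: h_def t_def)
    also have "(\<integral>\<^sup>+x\<in>Q z. ennreal (h x) \<partial>W) \<le> (\<integral>\<^sup>+\<xi>. ennreal (exp (\<alpha> * \<rho>\<^sup>2)) * (ennreal (sq f \<xi>) * indicator (ball z \<rho>) \<xi>) \<partial>W)"
    proof (rule nn_integral_mono)
      fix \<xi>
      have "h \<xi> \<le> exp (\<alpha> * \<rho>\<^sup>2) * sq f \<xi>" if "\<xi> \<in> ball z \<rho>"
      proof -
        have "\<alpha> * (dist z \<xi>)\<^sup>2 \<le> \<alpha> * \<rho>\<^sup>2" using that \<alpha> by (intro mult_left_mono power_mono) auto
        then show ?thesis using that by (simp add: h_def cmod_twist_sq mult.commute mult_left_mono)
      qed
      then show "ennreal (h \<xi>) * indicator (Q z) \<xi> \<le>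
          ennreal (exp (\<alpha> * \<rho>\<^sup>2)) * (ennreal (sq f \<xi>) * indicator (ball z \<rho>) \<xi>)"
        by (auto simp: indicator_def h_def ennreal_mult[symmetric] intro!: ennreal_leI)
    qed
    also have "\<dots> = ennreal (exp (\<alpha> * \<rho>\<^sup>2)) * (\<integral>\<^sup>+\<xi>\<in>ball z \<rho>. ennreal (sq f \<xi>) \<partial>W)"
      by (intro nn_integral_cmult) measurable
    also have "t powr q = (c * \<rho>\<^sup>2) powr q * sq f z"
    proof -
      have "(cmod (twist f z z) powr (2 / q)) powr q = (cmod (twist f z z))\<^sup>2"
        using q by (cases "twist f z z = 0") (simp_all add: powr_powr)
      then show ?thesis using c(1) \<rho> by (simp add: t_def powr_mult cmod_twist_self)
    qed
    finally have "ennreal ((c * \<rho>\<^sup>2) powr q) * ennreal (sq f z * v z) \<le>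
        ennreal (C * exp (\<alpha> * \<rho>\<^sup>2)) * (\<integral>\<^sup>+\<xi>\<in>ball z \<rho>. ennreal (sq f \<xi>) \<partial>W)"
      using C v_pos[of z] by (simp add: emeasure_W_Q ennreal_mult mult_left_mono mult.assoc)
    also have "ennreal (C * exp (\<alpha> * \<rho>\<^sup>2)) = ennreal ((c * \<rho>\<^sup>2) powr q) * ennreal L"
      using c(1) \<rho> C by (simp add: L_def ennreal_mult[symmetric])
    finally show ?thesis using c(1) \<rho>
      by (subst (asm) mult.assoc, subst (asm) ennreal_mult_le_mult_iff) auto
  qed
  moreover have "L > 0" using C c(1) \<rho> by (simp add: L_def)
  ultimately show ?thesis by blast
qed

end

section \<open>The weighted Fock space\<close>

text \<open>Rounding \<open>z\<close> down to a grid of mesh \<open>1 / (n + 1)\<close> leaves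
  countably many functions of \<open>\<xi>\<close>, each measurable; continuity in \<open>z\<close>
  gives the pointwise limit.\<close>

lemma Caratheodory_measurable:
  fixes F :: "complex \<Rightarrow> complex \<Rightarrow> complex"
  assumes cont: "\<And>\<xi>. continuous_on UNIV (\<lambda>z. F z \<xi>)" and meas: "\<And>z. F z \<in> borel_measurable borel"
  shows "(\<lambda>p. F (fst p) (snd p)) \<in> borel_measurable (borel \<Otimes>\<^sub>M borel)"
proof (rule borel_measurable_LIMSEQ_metric)
  define d where "d n z = Complex (real_of_int \<lfloor>real (Suc n) * Re z\<rfloor> / real (Suc n))
    (real_of_int \<lfloor>real (Suc n) * Im z\<rfloor> / real (Suc n))" for n z
  show "(\<lambda>p. F (d n (fst p)) (snd p)) \<in> borel_measurable (borel \<Otimes>\<^sub>M borel)" for n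
  proof -
    have 1: "(\<lambda>p. F (Complex (real_of_int i / real (Suc n)) (real_of_int j / real (Suc n))) (snd p))
        \<in> borel_measurable (borel \<Otimes>\<^sub>M borel)" for i j
      by (rule measurable_compose[OF measurable_snd meas])
    have 2: "(\<lambda>p::complex \<times> complex. \<lfloor>real (Suc n) * Re (fst p)\<rfloor>) \<in> measurable (borel \<Otimes>\<^sub>M borel) (count_space UNIV)"
      "(\<lambda>p::complex \<times> complex. \<lfloor>real (Suc n) * Im (fst p)\<rfloor>) \<in> measurable (borel \<Otimes>\<^sub>M borel) (count_space UNIV)"
      by measurable
    have "(\<lambda>p. F (Complex (real_of_int i / real (Suc n)) (real_of_int \<lfloor>real (Suc n) * Im (fst p)\<rfloor> / real (Suc n))) (snd p))
        \<in> borel_measurable (borel \<Otimes>\<^sub>M borel)" for i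
      by (rule measurable_compose_countable[OF 1 2(2)])
    from measurable_compose_countable[OF this 2(1)] show ?thesis by (simp add: d_def)
  qed
  fix p :: "complex \<times> complex"
  have fl: "(\<lambda>n. real_of_int \<lfloor>real (Suc n) * x\<rfloor> / real (Suc n)) \<longlonglongrightarrow> x" for x :: real
  proof -
    have "(\<lambda>n. x - real_of_int \<lfloor>real (Suc n) * x\<rfloor> / real (Suc n)) \<longlonglongrightarrow> 0"
    proof (rule tendsto_0_squeeze)
      show "(\<lambda>n. 1 / real (Suc n)) \<longlonglongrightarrow> 0" by real_asymp
      fix n
      have y: "0 \<le> real (Suc n) * x - real_of_int \<lfloor>real (Suc n) * x\<rfloor>"
        "real (Suc n) * x - real_of_int \<lfloor>real (Suc n) * x\<rfloor> \<le> 1" by linarith+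
      have eq: "x - real_of_int \<lfloor>real (Suc n) * x\<rfloor> / real (Suc n) =
          (real (Suc n) * x - real_of_int \<lfloor>real (Suc n) * x\<rfloor>) / real (Suc n)"
        by (simp add: diff_divide_distrib del: of_nat_Suc)
      show "0 \<le> x - real_of_int \<lfloor>real (Suc n) * x\<rfloor> / real (Suc n)"
        unfolding eq by (rule divide_nonneg_nonneg[OF y(1)]) simp
      show "x - real_of_int \<lfloor>real (Suc n) * x\<rfloor> / real (Suc n) \<le> 1 / real (Suc n)"
        unfolding eq by (rule divide_right_mono[OF y(2)]) simp
    qed
    from tendsto_diff[OF tendsto_const this, of x] show ?thesis by simp
  qed
  have "(\<lambda>n. d n (fst p)) \<longlonglongrightarrow> Complex (Re (fst p)) (Im (fst p))"
    unfolding d_def by (intro tendsto_Complex fl)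
  then have lim: "(\<lambda>n. d n (fst p)) \<longlonglongrightarrow> fst p" by simp
  have "isCont (\<lambda>z. F z (snd p)) (fst p)"
    using cont[of "snd p"] by (simp add: continuous_on_eq_continuous_at)
  from isCont_tendsto_compose[OF this lim]
  show "(\<lambda>n. F (d n (fst p)) (snd p)) \<longlonglongrightarrow> F (fst p) (snd p)" .
qed

context restricted_weight
begin

text \<open>One functional for two measures: \<open>N W f\<close> is the squared Fock norm and
  \<open>N \<mu> f\<close> is the quadratic form of the Toeplitz operator. Values in
  \<open>ennreal\<close> avoid any prior integrability.\<close>

definition N :: "complex measure \<Rightarrow> (complex \<Rightarrow> complex) \<Rightarrow> ennreal" where
  "N m f = (\<integral>\<^sup>+\<xi>. ennreal (sq f \<xi>) \<partial>m)"

definition fock_integrand :: "(complex \<Rightarrow> complex) \<Rightarrow> (complex \<Rightarrow> complex) \<Rightarrow> complex \<Rightarrow> complex" where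
  "fock_integrand f g z = f z * cnj (g z) * of_real (exp (- \<alpha> * (cmod z)\<^sup>2) * w z)"

lemma w_nonneg [simp]: "0 \<le> w z"
  using w by (simp add: weight_def)

lemma fock_ip_eq: "fock_ip \<alpha> w f g = (LINT z|lebesgue. fock_integrand f g z)"
  by (simp add: fock_ip_def fock_integrand_def)

lemma fock_integrand_self: "fock_integrand f f z = of_real (sq f z * w z)"
  unfolding fock_integrand_def sq_def complex_norm_square[symmetric] by (simp add: mult.assoc)

lemma fock_ip_self: "fock_ip \<alpha> w f f = of_real (LINT z|lebesgue. sq f z * w z)"
  by (simp add: fock_ip_eq fock_integrand_self del: of_real_mult)

lemma N_W: "f holomorphic_on UNIV \<Longrightarrow> N W f = (\<integral>\<^sup>+z. ennreal (sq f z * w z) \<partial>lebesgue)"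
  unfolding N_def using sq_measurable[of f]
  by (subst nn_integral_borel_weight_measure[OF w]) (auto simp: ennreal_mult mult.commute)

lemma holomorphic_lebesgue_measurable:
  "f holomorphic_on UNIV \<Longrightarrow> f \<in> borel_measurable lebesgue"
proof -
  assume "f holomorphic_on UNIV"
  then have "f \<in> borel_measurable borel"
    by (intro borel_measurable_continuous_onI holomorphic_on_imp_continuous_on)
  then show ?thesis by (intro measurable_completion) simp
qed

lemma sq_lebesgue_measurable: "f holomorphic_on UNIV \<Longrightarrow> (\<lambda>z. sq f z * w z) \<in> borel_measurable lebesgue"
proof (rule borel_measurable_times)
  assume "f holomorphic_on UNIV"
  then show "sq f \<in> borel_measurable lebesgue" by (intro measurable_completion) (simp add: sq_measurable)
qed (rule weight_measurable[OF w])

lemma fock_iff: "f \<in> fock \<alpha> w \<longleftrightarrow> f holomorphic_on UNIV \<and> N W f < top"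
proof -
  have "integrable lebesgue (\<lambda>z. sq f z * w z) \<longleftrightarrow> N W f < top" if "f holomorphic_on UNIV"
    using sq_lebesgue_measurable[OF that] by (simp add: integrable_iff_bounded N_W[OF that] abs_mult)
  then show ?thesis by (auto simp: fock_def sq_def[abs_def])
qed

lemma fockD: "f \<in> fock \<alpha> w \<Longrightarrow> f holomorphic_on UNIV" "f \<in> fock \<alpha> w \<Longrightarrow> N W f < top"
  by (simp_all add: fock_iff)

lemma fock_integrable: "f \<in> fock \<alpha> w \<Longrightarrow> integrable lebesgue (\<lambda>z. sq f z * w z)"
  by (simp add: fock_def sq_def)

lemma N_fock: "f \<in> fock \<alpha> w \<Longrightarrow> N W f = ennreal (Re (fock_ip \<alpha> w f f))"
  unfolding fock_ip_self Re_complex_of_real N_W[OF fockD(1)]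
  by (intro nn_integral_eq_integral fock_integrable) auto

lemma fock_integrand_integrable: 
  assumes "f \<in> fock \<alpha> w" "g \<in> fock \<alpha> w"
  shows "integrable lebesgue (fock_integrand f g)"
proof (rule Bochner_Integration.integrable_bound)
  show "integrable lebesgue (\<lambda>z. sq f z * w z + sq g z * w z)"
    using assms by (intro Bochner_Integration.integrable_add fock_integrable)
  have "(\<lambda>z::complex. exp (- \<alpha> * (cmod z)\<^sup>2)) \<in> borel_measurable lebesgue"
    by (intro measurable_completion) measurable
  from measurable_compose[OF borel_measurable_times[OF this weight_measurable[OF w]]
      borel_measurable_continuous_onI[OF continuous_on_of_real_id]]
  have e: "(\<lambda>z. complex_of_real (exp (- \<alpha> * (cmod z)\<^sup>2) * w z)) \<in> borel_measurable lebesgue" .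
  have c: "(\<lambda>z. cnj (g z)) \<in> borel_measurable lebesgue"
    by (rule measurable_compose[OF holomorphic_lebesgue_measurable[OF fockD(1)[OF assms(2)]]
        borel_measurable_continuous_onI]) (intro continuous_intros)
  show "fock_integrand f g \<in> borel_measurable lebesgue"
    unfolding fock_integrand_def[abs_def]
    by (intro borel_measurable_times holomorphic_lebesgue_measurable[OF fockD(1)[OF assms(1)]] c e)
  show "AE z in lebesgue. norm (fock_integrand f g z) \<le> norm (sq f z * w z + sq g z * w z)"
  proof (rule AE_I2)
    fix z
    have "cmod (f z) * cmod (g z) \<le> (cmod (f z))\<^sup>2 + (cmod (g z))\<^sup>2"
      using sum_squares_bound[of "cmod (f z)" "cmod (g z)", unfolded mult.assoc]
        mult_nonneg_nonneg[OF norm_ge_zero[of "f z"] norm_ge_zero[of "g z"]] by linarith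
    from mult_right_mono[OF this, of "exp (- \<alpha> * (cmod z)\<^sup>2) * w z"]
    show "norm (fock_integrand f g z) \<le> norm (sq f z * w z + sq g z * w z)"
      by (simp add: fock_integrand_def sq_def norm_mult algebra_simps)
  qed
qed

lemma sq_add_le: "sq (f + g) \<xi> \<le> 2 * sq f \<xi> + 2 * sq g \<xi>"
proof -
  have "(cmod (f \<xi> + g \<xi>))\<^sup>2 \<le> (cmod (f \<xi>) + cmod (g \<xi>))\<^sup>2"
    by (intro power_mono norm_triangle_ineq) simp
  also have "\<dots> \<le> 2 * (cmod (f \<xi>))\<^sup>2 + 2 * (cmod (g \<xi>))\<^sup>2"
    using sum_squares_bound[of "cmod (f \<xi>)" "cmod (g \<xi>)"] by (simp add: power2_sum)
  finally have "(cmod (f \<xi> + g \<xi>))\<^sup>2 * exp (- \<alpha> * (cmod \<xi>)\<^sup>2) \<le>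
      (2 * (cmod (f \<xi>))\<^sup>2 + 2 * (cmod (g \<xi>))\<^sup>2) * exp (- \<alpha> * (cmod \<xi>)\<^sup>2)"
    by (rule mult_right_mono) simp
  then show ?thesis by (simp add: sq_def distrib_right)
qed

lemma sq_scl: "sq (scl c f) \<xi> = (cmod c)\<^sup>2 * sq f \<xi>"
  by (simp add: sq_def norm_mult power_mult_distrib)

lemma fock_add: "f \<in> fock \<alpha> w \<Longrightarrow> g \<in> fock \<alpha> w \<Longrightarrow> f + g \<in> fock \<alpha> w"
proof -
  assume fg: "f \<in> fock \<alpha> w" "g \<in> fock \<alpha> w"
  note sq_measurable[OF fockD(1)[OF fg(1)], measurable] sq_measurable[OF fockD(1)[OF fg(2)], measurable]
  have "(f + g) holomorphic_on UNIV"
    unfolding plus_fun_def by (intro holomorphic_on_add fockD fg)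
  moreover have "N W (f + g) < top"
  proof -
    have "N W (f + g) \<le> (\<integral>\<^sup>+\<xi>. ennreal (2 * sq f \<xi> + 2 * sq g \<xi>) \<partial>W)"
      unfolding N_def by (intro nn_integral_mono ennreal_leI sq_add_le)
    also have "\<dots> = 2 * N W f + 2 * N W g"
      unfolding N_def by (simp add: ennreal_plus ennreal_mult nn_integral_add nn_integral_cmult)
    also have "\<dots> < top" using fg by (simp add: fock_iff ennreal_mult_less_top)
    finally show ?thesis .
  qed
  ultimately show ?thesis by (simp add: fock_iff)
qed

lemma fock_scl: "f \<in> fock \<alpha> w \<Longrightarrow> scl c f \<in> fock \<alpha> w"
proof -
  assume f: "f \<in> fock \<alpha> w"
  note sq_measurable[OF fockD(1)[OF f], measurable]
  have "scl c f holomorphic_on UNIV"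
    unfolding scl_def by (intro holomorphic_intros fockD f)
  moreover have "N W (scl c f) = ennreal ((cmod c)\<^sup>2) * N W f"
    unfolding N_def by (subst nn_integral_cmult[symmetric]) (auto simp: sq_scl ennreal_mult)
  ultimately show ?thesis using f by (simp add: fock_iff ennreal_mult_less_top)
qed

lemma pointwise_bound: "\<exists>L>0. \<forall>f z. f holomorphic_on UNIV \<longrightarrow> ennreal (sq f z * v z) \<le> ennreal L * N W f"
proof -
  obtain L where L: "L > 0" "\<And>f z. f holomorphic_on UNIV \<Longrightarrow>
      ennreal (sq f z * v z) \<le> ennreal L * (\<integral>\<^sup>+\<xi>\<in>ball z R. ennreal (sq f \<xi>) \<partial>W)"
    using local_estimate[OF R order_refl] by blast
  have "(\<integral>\<^sup>+\<xi>\<in>ball z R. ennreal (sq f \<xi>) \<partial>W) \<le> N W f" for f z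
    unfolding N_def by (intro nn_integral_mono) (auto simp: indicator_def)
  then show ?thesis using L by (meson mult_left_mono order_trans zero_le)
qed

lemma function_inner_space_fock: "function_inner_space (fock \<alpha> w) (fock_ip \<alpha> w)"
proof
  show "0 \<in> fock \<alpha> w" by (simp add: fock_def zero_fun_def)
  fix f g h :: "complex \<Rightarrow> complex" and c
  show "0 \<le> Re (fock_ip \<alpha> w f f)"
    unfolding fock_ip_self by simp
  show "fock_ip \<alpha> w (- f) (- f) = fock_ip \<alpha> w f f" by (simp add: fock_ip_def)
  assume f: "f \<in> fock \<alpha> w"
  show "scl c f \<in> fock \<alpha> w" by (rule fock_scl[OF f])
  \<comment> \<open>Norm zero forces every single value to vanish by \<open>pointwise_bound\<close>,
    without an almost-everywhere argument.\<close>
  show "f = 0" if "Re (fock_ip \<alpha> w f f) = 0"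
  proof
    fix z
    obtain L where "ennreal (sq f z * v z) \<le> ennreal L * N W f"
      using pointwise_bound fockD(1)[OF f] by blast
    moreover have "N W f = 0" using N_fock[OF f] that by simp
    ultimately have "ennreal (sq f z * v z) = 0" by simp
    then have "sq f z * v z \<le> 0" by (rule ennreal_eq_0_iff[THEN iffD1])
    then have "sq f z = 0" using v_pos[of z] sq_nonneg[of f z] by (simp add: mult_le_0_iff)
    then show "f z = 0 z" by (simp add: sq_def)
  qed
  assume g: "g \<in> fock \<alpha> w"
  show "f + g \<in> fock \<alpha> w" by (rule fock_add[OF f g])
  have "cnj (fock_ip \<alpha> w f g) = (LINT z|lebesgue. cnj (fock_integrand f g z))" by (simp add: fock_ip_eq)
  also have "\<dots> = fock_ip \<alpha> w g f" unfolding fock_ip_eq by (intro Bochner_Integration.integral_cong) (auto simp: fock_integrand_def)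
  finally show "fock_ip \<alpha> w g f = cnj (fock_ip \<alpha> w f g)" by simp
  have "fock_ip \<alpha> w (scl c f) g = (LINT z|lebesgue. c * fock_integrand f g z)"
    unfolding fock_ip_eq by (intro Bochner_Integration.integral_cong) (auto simp: fock_integrand_def)
  then show "fock_ip \<alpha> w (scl c f) g = c * fock_ip \<alpha> w f g" by (simp add: fock_ip_eq)
  assume h: "h \<in> fock \<alpha> w"
  have "fock_ip \<alpha> w (f + g) h = (LINT z|lebesgue. fock_integrand f h z + fock_integrand g h z)"
    unfolding fock_ip_eq by (intro Bochner_Integration.integral_cong) (auto simp: fock_integrand_def algebra_simps)
  also have "\<dots> = fock_ip \<alpha> w f h + fock_ip \<alpha> w g h"
    unfolding fock_ip_eq by (intro Bochner_Integration.integral_add fock_integrand_integrable f g h)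
  finally show "fock_ip \<alpha> w (f + g) h = fock_ip \<alpha> w f h + fock_ip \<alpha> w g h" .
qed (simp add: fock_ip_self)

lemma N_le_of_pointwise_limit:
  fixes m :: "complex measure"
  assumes m: "sets m = sets borel" and F: "\<And>n. F n holomorphic_on UNIV" "\<And>n. N m (F n) \<le> c"
    and lim: "\<And>z. (\<lambda>n. F n z) \<longlonglongrightarrow> g z"
  shows "N m g \<le> c"
proof -
  have eq: "ennreal (sq g z) = liminf (\<lambda>n. ennreal (sq (F n) z))" for z
  proof -
    have "(\<lambda>n. sq (F n) z) \<longlonglongrightarrow> sq g z"
      unfolding sq_def by (intro tendsto_intros lim)
    then have "(\<lambda>n. ennreal (sq (F n) z)) \<longlonglongrightarrow> ennreal (sq g z)" by (rule tendsto_ennrealI)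
    then show ?thesis by (metis lim_imp_Liminf sequentially_bot)
  qed
  have "N m g \<le> liminf (\<lambda>n. N m (F n))"
    unfolding N_def eq using sq_measurable[OF F(1)] m
    by (intro nn_integral_liminf) (auto cong: measurable_cong_sets)
  also have "\<dots> \<le> liminf (\<lambda>n. c)" using F(2) by (intro Liminf_mono) auto
  finally show ?thesis by (simp add: Liminf_const)
qed

text \<open>Montel's theorem: \<open>pointwise_bound\<close> and the growth of \<open>v\<close>
  bound the functions uniformly on compact sets, and Fatou's lemma keeps the norm bound in the
  limit. It serves both the completeness of the space and the compactness of Toeplitz
  operators.\<close>

lemma fock_subsequence:
  assumes F: "\<And>n. F n \<in> fock \<alpha> w" "\<And>n. N W (F n) \<le> ennreal M" and M: "0 \<le> M"
  obtains g r where "strict_mono (r :: nat \<Rightarrow> nat)" "g \<in> fock \<alpha> w" "N W g \<le> ennreal M"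
    "\<And>z. (\<lambda>n. F (r n) z) \<longlonglongrightarrow> g z" "\<And>A. compact A \<Longrightarrow> uniform_limit A (\<lambda>n. F (r n)) g sequentially"
proof -
  obtain L where L: "L > 0" "\<And>f z. f holomorphic_on UNIV \<Longrightarrow> ennreal (sq f z * v z) \<le> ennreal L * N W f"
    using pointwise_bound by blast
  have bounded: "\<exists>B. \<forall>h\<in>range F. \<forall>z\<in>A. cmod (h z) \<le> B" if A: "compact A" for A
  proof -
    obtain b where b: "\<And>z. z \<in> A \<Longrightarrow> cmod z \<le> b"
      using compact_imp_bounded[OF A] unfolding bounded_iff by blast
    \<comment> \<open>For \<open>|z| \<le> b\<close> the growth of \<open>v\<close> gives
      \<open>v 0 \<le> D * exp (k * b) * v z\<close>, and \<open>exp (\<alpha> * b^2)\<close> undoes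
      the Gaussian in \<open>sq\<close>.\<close>
    define B where "B = exp (\<alpha> * b\<^sup>2) * (L * M * (D * exp (k * b)) / v 0)"
    have "cmod (F n z) \<le> sqrt B" if z: "z \<in> A" for n z
    proof (rule real_le_rsqrt)
      have zb: "cmod z \<le> b" "0 \<le> b" using b[OF z] norm_ge_zero[of z] by linarith+
      have "ennreal (sq (F n) z * v z) \<le> ennreal L * ennreal M"
        using L(2)[OF fockD(1)[OF F(1)]] F(2) by (meson mult_left_mono order_trans zero_le)
      then have 1: "sq (F n) z * v z \<le> L * M" using L(1) M by (simp add: ennreal_mult[symmetric])
      have "v 0 \<le> D * exp (k * cmod z) * v z" using v_exp_growth[of 0 z] by simp
      also have "\<dots> \<le> D * exp (k * b) * v z"
        using zb k_nonneg D v_pos[of z] by (intro mult_right_mono mult_left_mono) (auto intro: mult_left_mono)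
      finally have "sq (F n) z * v 0 \<le> sq (F n) z * (D * exp (k * b) * v z)"
        by (intro mult_left_mono) auto
      also have "\<dots> = sq (F n) z * v z * (D * exp (k * b))" by simp
      also have "\<dots> \<le> L * M * (D * exp (k * b))" using 1 D by (intro mult_right_mono) auto
      finally have 2: "sq (F n) z \<le> L * M * (D * exp (k * b)) / v 0"
        using v_pos[of 0] by (simp add: field_simps)
      have "(cmod (F n z))\<^sup>2 = exp (\<alpha> * (cmod z)\<^sup>2) * sq (F n) z"
        by (simp add: sq_def exp_minus field_simps)
      also have "\<dots> \<le> exp (\<alpha> * b\<^sup>2) * sq (F n) z"
        using zb \<alpha> by (intro mult_right_mono) (auto intro!: mult_left_mono power_mono)
      also have "\<dots> \<le> B" unfolding B_def using 2 by (intro mult_left_mono) auto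
      finally show "(cmod (F n z))\<^sup>2 \<le> B" .
    qed
    then show ?thesis by blast
  qed
  obtain g r where gr: "g holomorphic_on UNIV" "strict_mono (r :: nat \<Rightarrow> nat)"
      "\<And>x. x \<in> UNIV \<Longrightarrow> ((\<lambda>n. F (r n) x) \<longlongrightarrow> g x) sequentially"
      "\<And>A. \<lbrakk>compact A; A \<subseteq> UNIV\<rbrakk> \<Longrightarrow> uniform_limit A (F \<circ> r) g sequentially"
  proof (rule Montel[of UNIV "range F" F])
    show "\<And>h. h \<in> range F \<Longrightarrow> h holomorphic_on UNIV" using F(1) fockD(1) by blast
    show "\<And>K. compact K \<Longrightarrow> K \<subseteq> UNIV \<Longrightarrow> \<exists>B. \<forall>h\<in>range F. \<forall>z\<in>K. cmod (h z) \<le> B"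
      using bounded by blast
  qed (auto simp: o_def)
  have "N W g \<le> ennreal M"
    by (rule N_le_of_pointwise_limit[where F = "\<lambda>n. F (r n)"]) (use F fockD(1) gr(3) in auto)
  moreover have "g \<in> fock \<alpha> w" using gr(1) calculation by (auto simp: fock_iff le_less_trans)
  moreover have "uniform_limit A (\<lambda>n. F (r n)) g sequentially" if "compact A" for A
    using gr(4)[OF that] by (simp add: o_def)
  ultimately show thesis using that[of r g] gr(2,3) by simp
qed

sublocale F: function_inner_space "fock \<alpha> w" "fock_ip \<alpha> w"
  by (rule function_inner_space_fock)

lemma N_eq_nrm: "f \<in> fock \<alpha> w \<Longrightarrow> N W f = ennreal ((F.nrm f)\<^sup>2)"
  by (simp add: N_fock F.nrm_sq)

text \<open>A Cauchy sequence is bounded, so a subsequence converges pointwise. Fatou's lemma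
  applied to the differences with a fixed member upgrades this to convergence in norm of the whole
  sequence.\<close>

lemma function_hilbert_space_fock: "function_hilbert_space (fock \<alpha> w) (fock_ip \<alpha> w)"
proof (unfold_locales)
  fix \<sigma> :: "nat \<Rightarrow> complex \<Rightarrow> complex"
  assume \<sigma>: "\<And>n. \<sigma> n \<in> fock \<alpha> w"
    and cauchy: "\<And>\<epsilon>. \<epsilon> > 0 \<Longrightarrow> \<exists>N. \<forall>m\<ge>N. \<forall>n\<ge>N. F.nrm (\<sigma> m - \<sigma> n) < \<epsilon>"
  obtain N0 where N0: "\<And>m n. m \<ge> N0 \<Longrightarrow> n \<ge> N0 \<Longrightarrow> F.nrm (\<sigma> m - \<sigma> n) < 1"
    using cauchy[of 1] by auto
  define b where "b = F.nrm (\<sigma> N0) + 1"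
  have bd: "F.nrm (\<sigma> (n + N0)) \<le> b" for n
    using F.nrm_triangle_sub[OF \<sigma> \<sigma>, of "n + N0" N0] N0[of "n + N0" N0] by (simp add: b_def)
  have "N W (\<sigma> (n + N0)) \<le> ennreal (b\<^sup>2)" for n
    using bd[of n] by (simp add: N_eq_nrm \<sigma> ennreal_leI power_mono)
  note NW = this
  obtain g r where g: "strict_mono (r :: nat \<Rightarrow> nat)" "g \<in> fock \<alpha> w" "N W g \<le> ennreal (b\<^sup>2)"
      "\<And>z. (\<lambda>n. \<sigma> (r n + N0) z) \<longlonglongrightarrow> g z"
      "\<And>A. compact A \<Longrightarrow> uniform_limit A (\<lambda>n. \<sigma> (r n + N0)) g sequentially"
    by (rule fock_subsequence[where F = "\<lambda>n. \<sigma> (n + N0)", OF \<sigma> NW zero_le_power2]) (rule that)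
  have "(\<lambda>n. F.nrm (\<sigma> n - g)) \<longlonglongrightarrow> 0"
  proof (rule LIMSEQ_I)
    fix \<epsilon> :: real assume \<epsilon>: "0 < \<epsilon>"
    obtain N1 where N1: "\<And>m n. m \<ge> N1 \<Longrightarrow> n \<ge> N1 \<Longrightarrow> F.nrm (\<sigma> m - \<sigma> n) < \<epsilon> / 2"
      using cauchy[of "\<epsilon> / 2"] \<epsilon> by auto
    have "F.nrm (\<sigma> n - g) < \<epsilon>" if n: "n \<ge> N1" for n
    proof -
      \<comment> \<open>The shift by \<open>N1\<close> puts the index of the second term beyond
        \<open>N1\<close>, because a strictly increasing \<open>r\<close> satisfies
        \<open>n \<le> r n\<close>.\<close>
      let ?G = "\<lambda>m. \<sigma> n - \<sigma> (r (m + N1) + N0)"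
      have "N W (\<sigma> n - g) \<le> ennreal ((\<epsilon> / 2)\<^sup>2)"
      proof (rule N_le_of_pointwise_limit[where F = ?G])
        fix m
        have G: "?G m \<in> fock \<alpha> w" using \<sigma> by (intro F.diff_mem)
        then show "?G m holomorphic_on UNIV" by (rule fockD)
        have "N1 \<le> r (m + N1) + N0" using seq_suble[OF g(1), of "m + N1"] by linarith
        then have "F.nrm (?G m) < \<epsilon> / 2" using N1 n by blast
        then show "N W (?G m) \<le> ennreal ((\<epsilon> / 2)\<^sup>2)"
          unfolding N_eq_nrm[OF G] by (intro ennreal_leI power_mono) auto
      next
        fix z
        have "(\<lambda>m. \<sigma> (r (m + N1) + N0) z) \<longlonglongrightarrow> g z"
          using LIMSEQ_ignore_initial_segment[OF g(4)[of z], of N1] .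
        from tendsto_diff[OF tendsto_const this, of "\<sigma> n z"]
        show "(\<lambda>m. ?G m z) \<longlonglongrightarrow> (\<sigma> n - g) z" by simp
      qed simp
      then have "(F.nrm (\<sigma> n - g))\<^sup>2 \<le> (\<epsilon> / 2)\<^sup>2"
        unfolding N_eq_nrm[OF F.diff_mem[OF \<sigma> g(2)]] by simp
      then have "F.nrm (\<sigma> n - g) \<le> \<epsilon> / 2" by (rule power2_le_imp_le) (use \<epsilon> in simp)
      then show ?thesis using \<epsilon> by simp
    qed
    then show "\<exists>no. \<forall>n\<ge>no. norm (F.nrm (\<sigma> n - g) - 0) < \<epsilon>" by auto
  qed
  then show "\<exists>f\<in>fock \<alpha> w. (\<lambda>n. F.nrm (\<sigma> n - f)) \<longlonglongrightarrow> 0" using g(2) by blast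
qed

sublocale F: function_hilbert_space "fock \<alpha> w" "fock_ip \<alpha> w"
  by (rule function_hilbert_space_fock)

section \<open>The reproducing kernel\<close>

abbreviation ker :: "complex \<Rightarrow> complex \<Rightarrow> complex" where "ker \<equiv> fock_kernel \<alpha> w"

lemma evaluation_bounded: "\<exists>C. \<forall>f\<in>fock \<alpha> w. cmod (f z) \<le> C * F.nrm f"
proof -
  obtain L where L: "L > 0" "\<And>f z. f holomorphic_on UNIV \<Longrightarrow> ennreal (sq f z * v z) \<le> ennreal L * N W f"
    using pointwise_bound by blast
  let ?c = "exp (\<alpha> * (cmod z)\<^sup>2) * L / v z"
  have "cmod (f z) \<le> sqrt ?c * F.nrm f" if f: "f \<in> fock \<alpha> w" for f
  proof (rule power2_le_imp_le)
    have "sq f z * v z \<le> L * (F.nrm f)\<^sup>2"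
      using L(2)[OF fockD(1)[OF f], of z] L(1) by (simp add: N_eq_nrm[OF f] ennreal_mult[symmetric])
    then have "exp (\<alpha> * (cmod z)\<^sup>2) * sq f z \<le> ?c * (F.nrm f)\<^sup>2"
      using v_pos[of z] by (simp add: field_simps)
    moreover have "(cmod (f z))\<^sup>2 = exp (\<alpha> * (cmod z)\<^sup>2) * sq f z"
      by (simp add: sq_def exp_minus field_simps)
    ultimately show "(cmod (f z))\<^sup>2 \<le> (sqrt ?c * F.nrm f)\<^sup>2"
      using L(1) v_pos[of z] by (simp add: power_mult_distrib)
  qed (use L v_pos[of z] in simp)
  then show ?thesis by blast
qed

text \<open>Existence is Riesz representation of point evaluation; uniqueness follows by testing two
  candidates on their difference. From here on \<open>fock_kernel\<close> denotes the
  kernel.\<close>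

lemma kernel: "ker z \<in> fock \<alpha> w \<and> (\<forall>f\<in>fock \<alpha> w. f z = fock_ip \<alpha> w f (ker z))"
proof -
  obtain C where "\<And>f. f \<in> fock \<alpha> w \<Longrightarrow> cmod (f z) \<le> C * F.nrm f" using evaluation_bounded by blast
  then have ex: "\<exists>g\<in>fock \<alpha> w. \<forall>f\<in>fock \<alpha> w. f z = fock_ip \<alpha> w f g"
    by (intro F.Riesz_representation[where \<phi> = "\<lambda>f. f z"]) auto
  then obtain g where g: "g \<in> fock \<alpha> w" "\<And>f. f \<in> fock \<alpha> w \<Longrightarrow> f z = fock_ip \<alpha> w f g" by blast
  have "ker z = g"
    unfolding fock_kernel_def
  proof (rule the_equality)
    show "g \<in> fock \<alpha> w \<and> (\<forall>f\<in>fock \<alpha> w. f z = fock_ip \<alpha> w f g)" using g by simp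
    fix h assume "h \<in> fock \<alpha> w \<and> (\<forall>f\<in>fock \<alpha> w. f z = fock_ip \<alpha> w f h)"
    then have h: "h \<in> fock \<alpha> w" "\<And>f. f \<in> fock \<alpha> w \<Longrightarrow> f z = fock_ip \<alpha> w f h" by simp_all
    have hg: "h - g \<in> fock \<alpha> w" using h g by simp
    have "fock_ip \<alpha> w (h - g) h = fock_ip \<alpha> w (h - g) g" using h(2)[OF hg] g(2)[OF hg] by (rule trans[OF sym])
    then have "fock_ip \<alpha> w (h - g) (h - g) = 0"
      using F.form_diff_right[OF h(1) g(1) hg] by simp
    then have "h - g = 0" using hg by (intro F.ip_definite) simp_all
    then show "h = g" by simp
  qed
  then show ?thesis using g by metis
qed

lemma ker_mem [simp]: "ker z \<in> fock \<alpha> w"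
  by (rule conjunct1[OF kernel])

lemma reproducing: "f \<in> fock \<alpha> w \<Longrightarrow> fock_ip \<alpha> w f (ker z) = f z"
  by (rule conjunct2[OF kernel, THEN bspec, symmetric])

text \<open>The kernel on the diagonal, see \<open>ker_self\<close>; written as a squared norm it is
  real and nonnegative by construction.\<close>

definition K :: "complex \<Rightarrow> real" where "K z = (F.nrm (ker z))\<^sup>2"

lemma ker_self: "ker z z = of_real (K z)"
  using reproducing[of "ker z" z] F.ip_self[of "ker z"] by (simp add: K_def)

lemma ker_hermitian: "ker z \<xi> = cnj (ker \<xi> z)"
  using reproducing[of "ker z" \<xi>] reproducing[of "ker \<xi>" z] F.form_commute[of "ker \<xi>" "ker z"] by simp

lemma sq_ker_commute: "sq (ker z) \<xi> * exp (- \<alpha> * (cmod z)\<^sup>2) = sq (ker \<xi>) z * exp (- \<alpha> * (cmod \<xi>)\<^sup>2)"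
  using ker_hermitian[of z \<xi>] by (simp add: sq_def)

lemma N_ker: "N W (ker z) = ennreal (K z)"
  by (simp add: N_eq_nrm K_def)

text \<open>Above: apply \<open>pointwise_bound\<close> to \<open>ker z\<close> at \<open>z\<close>
  and cancel one factor \<open>K z\<close>. Below: apply Cauchy-Schwarz to the value at
  \<open>z\<close> of an explicit Gaussian-type function whose norm \<open>gauss_bound\<close>
  controls.\<close>

lemma kernel_bounds:
  "\<exists>L>0. \<exists>G>0. \<forall>z. 0 < K z \<and> K z * exp (- \<alpha> * (cmod z)\<^sup>2) * v z \<le> L \<and>
     1 \<le> G * (K z * exp (- \<alpha> * (cmod z)\<^sup>2) * v z)"
proof -
  obtain L where L: "L > 0" "\<And>f z. f holomorphic_on UNIV \<Longrightarrow> ennreal (sq f z * v z) \<le> ennreal L * N W f"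
    using pointwise_bound by blast
  obtain G where G: "G > 0" "\<And>z. (\<integral>\<^sup>+\<xi>. ennreal (exp (- \<alpha> * (dist z \<xi>)\<^sup>2)) \<partial>W) \<le> ennreal (G * v z)"
    using gauss_bound by blast
  have "0 < K z \<and> K z * exp (- \<alpha> * (cmod z)\<^sup>2) * v z \<le> L \<and> 1 \<le> G * (K z * exp (- \<alpha> * (cmod z)\<^sup>2) * v z)" for z
  proof -
    let ?e = "exp (- \<alpha> * (cmod z)\<^sup>2)"
    \<comment> \<open>The reciprocal of the factor in \<open>twist\<close>, so that
      \<open>twist f z\<close> is 1 and \<open>sq f\<close> is the Gaussian centered at
      \<open>z\<close>.\<close>
    define f where "f = (\<lambda>\<xi>. exp (of_real \<alpha> * \<xi> * cnj z - of_real (\<alpha> * (cmod z)\<^sup>2 / 2)))"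
    have fh: "f holomorphic_on UNIV" unfolding f_def by (intro holomorphic_intros)
    have sqf: "sq f \<xi> = exp (- \<alpha> * (dist z \<xi>)\<^sup>2)" for \<xi>
    proof -
      have "twist f z \<xi> = 1" by (simp add: twist_def f_def exp_add[symmetric])
      then have "1 = sq f \<xi> * exp (\<alpha> * (dist z \<xi>)\<^sup>2)" using cmod_twist_sq[of f z \<xi>] by simp
      then show ?thesis by (simp add: exp_minus field_simps)
    qed
    have NG: "N W f \<le> ennreal (G * v z)" using G(2) by (simp add: N_def sqf)
    then have f: "f \<in> fock \<alpha> w" using fh by (auto simp: fock_iff le_less_trans)
    have nf: "(F.nrm f)\<^sup>2 \<le> G * v z" using NG G(1) v_pos[of z] by (simp add: N_eq_nrm[OF f])
    have "1 = sq f z" by (simp add: sqf)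
    also have "\<dots> = (cmod (fock_ip \<alpha> w f (ker z)))\<^sup>2 * ?e"
      using reproducing[OF f, of z] by (simp add: sq_def)
    also have "\<dots> \<le> (F.nrm f * F.nrm (ker z))\<^sup>2 * ?e"
      using F.cmod_ip_le[OF f ker_mem] by (intro mult_right_mono power_mono) auto
    also have "\<dots> = (F.nrm f)\<^sup>2 * (K z * ?e)" by (simp add: K_def power_mult_distrib)
    also have "\<dots> \<le> G * v z * (K z * ?e)" using nf by (intro mult_right_mono) (auto simp: K_def)
    finally have 1: "1 \<le> G * (K z * ?e * v z)" by (simp add: algebra_simps)
    have Kp: "0 < K z"
    proof (rule ccontr)
      assume "\<not> 0 < K z"
      then have "K z = 0" by (simp add: K_def)
      then show False using 1 by simp
    qed
    have "sq (ker z) z * v z \<le> L * K z"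
      using L(2)[OF fockD(1)[OF ker_mem], of z z] L(1) Kp by (simp add: N_ker ennreal_mult[symmetric])
    then have "K z * (K z * ?e * v z) \<le> K z * L"
      using ker_self[of z] by (simp add: sq_def power2_eq_square algebra_simps)
    then have "K z * ?e * v z \<le> L" using Kp by simp
    then show ?thesis using 1 Kp by blast
  qed
  then show ?thesis using L(1) G(1) by blast
qed

lemma K_pos: "0 < K z"
  using kernel_bounds by blast

text \<open>In units of \<open>sqrt (K z / v z)\<close> the twisted kernel is at most
  \<open>b\<close> on the disk of radius \<open>R / 2\<close> and at least \<open>1 / sqrt G\<close>
  at the center. The Lipschitz bound then keeps half of the central value on a disk whose radius
  does not depend on \<open>z\<close>.\<close>

lemma near_diagonal:
  "\<exists>\<delta>>0. \<exists>c>0. \<forall>z \<xi>. dist z \<xi> < \<delta> \<longrightarrow> c * K z \<le> sq (ker z) \<xi> * v z"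
proof -
  obtain L where L: "L > 0" "\<And>f z. f holomorphic_on UNIV \<Longrightarrow> ennreal (sq f z * v z) \<le> ennreal L * N W f"
    using pointwise_bound by blast
  obtain G where G: "G > 0" "\<And>z. 1 \<le> G * (K z * exp (- \<alpha> * (cmod z)\<^sup>2) * v z)"
    using kernel_bounds by blast
  define b where "b = sqrt (L * D * exp (\<alpha> * R\<^sup>2))"
  have b: "b > 0" using L D by (simp add: b_def)
  \<comment> \<open>The second entry makes the Lipschitz constant \<open>4 * b / R\<close> times
    \<open>\<delta>\<close> at most half of \<open>1 / sqrt G\<close>; the first keeps the points
    inside the disk of radius \<open>R / 2\<close>.\<close>
  define \<delta> where "\<delta> = min (R / 4) (R / (8 * b * sqrt G))"
  \<comment> \<open>The 4 comes from squaring the half of the central value, the exponential from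
    removing the twist.\<close>
  define c where "c = exp (- \<alpha> * R\<^sup>2) / (4 * G)"
  have \<delta>0: "\<delta> > 0" using R b G by (simp add: \<delta>_def)
  have c0: "c > 0" using G by (simp add: c_def)
  have main: "c * K z \<le> sq (ker z) \<xi> * v z" if \<xi>: "dist z \<xi> < \<delta>" for z \<xi>
  proof -
    let ?s = "sqrt (K z / v z)"
    have s: "?s > 0" "?s\<^sup>2 = K z / v z" using K_pos[of z] v_pos[of z] by simp_all
    have up: "cmod (twist (ker z) z \<eta>) \<le> b * ?s" if "\<eta> \<in> cball z (R / 2)" for \<eta>
    proof (rule power2_le_imp_le)
      have d: "dist z \<eta> \<le> R / 2" using that by simp
      have e: "exp (\<alpha> * (dist z \<eta>)\<^sup>2) \<le> exp (\<alpha> * R\<^sup>2)"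
        using d \<alpha> R by (auto intro!: mult_left_mono power_mono)
      have "sq (ker z) \<eta> * v \<eta> \<le> L * K z"
        using L(2)[OF fockD(1)[OF ker_mem], of z \<eta>] L(1) K_pos[of z] by (simp add: N_ker ennreal_mult[symmetric])
      then have "D * (sq (ker z) \<eta> * v \<eta>) \<le> D * (L * K z)" using D by (intro mult_left_mono) auto
      moreover have "sq (ker z) \<eta> * v z \<le> sq (ker z) \<eta> * (D * v \<eta>)"
        using v_doubling[OF d] by (intro mult_left_mono) auto
      moreover have "sq (ker z) \<eta> * (D * v \<eta>) = D * (sq (ker z) \<eta> * v \<eta>)"
        by (rule mult.left_commute)
      ultimately have "sq (ker z) \<eta> * v z \<le> D * (L * K z)" by linarith
      then have "sq (ker z) \<eta> \<le> L * D * (K z / v z)" using v_pos[of z] by (simp add: field_simps)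
      then have "sq (ker z) \<eta> * exp (\<alpha> * (dist z \<eta>)\<^sup>2) \<le> L * D * (K z / v z) * exp (\<alpha> * R\<^sup>2)"
        using e L D K_pos[of z] v_pos[of z] by (intro mult_mono) auto
      also have "\<dots> = (b * ?s)\<^sup>2" using L D s by (simp add: b_def power_mult_distrib)
      finally show "(cmod (twist (ker z) z \<eta>))\<^sup>2 \<le> (b * ?s)\<^sup>2" by (simp add: cmod_twist_sq)
    qed (use b s in simp)
    have low: "?s / sqrt G \<le> cmod (twist (ker z) z z)"
    proof (rule power2_le_imp_le)
      have eq: "sq (ker z) z = K z * (K z * exp (- \<alpha> * (cmod z)\<^sup>2))"
        using ker_self[of z] by (simp add: sq_def power2_eq_square)
      have "1 / (G * v z) \<le> K z * exp (- \<alpha> * (cmod z)\<^sup>2)"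
        using G(2)[of z] G(1) v_pos[of z] by (simp add: field_simps)
      then have "K z * (1 / (G * v z)) \<le> sq (ker z) z"
        unfolding eq by (rule mult_left_mono) (use K_pos[of z] in simp)
      then show "(?s / sqrt G)\<^sup>2 \<le> (cmod (twist (ker z) z z))\<^sup>2"
        using G(1) s by (simp add: cmod_twist_self power_divide mult.commute)
    qed simp
    have dR: "dist z \<xi> \<le> R / 4" "dist z \<xi> \<le> R / (8 * b * sqrt G)" using \<xi> by (simp_all add: \<delta>_def)
    have "cmod (twist (ker z) z \<xi> - twist (ker z) z z) \<le> 2 * (b * ?s) / (R / 2) * dist z \<xi>"
      using R dR up by (intro Cauchy_Lipschitz twist_holomorphic fockD(1) ker_mem) auto
    also have "\<dots> \<le> 2 * (b * ?s) / (R / 2) * (R / (8 * b * sqrt G))"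
      using dR b s R by (intro mult_left_mono) auto
    also have "\<dots> = ?s / sqrt G / 2" using R b by (simp add: field_simps)
    finally have "?s / sqrt G / 2 \<le> cmod (twist (ker z) z \<xi>)"
      using low norm_triangle_ineq2[of "twist (ker z) z z" "twist (ker z) z \<xi>"]
      by (simp add: norm_minus_commute)
    then have "(?s / sqrt G / 2)\<^sup>2 \<le> (cmod (twist (ker z) z \<xi>))\<^sup>2"
      using s G by (intro power_mono) auto
    then have "K z / v z / (4 * G) \<le> sq (ker z) \<xi> * exp (\<alpha> * (dist z \<xi>)\<^sup>2)"
      using G(1) s by (simp add: cmod_twist_sq power_divide)
    also have "\<dots> \<le> sq (ker z) \<xi> * exp (\<alpha> * R\<^sup>2)"
      using dR \<alpha> R by (intro mult_left_mono) (auto intro!: mult_left_mono power_mono)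
    finally have "K z / v z / (4 * G) / exp (\<alpha> * R\<^sup>2) \<le> sq (ker z) \<xi>"
      by (simp only: pos_divide_le_eq exp_gt_zero)
    then have "K z / v z / (4 * G) / exp (\<alpha> * R\<^sup>2) * v z \<le> sq (ker z) \<xi> * v z"
      by (rule mult_right_mono) (use v_pos[of z] in simp)
    moreover have "K z / v z / (4 * G) / exp (\<alpha> * R\<^sup>2) * v z = c * K z"
      using v_pos[of z] G(1) by (simp add: c_def exp_minus field_simps)
    ultimately show ?thesis by simp
  qed
  show ?thesis
    by (rule exI[of _ \<delta>], rule conjI[OF \<delta>0], rule exI[of _ c], rule conjI[OF c0])
      (intro allI impI main)
qed

lemma ker_continuous: "continuous_on UNIV (\<lambda>z. ker z \<xi>)"
proof -
  have "continuous_on UNIV (\<lambda>z. cnj (ker \<xi> z))"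
    by (intro continuous_on_cnj holomorphic_on_imp_continuous_on fockD(1) ker_mem)
  then show ?thesis by (simp add: ker_hermitian[of _ \<xi>, symmetric])
qed

lemma ker_measurable: "ker z \<in> borel_measurable borel"
  by (intro borel_measurable_continuous_onI holomorphic_on_imp_continuous_on fockD(1) ker_mem)

lemma ker_joint_measurable: "(\<lambda>p. ker (fst p) (snd p)) \<in> borel_measurable (borel \<Otimes>\<^sub>M borel)"
  by (rule Caratheodory_measurable[OF ker_continuous ker_measurable])

lemma N_ker_measurable:
  assumes "sets m = sets borel"
  shows "(\<lambda>z. N m (ker z)) \<in> borel_measurable borel"
  unfolding N_def
proof (rule nn_integral_lower_semicontinuous_measurable)
  show "(\<lambda>\<xi>. ennreal (sq (ker z) \<xi>)) \<in> borel_measurable m" for z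
    using sq_measurable[OF fockD(1)[OF ker_mem], of z] assms by (simp cong: measurable_cong_sets)
  fix zs :: "nat \<Rightarrow> complex" and z \<xi> assume zs: "zs \<longlonglongrightarrow> z"
  have "isCont (\<lambda>z. ker z \<xi>) z" using ker_continuous by (simp add: continuous_on_eq_continuous_at)
  from isCont_tendsto_compose[OF this zs] have "(\<lambda>n. ker (zs n) \<xi>) \<longlonglongrightarrow> ker z \<xi>" .
  then have "(\<lambda>n. sq (ker (zs n)) \<xi>) \<longlonglongrightarrow> sq (ker z) \<xi>"
    unfolding sq_def by (intro tendsto_intros)
  then have "(\<lambda>n. ennreal (sq (ker (zs n)) \<xi>)) \<longlonglongrightarrow> ennreal (sq (ker z) \<xi>)" by (rule tendsto_ennrealI)
  then show "ennreal (sq (ker z) \<xi>) \<le> liminf (\<lambda>n. ennreal (sq (ker (zs n)) \<xi>))"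
    by (metis lim_imp_Liminf sequentially_bot order_refl)
qed

lemma K_measurable [measurable]: "K \<in> borel_measurable borel"
proof -
  have "(\<lambda>z. ennreal (K z)) \<in> borel_measurable borel"
    using N_ker_measurable[of W] by (simp add: N_ker)
  then have "(\<lambda>z. enn2real (ennreal (K z))) \<in> borel_measurable borel" by measurable
  then show ?thesis using K_pos by (simp add: less_imp_le)
qed

end

section \<open>Averages and the Berezin transform\<close>

lemma nn_integral_lebesgue: "(\<integral>\<^sup>+z. f z \<partial>lebesgue) = (\<integral>\<^sup>+z. f z \<partial>lborel)"
  by (rule nn_integral_completion)

lemma Lp_norm_le_if_integral_le:
  assumes p: "0 < p" and c: "0 \<le> c"
    and le: "(\<integral>\<^sup>+z. epowr (g z) p \<partial>lborel) \<le> ennreal c * (\<integral>\<^sup>+z. epowr (h z) p \<partial>lborel)"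
  shows "Lp_norm p g \<le> ennreal (c powr (1 / p)) * Lp_norm p h"
proof -
  have "epowr (\<integral>\<^sup>+z. epowr (g z) p \<partial>lborel) (1 / p) \<le>
      epowr (ennreal c * (\<integral>\<^sup>+z. epowr (h z) p \<partial>lborel)) (1 / p)"
    using le p by (intro epowr_mono) auto
  then show ?thesis
    unfolding Lp_norm_def nn_integral_lebesgue using p c by (simp add: epowr_mult epowr_ennreal)
qed

context restricted_weight
begin

text \<open>A measurable substitute for \<open>v\<close>: the locale gives no regularity of
  \<open>Q z\<close> in \<open>z\<close>, so \<open>v\<close> need not be measurable, whereas masses
  of disks are.\<close>

definition u :: "complex \<Rightarrow> real" where "u \<xi> = measure W (ball \<xi> R)"

definition Cu :: real where "Cu = C / (pi * R\<^sup>2) powr q"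

lemma Cu: "0 < Cu"
  using C R by (simp add: Cu_def)

lemma u_le_v: "u \<xi> \<le> v \<xi>"
  by (simp add: u_def W_ball_le_v)

lemma v_le_u: "v \<xi> \<le> Cu * u \<xi>"
  using v_le_W_ball[OF R ball_Q] R by (simp add: Cu_def u_def field_simps)

lemma u_pos: "0 < u \<xi>"
  using v_le_u[of \<xi>] v_pos[of \<xi>] Cu by (smt (verit) mult_nonneg_nonpos)

lemma u_measurable [measurable]: "u \<in> borel_measurable borel"
proof -
  have "(\<lambda>\<xi>. enn2real (emeasure W (ball \<xi> R))) \<in> borel_measurable borel"
    by (intro measurable_compose[OF emeasure_ball_measurable]) auto
  then show ?thesis by (simp add: u_def[abs_def] measure_def)
qed

lemma W_ball_pos: "0 < r \<Longrightarrow> r \<le> R \<Longrightarrow> 0 < measure W (ball z r)"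
proof -
  assume r: "0 < r" "r \<le> R"
  have "(pi * r\<^sup>2) powr q * v z \<le> C * measure W (ball z r)"
    using r ball_Q[of z] by (intro v_le_W_ball) auto
  moreover have "0 < (pi * r\<^sup>2) powr q * v z" using r v_pos by simp
  ultimately have "0 < C * measure W (ball z r)" by linarith
  then show ?thesis using C by (simp add: zero_less_mult_iff)
qed

text \<open>The normalising mass is that of the disk of radius \<open>R\<close>, whatever
  \<open>\<rho>\<close> is, so that one function \<open>u\<close> serves all radii.\<close>

definition ball_density :: "complex measure \<Rightarrow> real \<Rightarrow> complex \<Rightarrow> ennreal" where
  "ball_density \<mu> \<rho> \<xi> = emeasure \<mu> (ball \<xi> \<rho>) * ennreal (1 / u \<xi>)"

lemma ball_density_measurable: "sets \<mu> = sets borel \<Longrightarrow> ball_density \<mu> \<rho> \<in> borel_measurable borel"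
proof -
  assume "sets \<mu> = sets borel"
  then have [measurable]: "(\<lambda>\<xi>. emeasure \<mu> (ball \<xi> \<rho>)) \<in> borel_measurable borel"
    by (intro emeasure_ball_measurable) simp
  show ?thesis unfolding ball_density_def[abs_def] by measurable
qed

lemma average_function_eq:
  "0 < r \<Longrightarrow> r \<le> R \<Longrightarrow> average_function w r \<mu> z = emeasure \<mu> (ball z r) * ennreal (1 / measure W (ball z r))"
  using W_ball_pos[of r z]
  by (simp add: average_function_def emeasure_weight_measure_eq[OF w] emeasure_W_ball divide_ennreal_def
      inverse_ennreal inverse_eq_divide)

lemma average_function_measurable:
  assumes "sets \<mu> = sets borel"
  shows "average_function w r \<mu> \<in> borel_measurable borel"
proof -
  have "sets borel \<subseteq> sets (weight_measure w)"
    unfolding weight_measure_def by (auto intro: sets_completionI_sets)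
  then have [measurable]: "(\<lambda>z. emeasure \<mu> (ball z r)) \<in> borel_measurable borel"
      "(\<lambda>z. emeasure (weight_measure w) (ball z r)) \<in> borel_measurable borel"
    using assms by (auto intro!: emeasure_ball_measurable)
  show ?thesis unfolding average_function_def[abs_def] by measurable
qed

text \<open>Halving the radius lets the disk about \<open>\<xi>\<close> fit into the larger disk
  about every nearby \<open>\<eta>\<close>. So the density at a point is dominated by the averages
  on a whole neighbourhood, with no doubling of \<open>\<mu>\<close>.\<close>

lemma ball_density_le_average_function:
  assumes \<mu>: "sets \<mu> = sets borel" and r: "0 < r" "r \<le> R" and d: "dist \<xi> \<eta> < r / 2"
  shows "ball_density \<mu> (r / 2) \<xi> \<le> ennreal (D * Cu) * average_function w r \<mu> \<eta>"
proof -
  have "ball \<xi> (r / 2) \<subseteq> ball \<eta> r"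
  proof
    fix x assume "x \<in> ball \<xi> (r / 2)"
    then show "x \<in> ball \<eta> r" using d dist_triangle[of \<eta> x \<xi>] by (simp add: dist_commute)
  qed
  then have 1: "emeasure \<mu> (ball \<xi> (r / 2)) \<le> emeasure \<mu> (ball \<eta> r)"
    using \<mu> by (intro emeasure_mono) auto
  have "measure W (ball \<eta> r) \<le> v \<eta>" using r by (intro W_ball_le_v)
  also have "\<dots> \<le> D * v \<xi>" using d r by (intro v_doubling) (simp add: dist_commute)
  also have "\<dots> \<le> D * (Cu * u \<xi>)" using v_le_u D by (intro mult_left_mono) auto
  finally have "1 / u \<xi> \<le> D * Cu * (1 / measure W (ball \<eta> r))"
    using u_pos[of \<xi>] W_ball_pos[OF r, of \<eta>] by (simp add: field_simps)
  then have 2: "ennreal (1 / u \<xi>) \<le> ennreal (D * Cu) * ennreal (1 / measure W (ball \<eta> r))"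
    using D Cu by (simp add: ennreal_mult[symmetric] ennreal_leI)
  have "ball_density \<mu> (r / 2) \<xi> \<le> emeasure \<mu> (ball \<eta> r) * (ennreal (D * Cu) * ennreal (1 / measure W (ball \<eta> r)))"
    unfolding ball_density_def using 1 2 by (intro mult_mono) auto
  then show ?thesis by (simp add: average_function_eq[OF r] mult.left_commute)
qed

lemma epowr_ball_density_le:
  assumes \<mu>: "sets \<mu> = sets borel" and r: "0 < r" "r \<le> R" and p: "1 \<le> p"
  shows "epowr (ball_density \<mu> (r / 2) \<xi>) p * ennreal (pi * (r / 2)\<^sup>2) \<le>
    ennreal ((D * Cu) powr p) * (\<integral>\<^sup>+\<eta>\<in>ball \<xi> (r / 2). epowr (average_function w r \<mu> \<eta>) p \<partial>lborel)"
proof -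
  note average_function_measurable[OF \<mu>, measurable]
  have DC: "0 \<le> D * Cu" using D Cu by simp
  have "epowr (ball_density \<mu> (r / 2) \<xi>) p * ennreal (pi * (r / 2)\<^sup>2) =
      (\<integral>\<^sup>+\<eta>. epowr (ball_density \<mu> (r / 2) \<xi>) p * indicator (ball \<xi> (r / 2)) \<eta> \<partial>lborel)"
    using r by (subst nn_integral_cmult_indicator) (auto simp: emeasure_lborel_ball_complex)
  also have "\<dots> \<le> (\<integral>\<^sup>+\<eta>. ennreal ((D * Cu) powr p) *
      (epowr (average_function w r \<mu> \<eta>) p * indicator (ball \<xi> (r / 2)) \<eta>) \<partial>lborel)"
  proof (rule nn_integral_mono)
    fix \<eta>
    have "epowr (ball_density \<mu> (r / 2) \<xi>) p \<le> ennreal ((D * Cu) powr p) * epowr (average_function w r \<mu> \<eta>) p"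
      if "dist \<xi> \<eta> < r / 2"
    proof -
      have "epowr (ball_density \<mu> (r / 2) \<xi>) p \<le> epowr (ennreal (D * Cu) * average_function w r \<mu> \<eta>) p"
        using ball_density_le_average_function[OF \<mu> r that] p by (intro epowr_mono) auto
      then show ?thesis using p DC by (simp add: epowr_mult epowr_ennreal)
    qed
    then show "epowr (ball_density \<mu> (r / 2) \<xi>) p * indicator (ball \<xi> (r / 2)) \<eta> \<le> ennreal ((D * Cu) powr p) *
      (epowr (average_function w r \<mu> \<eta>) p * indicator (ball \<xi> (r / 2)) \<eta>)"
      by (auto simp: indicator_def)
  qed
  also have "\<dots> = ennreal ((D * Cu) powr p) * (\<integral>\<^sup>+\<eta>\<in>ball \<xi> (r / 2). epowr (average_function w r \<mu> \<eta>) p \<partial>lborel)"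
    by (intro nn_integral_cmult) measurable
  finally show ?thesis .
qed

text \<open>The measure \<open>W\<close> divided by \<open>u\<close> behaves like area: it gives
  bounded mass to disks of radius \<open>r / 2\<close>. Hence the local bound by averages can be
  integrated against it and swapped.\<close>

lemma ball_density_smoothing:
  assumes r: "0 < r" "r \<le> R" and p: "1 \<le> p"
  shows "\<exists>A>0. \<forall>\<mu>. sets \<mu> = sets borel \<longrightarrow>
    (\<integral>\<^sup>+\<xi>. epowr (ball_density \<mu> (r / 2) \<xi>) p * ennreal (1 / u \<xi>) \<partial>W) \<le>
    ennreal A * (\<integral>\<^sup>+\<eta>. epowr (average_function w r \<mu> \<eta>) p \<partial>lborel)"
proof -
  let ?\<rho> = "r / 2" let ?a = "pi * (r / 2)\<^sup>2"
  have a: "0 < ?a" using r by simp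
  define A where "A = (D * Cu) powr p * (D * Cu) / ?a"
  have DC: "0 < D * Cu" using D Cu by simp
  have "(\<integral>\<^sup>+\<xi>. epowr (ball_density \<mu> (r / 2) \<xi>) p * ennreal (1 / u \<xi>) \<partial>W) \<le>
    ennreal A * (\<integral>\<^sup>+\<eta>. epowr (average_function w r \<mu> \<eta>) p \<partial>lborel)"
    if \<mu>: "sets \<mu> = sets borel" for \<mu>
  proof -
    note [measurable] = ball_density_measurable[OF \<mu>] average_function_measurable[OF \<mu>]
    let ?av = "\<lambda>\<eta>. epowr (average_function w r \<mu> \<eta>) p"
    have "ennreal ?a * (\<integral>\<^sup>+\<xi>. epowr (ball_density \<mu> ?\<rho> \<xi>) p * ennreal (1 / u \<xi>) \<partial>W) =
        (\<integral>\<^sup>+\<xi>. ennreal ?a * (epowr (ball_density \<mu> ?\<rho> \<xi>) p * ennreal (1 / u \<xi>)) \<partial>W)"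
      by (intro nn_integral_cmult[symmetric]) measurable
    also have "\<dots> \<le> (\<integral>\<^sup>+\<xi>. (ennreal ((D * Cu) powr p) * ennreal (1 / u \<xi>)) * (\<integral>\<^sup>+\<eta>\<in>ball \<xi> ?\<rho>. ?av \<eta> \<partial>lborel) \<partial>W)"
    proof (rule nn_integral_mono)
      fix \<xi>
      have "epowr (ball_density \<mu> ?\<rho> \<xi>) p * ennreal ?a * ennreal (1 / u \<xi>) \<le>
          ennreal ((D * Cu) powr p) * (\<integral>\<^sup>+\<eta>\<in>ball \<xi> ?\<rho>. ?av \<eta> \<partial>lborel) * ennreal (1 / u \<xi>)"
        by (intro mult_right_mono epowr_ball_density_le \<mu> r p) auto
      then show "ennreal ?a * (epowr (ball_density \<mu> ?\<rho> \<xi>) p * ennreal (1 / u \<xi>)) \<le>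
          (ennreal ((D * Cu) powr p) * ennreal (1 / u \<xi>)) * (\<integral>\<^sup>+\<eta>\<in>ball \<xi> ?\<rho>. ?av \<eta> \<partial>lborel)"
        by (simp only: mult_ac)
    qed
    also have "\<dots> = (\<integral>\<^sup>+\<eta>. ?av \<eta> * (\<integral>\<^sup>+\<xi>\<in>ball \<eta> ?\<rho>. ennreal ((D * Cu) powr p) * ennreal (1 / u \<xi>) \<partial>W) \<partial>lborel)"
      by (rule nn_integral_ball_swap[OF sigma_finite_W _ sigma_finite_lborel]) (auto simp del: ennreal_mult)
    also have "\<dots> \<le> (\<integral>\<^sup>+\<eta>. ennreal ((D * Cu) powr p * (D * Cu)) * ?av \<eta> \<partial>lborel)"
    proof (rule nn_integral_mono)
      fix \<eta>
      \<comment> \<open>On the disk about \<open>\<eta>\<close> doubling replaces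
        \<open>u \<xi>\<close> by \<open>v \<eta>\<close>, which also bounds the mass of that
        disk.\<close>
      have "(\<integral>\<^sup>+\<xi>\<in>ball \<eta> ?\<rho>. ennreal ((D * Cu) powr p) * ennreal (1 / u \<xi>) \<partial>W) \<le>
          (\<integral>\<^sup>+\<xi>. ennreal ((D * Cu) powr p * (D * Cu) / v \<eta>) * indicator (ball \<eta> ?\<rho>) \<xi> \<partial>W)"
      proof (rule nn_integral_mono)
        fix \<xi>
        have "1 / u \<xi> \<le> D * Cu / v \<eta>" if "dist \<eta> \<xi> < ?\<rho>"
        proof -
          have "v \<eta> \<le> D * v \<xi>" using that r by (intro v_doubling) simp
          also have "\<dots> \<le> D * (Cu * u \<xi>)" using v_le_u D by (intro mult_left_mono) auto
          finally show ?thesis using u_pos[of \<xi>] v_pos[of \<eta>] by (simp add: field_simps)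
        qed
        then have "(D * Cu) powr p * (1 / u \<xi>) \<le> (D * Cu) powr p * (D * Cu) / v \<eta>" if "dist \<eta> \<xi> < ?\<rho>"
          using that by (metis mult_left_mono powr_ge_zero times_divide_eq_right)
        then show "ennreal ((D * Cu) powr p) * ennreal (1 / u \<xi>) * indicator (ball \<eta> ?\<rho>) \<xi> \<le>
            ennreal ((D * Cu) powr p * (D * Cu) / v \<eta>) * indicator (ball \<eta> ?\<rho>) \<xi>"
          using u_pos[of \<xi>] by (auto simp: indicator_def ennreal_mult[symmetric] intro!: ennreal_leI)
      qed
      also have "\<dots> = ennreal ((D * Cu) powr p * (D * Cu) / v \<eta> * measure W (ball \<eta> ?\<rho>))"
        using DC v_pos[of \<eta>]
        by (subst nn_integral_cmult_indicator) (auto simp: emeasure_W_ball ennreal_mult[symmetric])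
      also have "\<dots> \<le> ennreal ((D * Cu) powr p * (D * Cu))"
      proof (rule ennreal_leI)
        have "measure W (ball \<eta> ?\<rho>) \<le> v \<eta>" using r by (intro W_ball_le_v) simp
        then have "(D * Cu) powr p * (D * Cu) / v \<eta> * measure W (ball \<eta> ?\<rho>) \<le> (D * Cu) powr p * (D * Cu) / v \<eta> * v \<eta>"
          using DC v_pos[of \<eta>] by (intro mult_left_mono) auto
        then show "(D * Cu) powr p * (D * Cu) / v \<eta> * measure W (ball \<eta> ?\<rho>) \<le> (D * Cu) powr p * (D * Cu)"
          using v_pos[of \<eta>] by simp
      qed
      finally have "?av \<eta> * (\<integral>\<^sup>+\<xi>\<in>ball \<eta> ?\<rho>. ennreal ((D * Cu) powr p) * ennreal (1 / u \<xi>) \<partial>W) \<le>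
          ?av \<eta> * ennreal ((D * Cu) powr p * (D * Cu))" by (rule mult_left_mono) simp
      then show "?av \<eta> * (\<integral>\<^sup>+\<xi>\<in>ball \<eta> ?\<rho>. ennreal ((D * Cu) powr p) * ennreal (1 / u \<xi>) \<partial>W) \<le>
          ennreal ((D * Cu) powr p * (D * Cu)) * ?av \<eta>" by (simp only: mult.commute)
    qed
    also have "\<dots> = ennreal ((D * Cu) powr p * (D * Cu)) * (\<integral>\<^sup>+\<eta>. ?av \<eta> \<partial>lborel)"
      by (intro nn_integral_cmult) measurable
    also have "ennreal ((D * Cu) powr p * (D * Cu)) = ennreal ?a * ennreal A"
      using a r DC by (simp add: A_def ennreal_mult[symmetric] del: ennreal_mult)
    finally have "ennreal ?a * (\<integral>\<^sup>+\<xi>. epowr (ball_density \<mu> ?\<rho> \<xi>) p * ennreal (1 / u \<xi>) \<partial>W) \<le>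
        ennreal ?a * (ennreal A * (\<integral>\<^sup>+\<eta>. ?av \<eta> \<partial>lborel))" by (simp only: mult.assoc)
    then show ?thesis using a by (subst (asm) ennreal_mult_le_mult_iff) auto
  qed
  moreover have "A > 0"
    unfolding A_def by (intro divide_pos_pos mult_pos_pos[OF _ DC] a) (use D Cu in simp)
  ultimately show ?thesis by blast
qed

text \<open>Compactness covers each large disk by finitely many disks of radius
  \<open>\<rho>\<close>. This supplies the sigma-finiteness that Tonelli's theorem needs and an
  arbitrary \<open>\<mu>\<close> lacks.\<close>

lemma sigma_finite_if_ball_density_finite:
  assumes \<mu>: "sets \<mu> = sets borel" and \<rho>: "0 < \<rho>" and fin: "\<And>\<xi>. ball_density \<mu> \<rho> \<xi> < top"
  shows "sigma_finite_measure \<mu>"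
proof (rule sigma_finite_if_finite_on_balls[OF \<mu>])
  fix n :: nat
  have b: "emeasure \<mu> (ball \<xi> \<rho>) < top" for \<xi>
    using fin[of \<xi>] u_pos[of \<xi>] by (auto simp: ball_density_def ennreal_mult_less_top)
  have cover: "cball (0::complex) (real n) \<subseteq> (\<Union>\<xi>\<in>cball 0 (real n). ball \<xi> \<rho>)"
  proof
    fix x :: complex assume "x \<in> cball 0 (real n)"
    then show "x \<in> (\<Union>\<xi>\<in>cball 0 (real n). ball \<xi> \<rho>)" using \<rho> by (intro UN_I[of x]) auto
  qed
  have "\<exists>I. finite I \<and> cball (0::complex) (real n) \<subseteq> (\<Union>\<xi>\<in>I. ball \<xi> \<rho>)"
  proof (rule compactE_image[OF compact_cball _ cover])
    fix I assume "finite I" "cball (0::complex) (real n) \<subseteq> (\<Union>\<xi>\<in>I. ball \<xi> \<rho>)"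
    then show ?thesis by (intro exI[of _ I] conjI)
  qed (rule open_ball)
  then obtain I where I: "finite I" "cball (0::complex) (real n) \<subseteq> (\<Union>\<xi>\<in>I. ball \<xi> \<rho>)" by (elim exE conjE)
  have "emeasure \<mu> (ball 0 (real n)) \<le> emeasure \<mu> (\<Union>\<xi>\<in>I. ball \<xi> \<rho>)"
  proof (rule emeasure_mono)
    show "ball 0 (real n) \<subseteq> (\<Union>\<xi>\<in>I. ball \<xi> \<rho>)" by (rule order_trans[OF ball_subset_cball I(2)])
    show "(\<Union>\<xi>\<in>I. ball \<xi> \<rho>) \<in> sets \<mu>"
      unfolding \<mu> by (intro borel_open open_UN ballI open_ball)
  qed
  also have "\<dots> \<le> (\<Sum>\<xi>\<in>I. emeasure \<mu> (ball \<xi> \<rho>))"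
    by (rule emeasure_subadditive_finite[OF I(1)]) (simp add: image_subset_iff \<mu>)
  also have "\<dots> < top" using b I(1) by simp
  finally show "emeasure \<mu> (ball 0 (real n)) < top" .
qed

lemma Carleson_estimate:
  assumes \<rho>: "0 < \<rho>" "\<rho> \<le> R / 2"
  shows "\<exists>L>0. \<forall>\<mu> f. sets \<mu> = sets borel \<longrightarrow> sigma_finite_measure \<mu> \<longrightarrow> f holomorphic_on UNIV \<longrightarrow>
    N \<mu> f \<le> ennreal L * (\<integral>\<^sup>+\<xi>. ennreal (sq f \<xi>) * ball_density \<mu> \<rho> \<xi> \<partial>W)"
proof -
  obtain L where L: "L > 0" "\<And>f z. f holomorphic_on UNIV \<Longrightarrow>
      ennreal (sq f z * v z) \<le> ennreal L * (\<integral>\<^sup>+\<xi>\<in>ball z \<rho>. ennreal (sq f \<xi>) \<partial>W)"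
    using local_estimate[of \<rho>] \<rho> R by auto
  have "N \<mu> f \<le> ennreal (L * D) * (\<integral>\<^sup>+\<xi>. ennreal (sq f \<xi>) * ball_density \<mu> \<rho> \<xi> \<partial>W)"
    if \<mu>: "sets \<mu> = sets borel" "sigma_finite_measure \<mu>" and f: "f holomorphic_on UNIV" for \<mu> f
  proof -
    note [measurable] = sq_measurable[OF f] ball_density_measurable[OF \<mu>(1)]
    \<comment> \<open>Doubling moves the normalisation \<open>1 / v \<zeta>\<close> under the
      integral as \<open>D / u \<xi>\<close>, so that after the swap the integral in
      \<open>\<zeta>\<close> is just the \<open>\<mu>\<close>-mass of a disk.\<close>
    have pt: "ennreal (sq f \<zeta>) \<le> (\<integral>\<^sup>+\<xi>\<in>ball \<zeta> \<rho>. ennreal (L * D) * (ennreal (sq f \<xi>) * ennreal (1 / u \<xi>)) \<partial>W)" for \<zeta>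
    proof -
      have "ennreal (sq f \<zeta>) = ennreal (1 / v \<zeta>) * ennreal (sq f \<zeta> * v \<zeta>)"
        using v_pos[of \<zeta>] by (simp add: ennreal_mult[symmetric])
      also have "\<dots> \<le> ennreal (1 / v \<zeta>) * (ennreal L * (\<integral>\<^sup>+\<xi>\<in>ball \<zeta> \<rho>. ennreal (sq f \<xi>) \<partial>W))"
        by (intro mult_left_mono L f) auto
      also have "\<dots> = (\<integral>\<^sup>+\<xi>. ennreal (L / v \<zeta>) * (ennreal (sq f \<xi>) * indicator (ball \<zeta> \<rho>) \<xi>) \<partial>W)"
        using L v_pos[of \<zeta>] by (subst nn_integral_cmult) (auto simp: mult.assoc[symmetric] ennreal_mult[symmetric])
      also have "\<dots> \<le> (\<integral>\<^sup>+\<xi>\<in>ball \<zeta> \<rho>. ennreal (L * D) * (ennreal (sq f \<xi>) * ennreal (1 / u \<xi>)) \<partial>W)"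
      proof (rule nn_integral_mono)
        fix \<xi>
        have "L / v \<zeta> * sq f \<xi> \<le> L * D * (sq f \<xi> * (1 / u \<xi>))" if "dist \<zeta> \<xi> < \<rho>"
        proof -
          have "u \<xi> \<le> v \<xi>" by (rule u_le_v)
          also have "\<dots> \<le> D * v \<zeta>" using that \<rho> by (intro v_doubling) (simp add: dist_commute)
          finally have "L / v \<zeta> \<le> L * D / u \<xi>" using u_pos[of \<xi>] v_pos[of \<zeta>] L by (simp add: field_simps)
          from mult_right_mono[OF this sq_nonneg[of f \<xi>]] show ?thesis by (simp add: mult_ac)
        qed
        then show "ennreal (L / v \<zeta>) * (ennreal (sq f \<xi>) * indicator (ball \<zeta> \<rho>) \<xi>) \<le>
            ennreal (L * D) * (ennreal (sq f \<xi>) * ennreal (1 / u \<xi>)) * indicator (ball \<zeta> \<rho>) \<xi>"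
          using u_pos[of \<xi>] v_pos[of \<zeta>] L D
          by (auto simp: indicator_def ennreal_mult[symmetric] intro!: ennreal_leI)
      qed
      finally show ?thesis .
    qed
    have "N \<mu> f \<le> (\<integral>\<^sup>+\<zeta>. 1 * (\<integral>\<^sup>+\<xi>\<in>ball \<zeta> \<rho>. ennreal (L * D) * (ennreal (sq f \<xi>) * ennreal (1 / u \<xi>)) \<partial>W) \<partial>\<mu>)"
      unfolding N_def mult_1 by (intro nn_integral_mono pt)
    also have "\<dots> = (\<integral>\<^sup>+\<xi>. ennreal (L * D) * (ennreal (sq f \<xi>) * ennreal (1 / u \<xi>)) * (\<integral>\<^sup>+\<zeta>\<in>ball \<xi> \<rho>. 1 \<partial>\<mu>) \<partial>W)"
      by (rule nn_integral_ball_swap[OF \<mu>(2,1) sigma_finite_W]) auto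
    also have "\<dots> = (\<integral>\<^sup>+\<xi>. ennreal (L * D) * (ennreal (sq f \<xi>) * ball_density \<mu> \<rho> \<xi>) \<partial>W)"
    proof (rule nn_integral_cong)
      fix \<xi>
      have "(\<integral>\<^sup>+\<zeta>\<in>ball \<xi> \<rho>. 1 \<partial>\<mu>) = emeasure \<mu> (ball \<xi> \<rho>)" using \<mu> by simp
      then show "ennreal (L * D) * (ennreal (sq f \<xi>) * ennreal (1 / u \<xi>)) * (\<integral>\<^sup>+\<zeta>\<in>ball \<xi> \<rho>. 1 \<partial>\<mu>) =
          ennreal (L * D) * (ennreal (sq f \<xi>) * ball_density \<mu> \<rho> \<xi>)"
        unfolding ball_density_def by (simp only: mult_ac)
    qed
    also have "\<dots> = ennreal (L * D) * (\<integral>\<^sup>+\<xi>. ennreal (sq f \<xi>) * ball_density \<mu> \<rho> \<xi> \<partial>W)"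
      by (intro nn_integral_cmult) measurable
    finally show ?thesis .
  qed
  moreover have "L * D > 0" using L D by simp
  ultimately show ?thesis by blast
qed

text \<open>Integrating the local estimate in \<open>z\<close> and swapping counts every
  \<open>\<xi>\<close> with the area of its disk. Thus the smoothed weight \<open>v\<close> may
  replace \<open>w\<close> in one direction, for entire functions.\<close>

lemma v_weighted_estimate:
  "\<exists>L>0. \<forall>f. f holomorphic_on UNIV \<longrightarrow> (\<integral>\<^sup>+z. ennreal (sq f z * v z) \<partial>lborel) \<le> ennreal L * N W f"
proof -
  obtain L where L: "L > 0" "\<And>f z. f holomorphic_on UNIV \<Longrightarrow>
      ennreal (sq f z * v z) \<le> ennreal L * (\<integral>\<^sup>+\<xi>\<in>ball z R. ennreal (sq f \<xi>) \<partial>W)"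
    using local_estimate[OF R order_refl] by blast
  have "(\<integral>\<^sup>+z. ennreal (sq f z * v z) \<partial>lborel) \<le> ennreal (L * (pi * R\<^sup>2)) * N W f"
    if f: "f holomorphic_on UNIV" for f
  proof -
    note [measurable] = sq_measurable[OF f]
    have "(\<integral>\<^sup>+z. ennreal (sq f z * v z) \<partial>lborel) \<le>
        (\<integral>\<^sup>+z. ennreal L * (\<integral>\<^sup>+\<xi>\<in>ball z R. ennreal (sq f \<xi>) \<partial>W) \<partial>lborel)"
      by (intro nn_integral_mono L f)
    also have "\<dots> = (\<integral>\<^sup>+\<xi>. ennreal (sq f \<xi>) * (\<integral>\<^sup>+z\<in>ball \<xi> R. ennreal L \<partial>lborel) \<partial>W)"
      by (rule nn_integral_ball_swap[OF sigma_finite_lborel _ sigma_finite_W]) auto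
    also have "\<dots> = (\<integral>\<^sup>+\<xi>. ennreal (L * (pi * R\<^sup>2)) * ennreal (sq f \<xi>) \<partial>W)"
      using R L by (intro nn_integral_cong)
        (simp add: nn_integral_cmult_indicator emeasure_lborel_ball_complex ennreal_mult mult.commute)
    also have "\<dots> = ennreal (L * (pi * R\<^sup>2)) * N W f"
      unfolding N_def by (intro nn_integral_cmult) measurable
    finally show ?thesis .
  qed
  moreover have "L * (pi * R\<^sup>2) > 0" using L R by simp
  ultimately show ?thesis by blast
qed

text \<open>The kernel is Hermitian and \<open>1 / K z\<close> is at most a multiple of the Gaussian
  times \<open>v z\<close>, so the integral in \<open>z\<close> becomes the norm of
  \<open>ker \<xi>\<close> with weight \<open>v\<close>, which is at most a multiple of
  \<open>K \<xi>\<close>. This replaces off-diagonal decay.\<close>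

lemma kernel_average_bound:
  "\<exists>A>0. \<forall>\<xi>. (\<integral>\<^sup>+z. ennreal (sq (ker z) \<xi> / K z) \<partial>lborel) \<le> ennreal (A / u \<xi>)"
proof -
  obtain L G where LG: "L > 0" "G > 0" "\<And>z. K z * exp (- \<alpha> * (cmod z)\<^sup>2) * v z \<le> L"
      "\<And>z. 1 \<le> G * (K z * exp (- \<alpha> * (cmod z)\<^sup>2) * v z)"
    using kernel_bounds by blast
  obtain M where M: "M > 0" "\<And>f. f holomorphic_on UNIV \<Longrightarrow> (\<integral>\<^sup>+z. ennreal (sq f z * v z) \<partial>lborel) \<le> ennreal M * N W f"
    using v_weighted_estimate by blast
  have "(\<integral>\<^sup>+z. ennreal (sq (ker z) \<xi> / K z) \<partial>lborel) \<le> ennreal (G * Cu * M * L / u \<xi>)" for \<xi>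
  proof -
    let ?e = "exp (- \<alpha> * (cmod \<xi>)\<^sup>2)"
    have "sq (ker z) \<xi> / K z \<le> G * Cu * ?e * (sq (ker \<xi>) z * u z)" for z
    proof -
      let ?f = "exp (- \<alpha> * (cmod z)\<^sup>2)"
      have "sq (ker z) \<xi> * 1 \<le> sq (ker z) \<xi> * (G * (K z * ?f * v z))"
        by (intro mult_left_mono LG) auto
      also have "\<dots> = G * K z * v z * (sq (ker z) \<xi> * ?f)" by (simp only: mult_ac)
      also have "\<dots> = G * K z * v z * (sq (ker \<xi>) z * ?e)" by (simp only: sq_ker_commute)
      finally have "sq (ker z) \<xi> / K z \<le> G * v z * (sq (ker \<xi>) z * ?e)"
        using K_pos[of z] by (simp add: field_simps)
      \<comment> \<open>\<open>u\<close> enters only to make the integrand measurable when the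
        constant is pulled out; afterwards it is enlarged to \<open>v\<close> again.\<close>
      also have "\<dots> \<le> G * (Cu * u z) * (sq (ker \<xi>) z * ?e)"
        using LG v_le_u[of z] by (intro mult_right_mono mult_left_mono) auto
      finally show ?thesis by (simp only: mult_ac)
    qed
    then have "(\<integral>\<^sup>+z. ennreal (sq (ker z) \<xi> / K z) \<partial>lborel) \<le>
        (\<integral>\<^sup>+z. ennreal (G * Cu * ?e) * ennreal (sq (ker \<xi>) z * u z) \<partial>lborel)"
      using LG Cu u_pos by (intro nn_integral_mono) (auto simp: ennreal_mult[symmetric] less_imp_le intro!: ennreal_leI)
    also have "\<dots> = ennreal (G * Cu * ?e) * (\<integral>\<^sup>+z. ennreal (sq (ker \<xi>) z * u z) \<partial>lborel)"
    proof -
      have [measurable]: "sq (ker \<xi>) \<in> borel_measurable borel" by (intro sq_measurable fockD(1) ker_mem)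
      show ?thesis by (intro nn_integral_cmult) measurable
    qed
    also have "\<dots> \<le> ennreal (G * Cu * ?e) * (\<integral>\<^sup>+z. ennreal (sq (ker \<xi>) z * v z) \<partial>lborel)"
      by (intro mult_left_mono nn_integral_mono ennreal_leI u_le_v) auto
    also have "\<dots> \<le> ennreal (G * Cu * ?e) * (ennreal M * ennreal (K \<xi>))"
      unfolding N_ker[symmetric] by (intro mult_left_mono M fockD(1) ker_mem) auto
    also have "\<dots> = ennreal (G * Cu * M * (K \<xi> * ?e))"
      using LG M Cu K_pos[of \<xi>] by (simp add: ennreal_mult[symmetric] mult_ac)
    also have "\<dots> \<le> ennreal (G * Cu * M * L / u \<xi>)"
    proof (rule ennreal_leI)
      have "K \<xi> * ?e * u \<xi> \<le> K \<xi> * ?e * v \<xi>"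
        using u_le_v[of \<xi>] K_pos[of \<xi>] by (intro mult_left_mono) auto
      then have "K \<xi> * ?e \<le> L / u \<xi>" using LG(3)[of \<xi>] u_pos[of \<xi>] by (simp add: field_simps)
      from mult_left_mono[OF this, of "G * Cu * M"] show "G * Cu * M * (K \<xi> * ?e) \<le> G * Cu * M * L / u \<xi>"
        using LG M Cu by simp
    qed
    finally show ?thesis .
  qed
  moreover have "G * Cu * M * L > 0" using LG M Cu by simp
  ultimately show ?thesis by blast
qed

section \<open>Averages against the Berezin transform\<close>

lemma berezin_eq: "sets \<mu> = sets borel \<Longrightarrow> berezin \<alpha> w \<mu> z = N \<mu> (ker z) * ennreal (1 / K z)"
proof -
  assume \<mu>: "sets \<mu> = sets borel"
  have m: "(\<lambda>\<xi>. ennreal (sq (ker z) \<xi>)) \<in> borel_measurable \<mu>"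
    using sq_measurable[OF fockD(1)[OF ker_mem], of z] \<mu> by (simp cong: measurable_cong_sets)
  have "berezin \<alpha> w \<mu> z = (\<integral>\<^sup>+\<xi>. ennreal (sq (ker z) \<xi>) * ennreal (1 / K z) \<partial>\<mu>)"
    unfolding berezin_def using K_pos[of z]
    by (intro nn_integral_cong)
      (simp add: normalized_kernel_def norm_divide power_divide K_def[symmetric] sq_def ennreal_mult[symmetric])
  also have "\<dots> = N \<mu> (ker z) * ennreal (1 / K z)"
    unfolding N_def by (rule nn_integral_multc[OF m])
  finally show ?thesis .
qed

lemma berezin_measurable: "sets \<mu> = sets borel \<Longrightarrow> berezin \<alpha> w \<mu> \<in> borel_measurable borel"
proof -
  assume \<mu>: "sets \<mu> = sets borel"
  have [measurable]: "(\<lambda>z. N \<mu> (ker z)) \<in> borel_measurable borel" by (rule N_ker_measurable[OF \<mu>])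
  have "(\<lambda>z. N \<mu> (ker z) * ennreal (1 / K z)) \<in> borel_measurable borel" by measurable
  then show ?thesis by (simp add: berezin_eq[OF \<mu>, abs_def])
qed

text \<open>On the disk the integrand of the Berezin transform is at least \<open>c / v z\<close>,
  and \<open>v z\<close> is at most a multiple of the mass of the disk.\<close>

lemma average_le_berezin:
  assumes \<delta>: "c > 0" "\<And>z \<xi>. dist z \<xi> < \<delta> \<Longrightarrow> c * K z \<le> sq (ker z) \<xi> * v z" and r: "0 < r" "r \<le> \<delta>" "r \<le> R"
  shows "\<exists>A>0. \<forall>\<mu> z. sets \<mu> = sets borel \<longrightarrow> average_function w r \<mu> z \<le> ennreal A * berezin \<alpha> w \<mu> z"
proof -
  define A where "A = C / (pi * r\<^sup>2) powr q / c"
  have A: "A > 0" using C r \<delta> by (simp add: A_def)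
  have "average_function w r \<mu> z \<le> ennreal A * berezin \<alpha> w \<mu> z" if \<mu>: "sets \<mu> = sets borel" for \<mu> z
  proof -
    let ?m = "measure W (ball z r)"
    have m: "0 < ?m" by (rule W_ball_pos) (use r in auto)
    have [measurable]: "sq (ker z) \<in> borel_measurable borel" by (intro sq_measurable fockD(1) ker_mem)
    have "(pi * r\<^sup>2) powr q * v z \<le> C * ?m"
      using r ball_Q[of z] by (intro v_le_W_ball) auto
    then have vm: "v z / ?m \<le> C / (pi * r\<^sup>2) powr q" using m r by (simp add: field_simps)
    have "average_function w r \<mu> z = (\<integral>\<^sup>+\<xi>. ennreal (1 / ?m) * indicator (ball z r) \<xi> \<partial>\<mu>)"
      using \<mu> by (subst nn_integral_cmult_indicator) (auto simp: average_function_eq[OF r(1,3)] mult.commute)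
    also have "\<dots> \<le> (\<integral>\<^sup>+\<xi>. ennreal (A / K z) * ennreal (sq (ker z) \<xi>) \<partial>\<mu>)"
    proof (rule nn_integral_mono)
      fix \<xi>
      have "1 / ?m \<le> A / K z * sq (ker z) \<xi>" if "dist z \<xi> < r"
      proof -
        have "c * K z \<le> sq (ker z) \<xi> * v z" using that r by (intro \<delta>(2)) simp
        then have "1 \<le> sq (ker z) \<xi> * v z / (c * K z)" using K_pos[of z] \<delta>(1) by (simp add: field_simps)
        then have "1 / ?m \<le> sq (ker z) \<xi> * v z / (c * K z) / ?m" using m by (intro divide_right_mono) auto
        also have "\<dots> = sq (ker z) \<xi> / (c * K z) * (v z / ?m)" by simp
        also have "\<dots> \<le> sq (ker z) \<xi> / (c * K z) * (C / (pi * r\<^sup>2) powr q)"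
          using vm \<delta>(1) K_pos[of z] by (intro mult_left_mono) auto
        also have "\<dots> = A / K z * sq (ker z) \<xi>" by (simp add: A_def mult_ac)
        finally show ?thesis .
      qed
      then show "ennreal (1 / ?m) * indicator (ball z r) \<xi> \<le> ennreal (A / K z) * ennreal (sq (ker z) \<xi>)"
        using A K_pos[of z] by (auto simp: indicator_def ennreal_mult[symmetric] intro!: ennreal_leI)
    qed
    also have "\<dots> = ennreal (A / K z) * N \<mu> (ker z)"
      unfolding N_def using \<mu> by (intro nn_integral_cmult) (simp cong: measurable_cong_sets)
    also have "\<dots> = ennreal A * berezin \<alpha> w \<mu> z"
      using A K_pos[of z] by (simp add: berezin_eq[OF \<mu>] ennreal_mult[symmetric] mult.left_commute mult.commute[of "N \<mu> (ker z)"] mult.assoc[symmetric])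
    finally show ?thesis .
  qed
  then show ?thesis using A by blast
qed

text \<open>The density \<open>sq (ker z) \<xi> / K z\<close> is treated as in Schur's test: for
  fixed \<open>z\<close> it has mass one against \<open>W\<close>, as Jensen's inequality requires,
  and for fixed \<open>\<xi>\<close> its integral in \<open>z\<close> is at most
  \<open>B / u \<xi>\<close>.\<close>

lemma berezin_Lp:
  assumes r: "0 < r" "r \<le> R" and p: "1 \<le> p"
  shows "\<exists>A>0. \<forall>\<mu>. sets \<mu> = sets borel \<longrightarrow> sigma_finite_measure \<mu> \<longrightarrow>
    (\<integral>\<^sup>+z. epowr (berezin \<alpha> w \<mu> z) p \<partial>lborel) \<le> ennreal A * (\<integral>\<^sup>+z. epowr (average_function w r \<mu> z) p \<partial>lborel)"
proof -
  obtain L where L: "L > 0" "\<And>\<mu> f. sets \<mu> = sets borel \<Longrightarrow> sigma_finite_measure \<mu> \<Longrightarrow> f holomorphic_on UNIV \<Longrightarrow>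
    N \<mu> f \<le> ennreal L * (\<integral>\<^sup>+\<xi>. ennreal (sq f \<xi>) * ball_density \<mu> (r / 2) \<xi> \<partial>W)"
    using Carleson_estimate[of "r / 2"] r by auto
  obtain A where A: "A > 0" "\<And>\<mu>. sets \<mu> = sets borel \<Longrightarrow>
    (\<integral>\<^sup>+\<xi>. epowr (ball_density \<mu> (r / 2) \<xi>) p * ennreal (1 / u \<xi>) \<partial>W) \<le>
    ennreal A * (\<integral>\<^sup>+\<eta>. epowr (average_function w r \<mu> \<eta>) p \<partial>lborel)"
    using ball_density_smoothing[OF r p] by blast
  obtain B where B: "B > 0" "\<And>\<xi>. (\<integral>\<^sup>+z. ennreal (sq (ker z) \<xi> / K z) \<partial>lborel) \<le> ennreal (B / u \<xi>)"
    using kernel_average_bound by blast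
  have "(\<integral>\<^sup>+z. epowr (berezin \<alpha> w \<mu> z) p \<partial>lborel) \<le>
      ennreal (L powr p * B * A) * (\<integral>\<^sup>+z. epowr (average_function w r \<mu> z) p \<partial>lborel)"
    if \<mu>: "sets \<mu> = sets borel" "sigma_finite_measure \<mu>" for \<mu>
  proof -
    let ?h = "ball_density \<mu> (r / 2)"
    note hm [measurable] = ball_density_measurable[OF \<mu>(1), of "r / 2"]
    have sm [measurable]: "sq (ker z) \<in> borel_measurable borel" for z by (intro sq_measurable fockD(1) ker_mem)
    have pt: "epowr (berezin \<alpha> w \<mu> z) p \<le> ennreal (L powr p) * (\<integral>\<^sup>+\<xi>. ennreal (sq (ker z) \<xi> / K z) * epowr (?h \<xi>) p \<partial>W)" for z
    proof -
      define m where "m = density W (\<lambda>\<xi>. ennreal (sq (ker z) \<xi> / K z))"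
      have hmm: "?h \<in> borel_measurable m" using hm by (simp add: m_def)
      have im: "(\<integral>\<^sup>+\<xi>. g \<xi> \<partial>m) = (\<integral>\<^sup>+\<xi>. ennreal (sq (ker z) \<xi> / K z) * g \<xi> \<partial>W)" if "g \<in> borel_measurable borel" for g
        unfolding m_def using that by (intro nn_integral_density) (auto cong: measurable_cong_sets)
      have "emeasure m (space m) = (\<integral>\<^sup>+\<xi>. ennreal (sq (ker z) \<xi> / K z) * 1 \<partial>W)"
        using im[of "\<lambda>_. 1"] by simp
      also have "\<dots> = (\<integral>\<^sup>+\<xi>. ennreal (1 / K z) * ennreal (sq (ker z) \<xi>) \<partial>W)"
        using K_pos[of z] by (intro nn_integral_cong) (simp add: ennreal_mult[symmetric])
      also have "\<dots> = ennreal (1 / K z) * N W (ker z)"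
        unfolding N_def by (intro nn_integral_cmult) measurable
      also have "\<dots> = ennreal 1" using K_pos[of z] by (simp add: N_ker ennreal_mult[symmetric] del: ennreal_1)
      finally have mass: "emeasure m (space m) \<le> ennreal 1" by simp
      have "berezin \<alpha> w \<mu> z \<le> ennreal L * (\<integral>\<^sup>+\<xi>. ennreal (sq (ker z) \<xi>) * ?h \<xi> \<partial>W) * ennreal (1 / K z)"
        unfolding berezin_eq[OF \<mu>(1)] by (intro mult_right_mono L \<mu> fockD(1) ker_mem) auto
      also have "\<dots> = ennreal L * ((\<integral>\<^sup>+\<xi>. ennreal (sq (ker z) \<xi>) * ?h \<xi> \<partial>W) * ennreal (1 / K z))"
        by (rule mult.assoc)
      also have "(\<integral>\<^sup>+\<xi>. ennreal (sq (ker z) \<xi>) * ?h \<xi> \<partial>W) * ennreal (1 / K z) =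
          (\<integral>\<^sup>+\<xi>. ennreal (sq (ker z) \<xi>) * ?h \<xi> * ennreal (1 / K z) \<partial>W)"
        by (intro nn_integral_multc[symmetric]) measurable
      also have "\<dots> = (\<integral>\<^sup>+\<xi>. ?h \<xi> \<partial>m)"
        unfolding im[OF hm]
      proof (rule nn_integral_cong)
        fix \<xi>
        have "ennreal (sq (ker z) \<xi> / K z) = ennreal (sq (ker z) \<xi>) * ennreal (1 / K z)"
          using K_pos[of z] by (simp add: ennreal_mult[symmetric])
        then show "ennreal (sq (ker z) \<xi>) * ?h \<xi> * ennreal (1 / K z) = ennreal (sq (ker z) \<xi> / K z) * ?h \<xi>"
          by (simp only: mult_ac)
      qed
      finally have "epowr (berezin \<alpha> w \<mu> z) p \<le> epowr (ennreal L * (\<integral>\<^sup>+\<xi>. ?h \<xi> \<partial>m)) p"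
        using p by (intro epowr_mono) auto
      also have "\<dots> = ennreal (L powr p) * epowr (\<integral>\<^sup>+\<xi>. ?h \<xi> \<partial>m) p"
        using p L by (simp add: epowr_mult epowr_ennreal)
      also have "\<dots> \<le> ennreal (L powr p) * (ennreal (1 powr (p - 1)) * (\<integral>\<^sup>+\<xi>. epowr (?h \<xi>) p \<partial>m))"
        by (intro mult_left_mono nn_integral_epowr_ge[OF hmm _ mass p]) auto
      also have "(\<integral>\<^sup>+\<xi>. epowr (?h \<xi>) p \<partial>m) = (\<integral>\<^sup>+\<xi>. ennreal (sq (ker z) \<xi> / K z) * epowr (?h \<xi>) p \<partial>W)"
        by (rule im) measurable
      finally show ?thesis by simp
    qed
    interpret pair_sigma_finite lborel W
      using sigma_finite_W sigma_finite_lborel by (simp add: pair_sigma_finite_def)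
    have cong: "sets (lborel \<Otimes>\<^sub>M W) = sets (borel \<Otimes>\<^sub>M borel :: (complex \<times> complex) measure)"
      by (rule sets_pair_measure_cong) auto
    \<comment> \<open>Tonelli needs joint measurability, which holds because the kernel is
      continuous in \<open>z\<close> and measurable in \<open>\<xi>\<close>.\<close>
    have joint: "(\<lambda>(z, \<xi>). ennreal (sq (ker z) \<xi> / K z) * epowr (?h \<xi>) p) \<in> borel_measurable (lborel \<Otimes>\<^sub>M W)"
      unfolding measurable_cong_sets[OF cong refl]
    proof -
      define X where "X = (\<lambda>p. ker (fst p) (snd p))"
      have [measurable]: "X \<in> borel_measurable (borel \<Otimes>\<^sub>M borel)"
        unfolding X_def by (rule ker_joint_measurable)
      have "(\<lambda>t. ennreal ((cmod (X t))\<^sup>2 * exp (- \<alpha> * (cmod (snd t))\<^sup>2) / K (fst t)) * epowr (?h (snd t)) p)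
          \<in> borel_measurable (borel \<Otimes>\<^sub>M borel)"
      proof (intro borel_measurable_times_ennreal)
        have [measurable]: "(\<lambda>\<xi>. exp (- \<alpha> * (cmod \<xi>)\<^sup>2)) \<in> borel_measurable borel" by measurable
        have "(\<lambda>t. exp (- \<alpha> * (cmod (snd t))\<^sup>2)) \<in> borel_measurable (borel \<Otimes>\<^sub>M borel)"
          "(\<lambda>t. K (fst t)) \<in> borel_measurable (borel \<Otimes>\<^sub>M borel)"
          "(\<lambda>t. (cmod (X t))\<^sup>2) \<in> borel_measurable (borel \<Otimes>\<^sub>M borel)"
          by measurable
        then show "(\<lambda>t. ennreal ((cmod (X t))\<^sup>2 * exp (- \<alpha> * (cmod (snd t))\<^sup>2) / K (fst t)))
            \<in> borel_measurable (borel \<Otimes>\<^sub>M borel)"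
          by (intro measurable_compose[OF _ measurable_ennreal] borel_measurable_divide borel_measurable_times)
        show "(\<lambda>t. epowr (?h (snd t)) p) \<in> borel_measurable (borel \<Otimes>\<^sub>M borel)"
          by (intro measurable_epowr measurable_compose[OF measurable_snd hm])
      qed
      then show "(\<lambda>(z, \<xi>). ennreal (sq (ker z) \<xi> / K z) * epowr (?h \<xi>) p) \<in> borel_measurable (borel \<Otimes>\<^sub>M borel)"
        by (simp add: X_def sq_def case_prod_beta')
    qed
    have "(\<integral>\<^sup>+z. epowr (berezin \<alpha> w \<mu> z) p \<partial>lborel) \<le>
        (\<integral>\<^sup>+z. ennreal (L powr p) * (\<integral>\<^sup>+\<xi>. ennreal (sq (ker z) \<xi> / K z) * epowr (?h \<xi>) p \<partial>W) \<partial>lborel)"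
      by (intro nn_integral_mono pt)
    also have "\<dots> = ennreal (L powr p) * (\<integral>\<^sup>+z. \<integral>\<^sup>+\<xi>. ennreal (sq (ker z) \<xi> / K z) * epowr (?h \<xi>) p \<partial>W \<partial>lborel)"
      using M2.borel_measurable_nn_integral[OF joint] by (intro nn_integral_cmult) simp
    also have "(\<integral>\<^sup>+z. \<integral>\<^sup>+\<xi>. ennreal (sq (ker z) \<xi> / K z) * epowr (?h \<xi>) p \<partial>W \<partial>lborel) =
        (\<integral>\<^sup>+\<xi>. \<integral>\<^sup>+z. ennreal (sq (ker z) \<xi> / K z) * epowr (?h \<xi>) p \<partial>lborel \<partial>W)"
      using Fubini'[OF joint] by simp
    also have "\<dots> \<le> (\<integral>\<^sup>+\<xi>. ennreal B * (epowr (?h \<xi>) p * ennreal (1 / u \<xi>)) \<partial>W)"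
    proof (rule nn_integral_mono)
      fix \<xi>
      have zm: "(\<lambda>z. ennreal (sq (ker z) \<xi> / K z)) \<in> borel_measurable lborel"
      proof -
        have [measurable]: "(\<lambda>z. ker z \<xi>) \<in> borel_measurable borel"
          by (intro borel_measurable_continuous_onI ker_continuous)
        show ?thesis unfolding sq_def by measurable
      qed
      have "(\<integral>\<^sup>+z. ennreal (sq (ker z) \<xi> / K z) * epowr (?h \<xi>) p \<partial>lborel) =
          (\<integral>\<^sup>+z. ennreal (sq (ker z) \<xi> / K z) \<partial>lborel) * epowr (?h \<xi>) p"
        by (rule nn_integral_multc[OF zm])
      also have "\<dots> \<le> ennreal (B / u \<xi>) * epowr (?h \<xi>) p" by (intro mult_right_mono B) auto
      also have "ennreal (B / u \<xi>) = ennreal B * ennreal (1 / u \<xi>)"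
        using B u_pos[of \<xi>] by (simp add: ennreal_mult[symmetric])
      also have "ennreal B * ennreal (1 / u \<xi>) * epowr (?h \<xi>) p = ennreal B * (epowr (?h \<xi>) p * ennreal (1 / u \<xi>))"
        by (simp only: mult_ac)
      finally show "(\<integral>\<^sup>+z. ennreal (sq (ker z) \<xi> / K z) * epowr (?h \<xi>) p \<partial>lborel) \<le>
          ennreal B * (epowr (?h \<xi>) p * ennreal (1 / u \<xi>))" .
    qed
    also have "\<dots> = ennreal B * (\<integral>\<^sup>+\<xi>. epowr (?h \<xi>) p * ennreal (1 / u \<xi>) \<partial>W)"
      by (intro nn_integral_cmult) measurable
    also have "\<dots> \<le> ennreal B * (ennreal A * (\<integral>\<^sup>+\<eta>. epowr (average_function w r \<mu> \<eta>) p \<partial>lborel))"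
      by (intro mult_left_mono A \<mu>) auto
    finally show ?thesis using L B A by (simp add: ennreal_mult mult.assoc mult_left_mono)
  qed
  moreover have "L powr p * B * A > 0" using L A B by simp
  ultimately show ?thesis by blast
qed

end

section \<open>Toeplitz forms\<close>

context restricted_weight
begin

text \<open>The sesquilinear form of the Toeplitz operator, which is at the same time its pointwise
  value when the second argument is a kernel (\<open>toeplitz_eq_gip\<close>).\<close>

definition gip :: "complex measure \<Rightarrow> complex inner_product" where
  "gip \<mu> f g = (LINT \<xi>|\<mu>. f \<xi> * cnj (g \<xi>) * of_real (exp (- \<alpha> * (cmod \<xi>)\<^sup>2)))"

lemma holomorphic_measurable:
  assumes "sets \<mu> = sets borel" "f holomorphic_on UNIV"
  shows "f \<in> borel_measurable \<mu>"
proof -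
  have "f \<in> borel_measurable borel"
    using assms by (intro borel_measurable_continuous_onI holomorphic_on_imp_continuous_on)
  then show ?thesis using assms(1) by (simp cong: measurable_cong_sets)
qed

lemma sq_measurable_wrt: "sets \<mu> = sets borel \<Longrightarrow> f holomorphic_on UNIV \<Longrightarrow> sq f \<in> borel_measurable \<mu>"
  using sq_measurable[of f] by (simp cong: measurable_cong_sets)

lemma sq_integrable:
  assumes "sets \<mu> = sets borel" "f holomorphic_on UNIV" "N \<mu> f < top"
  shows "integrable \<mu> (sq f)"
  using assms sq_measurable_wrt[OF assms(1,2)] by (simp add: integrable_iff_bounded N_def)

lemma gip_integrable:
  assumes \<mu>: "sets \<mu> = sets borel" and f: "f holomorphic_on UNIV" "N \<mu> f < top"
    and g: "g holomorphic_on UNIV" "N \<mu> g < top"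
  shows "integrable \<mu> (\<lambda>\<xi>. f \<xi> * cnj (g \<xi>) * of_real (exp (- \<alpha> * (cmod \<xi>)\<^sup>2)))"
proof (rule Bochner_Integration.integrable_bound)
  show "integrable \<mu> (\<lambda>\<xi>. sq f \<xi> + sq g \<xi>)"
    by (intro Bochner_Integration.integrable_add sq_integrable assms)
  have e: "(\<lambda>\<xi>::complex. complex_of_real (exp (- \<alpha> * (cmod \<xi>)\<^sup>2))) \<in> borel_measurable \<mu>"
    unfolding measurable_cong_sets[OF \<mu> refl]
    by (intro borel_measurable_continuous_onI continuous_intros)
  have c: "(\<lambda>z. cnj (g z)) \<in> borel_measurable \<mu>"
    by (rule measurable_compose[OF holomorphic_measurable[OF \<mu> g(1)] borel_measurable_continuous_onI])
      (intro continuous_intros)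
  show "(\<lambda>\<xi>. f \<xi> * cnj (g \<xi>) * of_real (exp (- \<alpha> * (cmod \<xi>)\<^sup>2))) \<in> borel_measurable \<mu>"
    by (intro borel_measurable_times holomorphic_measurable[OF \<mu> f(1)] c e)
  show "AE \<xi> in \<mu>. norm (f \<xi> * cnj (g \<xi>) * of_real (exp (- \<alpha> * (cmod \<xi>)\<^sup>2))) \<le> norm (sq f \<xi> + sq g \<xi>)"
  proof (rule AE_I2)
    fix \<xi>
    have "cmod (f \<xi>) * cmod (g \<xi>) \<le> (cmod (f \<xi>))\<^sup>2 + (cmod (g \<xi>))\<^sup>2"
      using sum_squares_bound[of "cmod (f \<xi>)" "cmod (g \<xi>)", unfolded mult.assoc]
        mult_nonneg_nonneg[OF norm_ge_zero[of "f \<xi>"] norm_ge_zero[of "g \<xi>"]] by linarith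
    from mult_right_mono[OF this, of "exp (- \<alpha> * (cmod \<xi>)\<^sup>2)"]
    show "norm (f \<xi> * cnj (g \<xi>) * of_real (exp (- \<alpha> * (cmod \<xi>)\<^sup>2))) \<le> norm (sq f \<xi> + sq g \<xi>)"
      by (simp add: sq_def norm_mult algebra_simps)
  qed
qed

lemma gip_self: "gip \<mu> f f = of_real (LINT \<xi>|\<mu>. sq f \<xi>)"
proof -
  have "f \<xi> * cnj (f \<xi>) * of_real (exp (- \<alpha> * (cmod \<xi>)\<^sup>2)) = of_real (sq f \<xi>)" for \<xi>
    unfolding sq_def complex_norm_square[symmetric] by simp
  then show ?thesis by (simp add: gip_def)
qed

lemma N_eq_gip:
  assumes "sets \<mu> = sets borel" "f holomorphic_on UNIV" "N \<mu> f < top"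
  shows "N \<mu> f = ennreal (Re (gip \<mu> f f))"
  unfolding N_def gip_self Re_complex_of_real
  by (intro nn_integral_eq_integral sq_integrable assms) auto

text \<open>The Fock space embeds boundedly into the Gaussian \<open>L^2\<close> space of
  \<open>\<mu>\<close>. Under this condition the Bochner integrals in \<open>gip\<close> are those
  of integrable functions.\<close>

definition carleson :: "complex measure \<Rightarrow> real \<Rightarrow> bool" where
  "carleson \<mu> M \<longleftrightarrow> sets \<mu> = sets borel \<and> 0 \<le> M \<and> (\<forall>f. f holomorphic_on UNIV \<longrightarrow> N \<mu> f \<le> ennreal M * N W f)"

lemma carleson_if_ball_density_bounded:
  assumes \<mu>: "sets \<mu> = sets borel" and r: "0 < r" "r \<le> R" and M: "0 \<le> M" "\<And>\<xi>. ball_density \<mu> (r / 2) \<xi> \<le> ennreal M"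
  shows "\<exists>M. carleson \<mu> M"
proof -
  obtain L where L: "L > 0" "\<And>\<mu> f. sets \<mu> = sets borel \<Longrightarrow> sigma_finite_measure \<mu> \<Longrightarrow> f holomorphic_on UNIV \<Longrightarrow>
    N \<mu> f \<le> ennreal L * (\<integral>\<^sup>+\<xi>. ennreal (sq f \<xi>) * ball_density \<mu> (r / 2) \<xi> \<partial>W)"
    using Carleson_estimate[of "r / 2"] r by auto
  have sf: "sigma_finite_measure \<mu>"
    by (rule sigma_finite_if_ball_density_finite[OF \<mu> _ le_less_trans[OF M(2) ennreal_less_top]]) (use r in simp)
  have "N \<mu> f \<le> ennreal (L * M) * N W f" if f: "f holomorphic_on UNIV" for f
  proof -
    note [measurable] = sq_measurable[OF f]
    have "N \<mu> f \<le> ennreal L * (\<integral>\<^sup>+\<xi>. ennreal (sq f \<xi>) * ball_density \<mu> (r / 2) \<xi> \<partial>W)" by (rule L(2)[OF \<mu> sf f])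
    also have "\<dots> \<le> ennreal L * (\<integral>\<^sup>+\<xi>. ennreal (sq f \<xi>) * ennreal M \<partial>W)"
      by (intro mult_left_mono nn_integral_mono M) auto
    also have "\<dots> = ennreal (L * M) * N W f"
      unfolding N_def using L(1) M(1)
      by (subst nn_integral_multc) (auto simp: ennreal_mult mult_ac)
    finally show ?thesis .
  qed
  then show ?thesis using \<mu> L(1) M(1) unfolding carleson_def by (intro exI[of _ "L * M"]) auto
qed

lemma N_finite_if_carleson: "carleson \<mu> M \<Longrightarrow> f \<in> fock \<alpha> w \<Longrightarrow> N \<mu> f < top"
proof -
  assume c: "carleson \<mu> M" and f: "f \<in> fock \<alpha> w"
  have "N \<mu> f \<le> ennreal M * N W f" using c fockD(1)[OF f] by (simp add: carleson_def)
  also have "\<dots> < top" using fockD(2)[OF f] by (simp add: ennreal_mult_less_top)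
  finally show ?thesis .
qed

lemma semi_inner_form_gip:
  assumes c: "carleson \<mu> M"
  shows "semi_inner_form (fock \<alpha> w) (gip \<mu>)"
proof
  have \<mu>: "sets \<mu> = sets borel" using c by (simp add: carleson_def)
  note int = gip_integrable[OF \<mu> fockD(1) N_finite_if_carleson[OF c] fockD(1) N_finite_if_carleson[OF c]]
  fix f g h :: "complex \<Rightarrow> complex" and a
  assume f: "f \<in> fock \<alpha> w"
  show "scl a f \<in> fock \<alpha> w" using f by simp
  show "0 \<le> Re (gip \<mu> f f)" by (simp add: gip_self)
  assume g: "g \<in> fock \<alpha> w"
  show "f + g \<in> fock \<alpha> w" using f g by simp
  have "cnj (gip \<mu> f g) = (LINT \<xi>|\<mu>. cnj (f \<xi> * cnj (g \<xi>) * of_real (exp (- \<alpha> * (cmod \<xi>)\<^sup>2))))"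
    unfolding gip_def by (rule Bochner_Integration.integral_cnj[symmetric])
  also have "\<dots> = gip \<mu> g f" unfolding gip_def by (intro Bochner_Integration.integral_cong) auto
  finally show "gip \<mu> g f = cnj (gip \<mu> f g)" by (rule sym)
  have "gip \<mu> (scl a f) g = (LINT \<xi>|\<mu>. a * (f \<xi> * cnj (g \<xi>) * of_real (exp (- \<alpha> * (cmod \<xi>)\<^sup>2))))"
    unfolding gip_def by (intro Bochner_Integration.integral_cong) auto
  then show "gip \<mu> (scl a f) g = a * gip \<mu> f g" by (simp add: gip_def)
  assume h: "h \<in> fock \<alpha> w"
  have "gip \<mu> (f + g) h = (LINT \<xi>|\<mu>. f \<xi> * cnj (h \<xi>) * of_real (exp (- \<alpha> * (cmod \<xi>)\<^sup>2)) +
      g \<xi> * cnj (h \<xi>) * of_real (exp (- \<alpha> * (cmod \<xi>)\<^sup>2)))"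
    unfolding gip_def by (intro Bochner_Integration.integral_cong) (auto simp: algebra_simps)
  also have "\<dots> = gip \<mu> f h + gip \<mu> g h"
    unfolding gip_def by (intro Bochner_Integration.integral_add int f g h)
  finally show "gip \<mu> (f + g) h = gip \<mu> f h + gip \<mu> g h" .
qed simp

lemma toeplitz_eq_gip: "toeplitz \<alpha> w \<mu> f z = gip \<mu> f (ker z)"
  by (simp add: toeplitz_def toeplitz_integrand_def gip_def)

lemma Re_gip_le:
  assumes c: "carleson \<mu> M" and f: "f \<in> fock \<alpha> w"
  shows "Re (gip \<mu> f f) \<le> M * (F.nrm f)\<^sup>2"
proof -
  have "N \<mu> f \<le> ennreal M * N W f" "0 \<le> M" "sets \<mu> = sets borel"
    using c fockD(1)[OF f] by (simp_all add: carleson_def)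
  then show ?thesis
    using N_eq_gip[OF _ fockD(1)[OF f] N_finite_if_carleson[OF c f]]
    by (simp add: N_eq_nrm[OF f] ennreal_mult[symmetric])
qed

text \<open>Riesz representation of the bounded form gives an \<open>h\<close> in the space, and
  testing against kernels identifies \<open>h\<close> with the pointwise integral. So neither
  holomorphy of the integral nor an exchange of integrals has to be proved.\<close>

lemma toeplitz_form:
  assumes c: "carleson \<mu> M" and f: "f \<in> fock \<alpha> w"
  shows "toeplitz \<alpha> w \<mu> f \<in> fock \<alpha> w \<and> (\<forall>g\<in>fock \<alpha> w. fock_ip \<alpha> w (toeplitz \<alpha> w \<mu> f) g = gip \<mu> f g)"
proof -
  interpret G: semi_inner_form "fock \<alpha> w" "gip \<mu>" by (rule semi_inner_form_gip[OF c])
  have "cmod (gip \<mu> g f) \<le> sqrt (M * Re (gip \<mu> f f)) * F.nrm g" if g: "g \<in> fock \<alpha> w" for g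
  proof (rule power2_le_imp_le)
    have M: "0 \<le> M" using c by (simp add: carleson_def)
    have "(cmod (gip \<mu> g f))\<^sup>2 \<le> Re (gip \<mu> g g) * Re (gip \<mu> f f)" by (rule G.Cauchy_Schwarz[OF g f])
    also have "\<dots> \<le> M * (F.nrm g)\<^sup>2 * Re (gip \<mu> f f)"
      by (intro mult_right_mono Re_gip_le[OF c g] G.form_nonneg[OF f])
    also have "\<dots> = (sqrt (M * Re (gip \<mu> f f)) * F.nrm g)\<^sup>2"
      using M G.form_nonneg[OF f] by (simp add: power_mult_distrib)
    finally show "(cmod (gip \<mu> g f))\<^sup>2 \<le> (sqrt (M * Re (gip \<mu> f f)) * F.nrm g)\<^sup>2" .
  qed (use c G.form_nonneg[OF f] in \<open>simp add: carleson_def\<close>)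
  then have "\<exists>h\<in>fock \<alpha> w. \<forall>g\<in>fock \<alpha> w. gip \<mu> g f = fock_ip \<alpha> w g h"
    by (intro F.Riesz_representation[where \<phi> = "\<lambda>g. gip \<mu> g f"]) (auto simp: G.form_add G.form_scl f)
  then obtain h where h: "h \<in> fock \<alpha> w" "\<forall>g\<in>fock \<alpha> w. gip \<mu> g f = fock_ip \<alpha> w g h" by (elim bexE)
  have h': "fock_ip \<alpha> w h g = gip \<mu> f g" if "g \<in> fock \<alpha> w" for g
    using h(2)[rule_format, OF that] F.form_commute[OF that h(1)] G.form_commute[OF that f] by simp
  have "toeplitz \<alpha> w \<mu> f = h"
  proof
    fix z
    show "toeplitz \<alpha> w \<mu> f z = h z"
      using h'[OF ker_mem[of z]] reproducing[OF h(1), of z] by (simp add: toeplitz_eq_gip)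
  qed
  then show ?thesis using h(1) h' by simp
qed

lemma toeplitz_converges_if_carleson: "carleson \<mu> M \<Longrightarrow> toeplitz_converges \<alpha> w \<mu>"
  unfolding toeplitz_converges_def toeplitz_integrand_def
proof (intro ballI allI)
  fix f z assume c: "carleson \<mu> M" and f: "f \<in> fock \<alpha> w"
  show "integrable \<mu> (\<lambda>\<xi>. f \<xi> * cnj (ker z \<xi>) * of_real (exp (- \<alpha> * (cmod \<xi>)\<^sup>2)))"
    using c by (intro gip_integrable fockD(1) N_finite_if_carleson[OF c] ker_mem f) (simp add: carleson_def)
qed

lemma toeplitz_linear:
  assumes c: "carleson \<mu> M"
  shows "linear_operator (fock \<alpha> w) (toeplitz \<alpha> w \<mu>)"
proof -
  interpret G: semi_inner_form "fock \<alpha> w" "gip \<mu>" by (rule semi_inner_form_gip[OF c])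
  have "toeplitz \<alpha> w \<mu> (\<lambda>x. f x + g x) = (\<lambda>x. toeplitz \<alpha> w \<mu> f x + toeplitz \<alpha> w \<mu> g x)"
    if "f \<in> fock \<alpha> w" "g \<in> fock \<alpha> w" for f g
    using G.form_add[OF that ker_mem] by (simp add: toeplitz_eq_gip fun_eq_iff plus_fun_def)
  moreover have "toeplitz \<alpha> w \<mu> (\<lambda>x. a * f x) = (\<lambda>x. a * toeplitz \<alpha> w \<mu> f x)" if "f \<in> fock \<alpha> w" for a f
    using G.form_scl[OF that ker_mem, of a] by (simp add: toeplitz_eq_gip fun_eq_iff scl_def)
  ultimately show ?thesis
    using toeplitz_form[OF c] unfolding linear_operator_def by (simp add: image_subset_iff)
qed

text \<open>Cauchy-Schwarz for \<open>gip \<mu>\<close> at \<open>f\<close> and its image, after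
  which one squared norm of the image cancels. It reduces norm convergence of images to convergence
  of the quadratic form.\<close>

lemma nrm_toeplitz_sq_le:
  assumes c: "carleson \<mu> M" and f: "f \<in> fock \<alpha> w"
  shows "(F.nrm (toeplitz \<alpha> w \<mu> f))\<^sup>2 \<le> M * Re (gip \<mu> f f)"
proof -
  interpret G: semi_inner_form "fock \<alpha> w" "gip \<mu>" by (rule semi_inner_form_gip[OF c])
  let ?T = "toeplitz \<alpha> w \<mu> f" let ?n = "(F.nrm ?T)\<^sup>2"
  have T: "?T \<in> fock \<alpha> w" "\<And>g. g \<in> fock \<alpha> w \<Longrightarrow> fock_ip \<alpha> w ?T g = gip \<mu> f g"
    using toeplitz_form[OF c f] by auto
  have "gip \<mu> f ?T = of_real ?n" using T(2)[OF T(1)] F.ip_self[OF T(1)] by simp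
  then have "cmod (gip \<mu> f ?T) = ?n" by (simp only: norm_of_real abs_of_nonneg zero_le_power2)
  then have "?n * ?n \<le> Re (gip \<mu> f f) * Re (gip \<mu> ?T ?T)"
    using G.Cauchy_Schwarz[OF f T(1)] by (simp add: power2_eq_square)
  also have "\<dots> \<le> Re (gip \<mu> f f) * (M * ?n)"
    by (intro mult_left_mono Re_gip_le[OF c T(1)] G.form_nonneg[OF f])
  finally have le: "?n * ?n \<le> (M * Re (gip \<mu> f f)) * ?n" by (simp add: mult_ac)
  show ?thesis
  proof (cases "?n = 0")
    case True
    then show ?thesis using c G.form_nonneg[OF f] by (simp add: carleson_def)
  next
    case False
    then have "0 < ?n" by (simp add: zero_less_power2)
    with le show ?thesis by (rule mult_right_le_imp_le)
  qed
qed

lemma positive_compact_toeplitz: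
  assumes c: "carleson \<mu> M" and T: "compact_operator (fock \<alpha> w) (fock_ip \<alpha> w) (toeplitz \<alpha> w \<mu>)"
  shows "positive_compact_operator (fock \<alpha> w) (fock_ip \<alpha> w) (toeplitz \<alpha> w \<mu>)"
proof -
  interpret G: semi_inner_form "fock \<alpha> w" "gip \<mu>" by (rule semi_inner_form_gip[OF c])
  show ?thesis
  proof (intro positive_compact_operator.intro F.function_inner_space_axioms positive_compact_operator_axioms.intro T)
    fix f assume f: "f \<in> fock \<alpha> w"
    show "0 \<le> Re (fock_ip \<alpha> w (toeplitz \<alpha> w \<mu> f) f)"
      using toeplitz_form[OF c f] G.form_nonneg[OF f] f by simp
    fix g assume g: "g \<in> fock \<alpha> w"
    have "fock_ip \<alpha> w f (toeplitz \<alpha> w \<mu> g) = cnj (fock_ip \<alpha> w (toeplitz \<alpha> w \<mu> g) f)"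
      using toeplitz_form[OF c g] f by (intro F.form_commute) auto
    also have "\<dots> = gip \<mu> f g" using toeplitz_form[OF c g] f G.form_commute[OF g f] by simp
    finally show "fock_ip \<alpha> w (toeplitz \<alpha> w \<mu> f) g = fock_ip \<alpha> w f (toeplitz \<alpha> w \<mu> g)"
      using toeplitz_form[OF c f] g by simp
  qed
qed

section \<open>Compactness of Toeplitz operators\<close>

lemma sq_Jensen:
  assumes f: "f holomorphic_on UNIV" and h: "h \<in> borel_measurable borel" and Y: "0 < Y" "N W f \<le> ennreal Y" and p: "1 \<le> p"
  shows "epowr (\<integral>\<^sup>+\<xi>. ennreal (sq f \<xi>) * h \<xi> \<partial>W) p \<le>
    ennreal (Y powr (p - 1)) * (\<integral>\<^sup>+\<xi>. ennreal (sq f \<xi>) * epowr (h \<xi>) p \<partial>W)"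
proof -
  define m where "m = density W (\<lambda>\<xi>. ennreal (sq f \<xi>))"
  note [measurable] = sq_measurable[OF f] h
  have im: "(\<integral>\<^sup>+\<xi>. g \<xi> \<partial>m) = (\<integral>\<^sup>+\<xi>. ennreal (sq f \<xi>) * g \<xi> \<partial>W)" if "g \<in> borel_measurable borel" for g
    unfolding m_def using that by (intro nn_integral_density) (auto cong: measurable_cong_sets)
  have "emeasure m (space m) = N W f" using im[of "\<lambda>_. 1"] by (simp add: N_def)
  then have "emeasure m (space m) \<le> ennreal Y" using Y by simp
  moreover have "h \<in> borel_measurable m" using h by (simp add: m_def)
  ultimately have "epowr (\<integral>\<^sup>+\<xi>. h \<xi> \<partial>m) p \<le> ennreal (Y powr (p - 1)) * (\<integral>\<^sup>+\<xi>. epowr (h \<xi>) p \<partial>m)"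
    using Y p by (intro nn_integral_epowr_ge)
  then show ?thesis by (simp add: im)
qed

text \<open>The p-th power of the density at a point is at most a multiple of the integral of the
  averages over a disk of fixed area, so integrability already implies a uniform bound.\<close>

lemma ball_density_finite:
  assumes \<mu>: "sets \<mu> = sets borel" and r: "0 < r" "r \<le> R" and p: "1 \<le> p"
    and fin: "(\<integral>\<^sup>+z. epowr (average_function w r \<mu> z) p \<partial>lborel) < top"
  shows "\<exists>M\<ge>0. \<forall>\<xi>. ball_density \<mu> (r / 2) \<xi> \<le> ennreal M"
proof -
  let ?I = "\<integral>\<^sup>+z. epowr (average_function w r \<mu> z) p \<partial>lborel" let ?a = "pi * (r / 2)\<^sup>2"
  obtain I where I: "?I = ennreal I" "0 \<le> I" using fin by (cases ?I) auto
  define b where "b = (D * Cu) powr p * I / ?a"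
  have a: "0 < ?a" using r by simp
  have b: "0 \<le> b" using a I by (simp add: b_def)
  have "ball_density \<mu> (r / 2) \<xi> \<le> ennreal (b powr (1 / p))" for \<xi>
  proof -
    have "epowr (ball_density \<mu> (r / 2) \<xi>) p * ennreal ?a \<le>
        ennreal ((D * Cu) powr p) * (\<integral>\<^sup>+\<eta>\<in>ball \<xi> (r / 2). epowr (average_function w r \<mu> \<eta>) p \<partial>lborel)"
      by (rule epowr_ball_density_le[OF \<mu> r p])
    also have "\<dots> \<le> ennreal ((D * Cu) powr p) * ?I"
      by (intro mult_left_mono nn_integral_mono) (auto simp: indicator_def)
    also have "\<dots> = ennreal b * ennreal ?a"
      using a I r by (simp add: b_def ennreal_mult[symmetric])
    finally have "ennreal ?a * epowr (ball_density \<mu> (r / 2) \<xi>) p \<le> ennreal ?a * ennreal b" by (simp only: mult.commute)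
    then have "epowr (ball_density \<mu> (r / 2) \<xi>) p \<le> ennreal b"
      using a by (subst (asm) ennreal_mult_le_mult_iff) auto
    then have "epowr (epowr (ball_density \<mu> (r / 2) \<xi>) p) (1 / p) \<le> epowr (ennreal b) (1 / p)"
      using p by (intro epowr_mono) auto
    then show ?thesis using p b by (simp add: epowr_epowr epowr_ennreal)
  qed
  then show ?thesis by (intro exI[of _ "b powr (1 / p)"]) simp
qed

text \<open>Raising to the power \<open>p\<close> by Jensen's inequality turns \<open>\<mu>(D)\<^sup>p / w(D)\<^sup>p dw\<close> into an integrable
  majorant, so that pointwise convergence suffices for the compactness of \<open>T\<^sub>\<mu>\<close>.\<close>

lemma N_tendsto_0:
  assumes \<mu>: "sets \<mu> = sets borel" and r: "0 < r" "r \<le> R" and p: "1 \<le> p"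
    and fin: "(\<integral>\<^sup>+z. epowr (average_function w r \<mu> z) p \<partial>lborel) < top"
    and f: "\<And>n. f n \<in> fock \<alpha> w" "\<And>n. N W (f n) \<le> ennreal 4" "\<And>z. (\<lambda>n. f n z) \<longlonglongrightarrow> 0" and \<epsilon>: "0 < \<epsilon>"
  shows "\<forall>\<^sub>F n in sequentially. N \<mu> (f n) \<le> ennreal \<epsilon>"
proof -
  let ?h = "ball_density \<mu> (r / 2)"
  obtain L where L: "L > 0" "\<And>\<mu> f. sets \<mu> = sets borel \<Longrightarrow> sigma_finite_measure \<mu> \<Longrightarrow> f holomorphic_on UNIV \<Longrightarrow>
    N \<mu> f \<le> ennreal L * (\<integral>\<^sup>+\<xi>. ennreal (sq f \<xi>) * ball_density \<mu> (r / 2) \<xi> \<partial>W)"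
    using Carleson_estimate[of "r / 2"] r by auto
  obtain P where P: "P > 0" "\<And>f z. f holomorphic_on UNIV \<Longrightarrow> ennreal (sq f z * v z) \<le> ennreal P * N W f"
    using pointwise_bound by blast
  obtain A where A: "A > 0" "\<And>\<mu>. sets \<mu> = sets borel \<Longrightarrow>
    (\<integral>\<^sup>+\<xi>. epowr (ball_density \<mu> (r / 2) \<xi>) p * ennreal (1 / u \<xi>) \<partial>W) \<le>
    ennreal A * (\<integral>\<^sup>+\<eta>. epowr (average_function w r \<mu> \<eta>) p \<partial>lborel)"
    using ball_density_smoothing[OF r p] by blast
  obtain M where M: "M \<ge> 0" "\<And>\<xi>. ?h \<xi> \<le> ennreal M" using ball_density_finite[OF \<mu> r p fin] by blast
  have hfin: "?h \<xi> < top" for \<xi> using le_less_trans[OF M(2)] by simp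
  have sf: "sigma_finite_measure \<mu>"
    by (rule sigma_finite_if_ball_density_finite[OF \<mu>, of "r / 2"]) (use r hfin in auto)
  have fh: "f n holomorphic_on UNIV" for n by (rule fockD(1)[OF f(1)])
  note [measurable] = ball_density_measurable[OF \<mu>] sq_measurable[OF fh]
  have lim: "(\<lambda>n. \<integral>\<^sup>+\<xi>. ennreal (sq (f n) \<xi>) * epowr (?h \<xi>) p \<partial>W) \<longlonglongrightarrow> (\<integral>\<^sup>+\<xi>. 0 \<partial>W)"
  \<comment> \<open>The majorant comes from \<open>pointwise_bound\<close> with the norm bound 4; it
    is integrable by \<open>ball_density_smoothing\<close>.\<close>
  proof (rule nn_integral_dominated_convergence[where w = "\<lambda>\<xi>. ennreal (4 * P) * (epowr (?h \<xi>) p * ennreal (1 / u \<xi>))"])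
    show "AE \<xi> in W. ennreal (sq (f n) \<xi>) * epowr (?h \<xi>) p \<le> ennreal (4 * P) * (epowr (?h \<xi>) p * ennreal (1 / u \<xi>))" for n
    proof (rule AE_I2)
      fix \<xi>
      have "ennreal (sq (f n) \<xi> * v \<xi>) \<le> ennreal P * ennreal 4"
        using P(2)[OF fh] f(2) by (meson mult_left_mono order_trans zero_le)
      then have "sq (f n) \<xi> * v \<xi> \<le> P * 4"
        using P(1) by (subst (asm) ennreal_mult[symmetric]) (auto simp del: ennreal_numeral)
      moreover have "sq (f n) \<xi> * u \<xi> \<le> sq (f n) \<xi> * v \<xi>" by (intro mult_left_mono u_le_v) simp
      ultimately have "sq (f n) \<xi> \<le> 4 * P * (1 / u \<xi>)" using u_pos[of \<xi>] by (simp add: field_simps)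
      then have "ennreal (sq (f n) \<xi>) \<le> ennreal (4 * P) * ennreal (1 / u \<xi>)"
        using P(1) u_pos[of \<xi>] by (subst ennreal_mult[symmetric]) (auto intro: ennreal_leI)
      then have "ennreal (sq (f n) \<xi>) * epowr (?h \<xi>) p \<le> ennreal (4 * P) * ennreal (1 / u \<xi>) * epowr (?h \<xi>) p"
        by (rule mult_right_mono) simp
      then show "ennreal (sq (f n) \<xi>) * epowr (?h \<xi>) p \<le> ennreal (4 * P) * (epowr (?h \<xi>) p * ennreal (1 / u \<xi>))"
        by (simp only: mult_ac)
    qed
    have "(\<integral>\<^sup>+\<xi>. ennreal (4 * P) * (epowr (?h \<xi>) p * ennreal (1 / u \<xi>)) \<partial>W) =
        ennreal (4 * P) * (\<integral>\<^sup>+\<xi>. epowr (?h \<xi>) p * ennreal (1 / u \<xi>) \<partial>W)"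
      by (intro nn_integral_cmult) measurable
    also have "\<dots> \<le> ennreal (4 * P) * (ennreal A * (\<integral>\<^sup>+z. epowr (average_function w r \<mu> z) p \<partial>lborel))"
      by (intro mult_left_mono A \<mu>) simp
    also have "\<dots> < top" using fin by (simp add: ennreal_mult_less_top)
    finally show "(\<integral>\<^sup>+\<xi>. ennreal (4 * P) * (epowr (?h \<xi>) p * ennreal (1 / u \<xi>)) \<partial>W) < \<infinity>" by simp
    show "AE \<xi> in W. (\<lambda>n. ennreal (sq (f n) \<xi>) * epowr (?h \<xi>) p) \<longlonglongrightarrow> 0"
    proof (rule AE_I2)
      fix \<xi>
      have "(\<lambda>n. sq (f n) \<xi>) \<longlonglongrightarrow> (cmod 0)\<^sup>2 * exp (- \<alpha> * (cmod \<xi>)\<^sup>2)"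
        unfolding sq_def by (intro tendsto_intros f(3))
      then have "(\<lambda>n. ennreal (sq (f n) \<xi>)) \<longlonglongrightarrow> ennreal 0" by (intro tendsto_ennrealI) simp
      from ennreal_tendsto_cmult[OF _ this, of "epowr (?h \<xi>) p"] hfin[of \<xi>]
      show "(\<lambda>n. ennreal (sq (f n) \<xi>) * epowr (?h \<xi>) p) \<longlonglongrightarrow> 0" by (simp add: mult.commute)
    qed
  qed measurable
  \<comment> \<open>Chosen so that its p-th root times \<open>L\<close> is
    \<open>\<epsilon>\<close>.\<close>
  define e where "e = (\<epsilon> / L) powr p"
  have e: "e > 0" using \<epsilon> L by (simp add: e_def)
  have "(\<lambda>n. ennreal (4 powr (p - 1)) * (\<integral>\<^sup>+\<xi>. ennreal (sq (f n) \<xi>) * epowr (?h \<xi>) p \<partial>W)) \<longlonglongrightarrow> ennreal (4 powr (p - 1)) * 0"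
    using lim by (intro ennreal_tendsto_cmult) auto
  then have "\<forall>\<^sub>F n in sequentially. ennreal (4 powr (p - 1)) * (\<integral>\<^sup>+\<xi>. ennreal (sq (f n) \<xi>) * epowr (?h \<xi>) p \<partial>W) < ennreal e"
    using e by (intro order_tendstoD) auto
  then show ?thesis
  proof eventually_elim
    case (elim n)
    let ?X = "\<integral>\<^sup>+\<xi>. ennreal (sq (f n) \<xi>) * ?h \<xi> \<partial>W"
    have "epowr ?X p \<le> ennreal (4 powr (p - 1)) * (\<integral>\<^sup>+\<xi>. ennreal (sq (f n) \<xi>) * epowr (?h \<xi>) p \<partial>W)"
      by (intro sq_Jensen fh ball_density_measurable \<mu> f(2) p) simp
    also note elim
    finally have "epowr ?X p \<le> ennreal e" by simp
    then have "epowr (epowr ?X p) (1 / p) \<le> epowr (ennreal e) (1 / p)" using p by (intro epowr_mono) auto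
    then have X: "?X \<le> ennreal (\<epsilon> / L)"
      using p e \<epsilon> L by (simp add: epowr_epowr epowr_ennreal) (simp add: e_def powr_powr)
    have "N \<mu> (f n) \<le> ennreal L * ?X" by (rule L(2)[OF \<mu> sf fh])
    also have "\<dots> \<le> ennreal L * ennreal (\<epsilon> / L)" using X by (intro mult_left_mono) auto
    also have "\<dots> = ennreal \<epsilon>" using L \<epsilon> by (simp add: ennreal_mult[symmetric])
    finally show "N \<mu> (f n) \<le> ennreal \<epsilon>" .
  qed
qed

text \<open>The image of the closed unit ball is compact itself and hence equals its closure: a
  subsequence in the ball converges pointwise to a member \<open>g\<close> of the ball, and the
  images of the differences tend to 0.\<close>

lemma toeplitz_compact:
  assumes \<mu>: "sets \<mu> = sets borel" and r: "0 < r" "r \<le> R" and p: "1 \<le> p"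
    and fin: "(\<integral>\<^sup>+z. epowr (average_function w r \<mu> z) p \<partial>lborel) < top" and c: "carleson \<mu> M"
  shows "compact_operator (fock \<alpha> w) (fock_ip \<alpha> w) (toeplitz \<alpha> w \<mu>)"
proof -
  let ?T = "toeplitz \<alpha> w \<mu>"
  let ?S = "?T ` {f \<in> fock \<alpha> w. F.nrm f \<le> 1}"
  interpret G: semi_inner_form "fock \<alpha> w" "gip \<mu>" by (rule semi_inner_form_gip[OF c])
  note lin = toeplitz_linear[OF c]
  note Tm = linear_operatorD[OF lin]
  have Td: "?T (f - g) = ?T f - ?T g" if "f \<in> fock \<alpha> w" "g \<in> fock \<alpha> w" for f g
    using Tm(2)[OF that(1) F.scl_mem[OF that(2)], of "- 1"] Tm(3)[OF that(2), of "- 1"]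
    unfolding F.diff_eq_scl by simp
  interpret M: Metric_space "fock \<alpha> w" "\<lambda>f g. F.nrm (\<lambda>x. f x - g x)" by (rule F.Metric_space_ndist)
  have "\<exists>l s. l \<in> ?S \<and> strict_mono s \<and> limitin M.mtopology (\<sigma> \<circ> s) l sequentially"
    if \<sigma>: "range \<sigma> \<subseteq> ?S" for \<sigma> :: "nat \<Rightarrow> complex \<Rightarrow> complex"
  proof -
    have "\<forall>n. \<exists>f. f \<in> fock \<alpha> w \<and> F.nrm f \<le> 1 \<and> \<sigma> n = ?T f" using \<sigma> by (auto simp: image_subset_iff)
    then obtain f where f: "\<And>n. f n \<in> fock \<alpha> w" "\<And>n. F.nrm (f n) \<le> 1" "\<And>n. \<sigma> n = ?T (f n)" by metis
    have Nf: "N W (f n) \<le> ennreal 1" for n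
      unfolding N_eq_nrm[OF f(1)] using f(2)[of n] by (intro ennreal_leI) (simp add: power_le_one)
    obtain g s where g: "strict_mono (s :: nat \<Rightarrow> nat)" "g \<in> fock \<alpha> w" "N W g \<le> ennreal 1"
        "\<And>z. (\<lambda>n. f (s n) z) \<longlonglongrightarrow> g z" "\<And>A. compact A \<Longrightarrow> uniform_limit A (\<lambda>n. f (s n)) g sequentially"
      by (rule fock_subsequence[where F = f, OF f(1) Nf zero_le_one]) (rule that)
    have "(F.nrm g)\<^sup>2 \<le> 1" using g(3) unfolding N_eq_nrm[OF g(2)] by (simp del: ennreal_1 add: ennreal_1[symmetric])
    then have g1: "F.nrm g \<le> 1" using power2_le_imp_le[of "F.nrm g" 1] by simp
    define d where "d n = f (s n) - g" for n
    have d: "d n \<in> fock \<alpha> w" for n using f(1) g(2) by (simp add: d_def)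
    \<comment> \<open>Differences of two members of the unit ball have norm at most 2, which is the
      origin of the 4 in \<open>N_tendsto_0\<close>.\<close>
    have Nd: "N W (d n) \<le> ennreal 4" for n
    proof -
      have "F.nrm (d n) \<le> F.nrm (f (s n)) + F.nrm (0 - g)"
        using F.nrm_diff_triangle[OF f(1) F.zero_mem g(2), of "s n"] by (simp add: d_def)
      also have "\<dots> \<le> 1 + 1" using f(2)[of "s n"] g1 F.nrm_diff_commute[of 0 g] by (intro add_mono) auto
      finally have "(F.nrm (d n))\<^sup>2 \<le> 2\<^sup>2" by (intro power_mono) auto
      then show ?thesis unfolding N_eq_nrm[OF d] by (intro ennreal_leI) simp
    qed
    have dlim: "(\<lambda>n. d n z) \<longlonglongrightarrow> 0" for z
      using tendsto_diff[OF g(4)[of z] tendsto_const, of "g z"] by (simp add: d_def)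
    have "(\<lambda>n. F.nrm (?T (d n))) \<longlonglongrightarrow> 0"
    proof (rule LIMSEQ_I)
      fix \<epsilon> :: real assume \<epsilon>: "0 < \<epsilon>"
      have M0: "0 \<le> M" using c by (simp add: carleson_def)
      \<comment> \<open>Dividing by \<open>M + 1\<close> instead of \<open>M\<close> covers the case
        \<open>M = 0\<close>.\<close>
      define \<eta> where "\<eta> = (\<epsilon> / 2)\<^sup>2 / (M + 1)"
      have \<eta>: "0 < \<eta>" using \<epsilon> M0 by (simp add: \<eta>_def)
      obtain n0 where n0: "\<And>n. n \<ge> n0 \<Longrightarrow> N \<mu> (d n) \<le> ennreal \<eta>"
        using N_tendsto_0[OF \<mu> r p fin d Nd dlim \<eta>] unfolding eventually_sequentially by blast
      have "F.nrm (?T (d n)) < \<epsilon>" if n: "n \<ge> n0" for n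
      proof -
        have "Re (gip \<mu> (d n) (d n)) \<le> \<eta>"
          using n0[OF n] \<eta> unfolding N_eq_gip[OF \<mu> fockD(1)[OF d] N_finite_if_carleson[OF c d]] by simp
        then have "M * Re (gip \<mu> (d n) (d n)) \<le> (M + 1) * \<eta>"
          using M0 G.form_nonneg[OF d[of n]] by (intro mult_mono) auto
        then have "(F.nrm (?T (d n)))\<^sup>2 \<le> (\<epsilon> / 2)\<^sup>2"
          using nrm_toeplitz_sq_le[OF c d[of n]] M0 by (simp add: \<eta>_def)
        then have "F.nrm (?T (d n)) \<le> \<epsilon> / 2" by (rule power2_le_imp_le) (use \<epsilon> in simp)
        then show ?thesis using \<epsilon> by simp
      qed
      then show "\<exists>no. \<forall>n\<ge>no. norm (F.nrm (?T (d n)) - 0) < \<epsilon>" by auto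
    qed
    then have lim: "(\<lambda>n. F.nrm (?T (f (s n)) - ?T g)) \<longlonglongrightarrow> 0"
      by (simp only: d_def Td f(1) g(2))
    have "limitin M.mtopology (\<sigma> \<circ> s) (?T g) sequentially"
      unfolding M.limitin_metric_dist_null
    proof (intro conjI)
      show "?T g \<in> fock \<alpha> w" by (rule Tm(1)[OF g(2)])
      show "\<forall>\<^sub>F x in sequentially. (\<sigma> \<circ> s) x \<in> fock \<alpha> w" using f Tm(1) by simp
      show "(\<lambda>n. F.nrm (\<lambda>x. (\<sigma> \<circ> s) n x - ?T g x)) \<longlonglongrightarrow> 0"
        using lim by (simp only: fun_diff_def o_def f(3))
    qed
    moreover have "?T g \<in> ?S" using g(2) g1 by blast
    ultimately show ?thesis using g(1) by blast
  qed
  then have comp: "compactin M.mtopology ?S"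
    unfolding M.compactin_sequentially using Tm(1) by blast
  then have "closedin M.mtopology ?S"
    by (rule compactin_imp_closedin[OF M.Hausdorff_space_mtopology])
  then have "M.mtopology closure_of ?S = ?S" by (simp add: closure_of_eq)
  then show ?thesis using lin comp by (simp add: compact_operator_def ip_topology_def)
qed

end

section \<open>Schatten norms\<close>

lemma uniformly_comparableI:
  assumes "0 < a" "0 < b" "\<And>i. i \<in> M \<Longrightarrow> Y i \<le> ennreal a * X i" "\<And>i. i \<in> M \<Longrightarrow> X i \<le> ennreal b * Y i"
  shows "uniformly_comparable M X Y"
proof -
  have "ennreal (1 / a) * Y i \<le> X i" if "i \<in> M" for i
  proof -
    have "ennreal (1 / a) * Y i \<le> ennreal (1 / a) * (ennreal a * X i)"
      by (intro mult_left_mono assms that) simp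
    also have "\<dots> = ennreal 1 * X i"
      using assms(1) by (simp add: mult.assoc[symmetric] ennreal_mult[symmetric] del: ennreal_1)
    finally show ?thesis by simp
  qed
  then show ?thesis using assms unfolding uniformly_comparable_def
    by (intro exI[of _ "1 / a"] conjI exI[of _ b]) auto
qed

lemma Lp_norm_less_top_iff: "0 < p \<Longrightarrow> Lp_norm p g < top \<longleftrightarrow> (\<integral>\<^sup>+z. epowr (g z) p \<partial>lborel) < top"
  by (simp add: Lp_norm_def nn_integral_lebesgue)

context restricted_weight
begin

lemma schatten_upper:
  assumes r: "0 < r" "r \<le> R" and p: "1 \<le> p"
  shows "\<exists>A>0. \<forall>\<mu>. sets \<mu> = sets borel \<longrightarrow> Lp_norm p (average_function w r \<mu>) < top \<longrightarrow>
    toeplitz_in_schatten p \<alpha> w \<mu> \<and>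
    toeplitz_schatten_norm p \<alpha> w \<mu> \<le> ennreal A * Lp_norm p (average_function w r \<mu>)"
proof -
  obtain L where L: "L > 0" "\<And>\<mu> f. sets \<mu> = sets borel \<Longrightarrow> sigma_finite_measure \<mu> \<Longrightarrow> f holomorphic_on UNIV \<Longrightarrow>
    N \<mu> f \<le> ennreal L * (\<integral>\<^sup>+\<xi>. ennreal (sq f \<xi>) * ball_density \<mu> (r / 2) \<xi> \<partial>W)"
    using Carleson_estimate[of "r / 2"] r by auto
  obtain A where A: "A > 0" "\<And>\<mu>. sets \<mu> = sets borel \<Longrightarrow>
    (\<integral>\<^sup>+\<xi>. epowr (ball_density \<mu> (r / 2) \<xi>) p * ennreal (1 / u \<xi>) \<partial>W) \<le>
    ennreal A * (\<integral>\<^sup>+\<eta>. epowr (average_function w r \<mu> \<eta>) p \<partial>lborel)"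
    using ball_density_smoothing[OF r p] by blast
  obtain P where P: "P > 0" "\<And>z. K z * exp (- \<alpha> * (cmod z)\<^sup>2) * v z \<le> P"
    using kernel_bounds by blast
  define c where "c = L powr p * P * A"
  have c: "c > 0" using L A P by (simp add: c_def)
  have "toeplitz_in_schatten p \<alpha> w \<mu> \<and>
      toeplitz_schatten_norm p \<alpha> w \<mu> \<le> ennreal (c powr (1 / p)) * Lp_norm p (average_function w r \<mu>)"
    if \<mu>: "sets \<mu> = sets borel" and Lp: "Lp_norm p (average_function w r \<mu>) < top" for \<mu>
  proof -
    let ?h = "ball_density \<mu> (r / 2)"
    let ?I = "\<integral>\<^sup>+z. epowr (average_function w r \<mu> z) p \<partial>lborel"
    have fin: "?I < top" using Lp p by (simp add: Lp_norm_less_top_iff)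
    then obtain I where I: "?I = ennreal I" "0 \<le> I" by (cases ?I) auto
    obtain M0 where M0: "M0 \<ge> 0" "\<And>\<xi>. ?h \<xi> \<le> ennreal M0" using ball_density_finite[OF \<mu> r p fin] by blast
    have sf: "sigma_finite_measure \<mu>"
      by (rule sigma_finite_if_ball_density_finite[OF \<mu> _ le_less_trans[OF M0(2) ennreal_less_top]]) (use r in simp)
    \<comment> \<open>\<open>M\<close> depends on \<open>\<mu>\<close> and only makes the operator
      well defined and its form finite; the final constant \<open>c\<close> does not contain
      it.\<close>
    obtain M where M: "carleson \<mu> M" using carleson_if_ball_density_bounded[OF \<mu> r M0] by blast
    have comp: "compact_operator (fock \<alpha> w) (fock_ip \<alpha> w) (toeplitz \<alpha> w \<mu>)"
      by (rule toeplitz_compact[OF \<mu> r p fin M])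
    interpret T: positive_compact_operator "fock \<alpha> w" "fock_ip \<alpha> w" "toeplitz \<alpha> w \<mu>"
      by (rule positive_compact_toeplitz[OF M comp])
    have em: "T.eigvec n \<in> fock \<alpha> w" for n by (rule T.eigvec_mem)
    have eh: "T.eigvec n holomorphic_on UNIV" for n by (rule fockD(1)[OF em])
    note [measurable] = ball_density_measurable[OF \<mu>] sq_measurable[OF eh]
    have val: "ennreal (T.eigval n) = N \<mu> (T.eigvec n)" for n
    proof -
      have "Re (gip \<mu> (T.eigvec n) (T.eigvec n)) = Re (fock_ip \<alpha> w (toeplitz \<alpha> w \<mu> (T.eigvec n)) (T.eigvec n))"
        using toeplitz_form[OF M em] em by simp
      also have "\<dots> = T.eigval n * (F.nrm (T.eigvec n))\<^sup>2"
        unfolding T.T_eigvec F.form_scl[OF em em] by (simp add: F.ip_self[OF em])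
      also have "\<dots> = T.eigval n"
        using T.nrm_eigvec[of n] T.eigval_nonneg[of n] by (cases "T.eigval n = 0") (auto simp: less_le)
      finally show ?thesis
        by (simp add: N_eq_gip[OF \<mu> eh N_finite_if_carleson[OF M em]])
    qed
    have pt: "ennreal (T.eigval n powr p) \<le> ennreal (L powr p) * (\<integral>\<^sup>+\<xi>. ennreal (sq (T.eigvec n) \<xi>) * epowr (?h \<xi>) p \<partial>W)" for n
    proof -
      \<comment> \<open>The norm is 1 or, for a padding vector, 0; Jensen's inequality needs only
        the upper bound.\<close>
      have N1: "N W (T.eigvec n) \<le> ennreal 1"
        unfolding N_eq_nrm[OF em] using T.nrm_eigvec[of n] by (intro ennreal_leI) auto
      have "ennreal (T.eigval n powr p) = epowr (N \<mu> (T.eigvec n)) p"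
        using T.eigval_nonneg[of n] by (simp add: val[symmetric] epowr_ennreal)
      also have "\<dots> \<le> epowr (ennreal L * (\<integral>\<^sup>+\<xi>. ennreal (sq (T.eigvec n) \<xi>) * ?h \<xi> \<partial>W)) p"
        using p by (intro epowr_mono L(2)[OF \<mu> sf eh]) simp
      also have "\<dots> = ennreal (L powr p) * epowr (\<integral>\<^sup>+\<xi>. ennreal (sq (T.eigvec n) \<xi>) * ?h \<xi> \<partial>W) p"
        using p L(1) by (simp add: epowr_mult epowr_ennreal)
      also have "\<dots> \<le> ennreal (L powr p) * (ennreal (1 powr (p - 1)) * (\<integral>\<^sup>+\<xi>. ennreal (sq (T.eigvec n) \<xi>) * epowr (?h \<xi>) p \<partial>W))"
        by (intro mult_left_mono sq_Jensen eh ball_density_measurable \<mu> N1 p) auto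
      finally show ?thesis by simp
    qed
    \<comment> \<open>The values of the eigenvectors at \<open>\<xi>\<close> are, up to conjugation,
      the coefficients of \<open>ker \<xi>\<close>, so this is Bessel's inequality for the
      kernel.\<close>
    have bessel: "(\<Sum>n<m. sq (T.eigvec n) \<xi>) \<le> P / u \<xi>" for m \<xi>
    proof -
      let ?e = "exp (- \<alpha> * (cmod \<xi>)\<^sup>2)"
      have e: "cmod (T.eigvec n \<xi>) = cmod (fock_ip \<alpha> w (ker \<xi>) (T.eigvec n))" for n
        using reproducing[OF em[of n], of \<xi>] F.form_commute[OF em[of n] ker_mem[of \<xi>]] by simp
      have "(\<Sum>n<m. sq (T.eigvec n) \<xi>) = (\<Sum>n<m. (cmod (fock_ip \<alpha> w (ker \<xi>) (T.eigvec n)))\<^sup>2) * ?e"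
        unfolding sq_def e by (rule sum_distrib_right[symmetric])
      also have "\<dots> \<le> K \<xi> * ?e"
        unfolding K_def by (intro mult_right_mono T.Bessel ker_mem) simp
      also have "\<dots> \<le> P / u \<xi>"
      proof -
        have "K \<xi> * ?e * u \<xi> \<le> K \<xi> * ?e * v \<xi>" using u_le_v[of \<xi>] K_pos[of \<xi>] by (intro mult_left_mono) auto
        then show ?thesis using P(2)[of \<xi>] u_pos[of \<xi>] by (simp add: field_simps)
      qed
      finally show ?thesis .
    qed
    have partial: "(\<Sum>n<m. T.eigval n powr p) \<le> c * I" for m
    proof -
      have "ennreal (\<Sum>n<m. T.eigval n powr p) = (\<Sum>n<m. ennreal (T.eigval n powr p))"
        by (rule sum_ennreal[symmetric]) simp
      also have "\<dots> \<le> (\<Sum>n<m. ennreal (L powr p) * (\<integral>\<^sup>+\<xi>. ennreal (sq (T.eigvec n) \<xi>) * epowr (?h \<xi>) p \<partial>W))"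
        by (intro sum_mono pt)
      also have "\<dots> = ennreal (L powr p) * (\<Sum>n<m. \<integral>\<^sup>+\<xi>. ennreal (sq (T.eigvec n) \<xi>) * epowr (?h \<xi>) p \<partial>W)"
        by (rule sum_distrib_left[symmetric])
      also have "(\<Sum>n<m. \<integral>\<^sup>+\<xi>. ennreal (sq (T.eigvec n) \<xi>) * epowr (?h \<xi>) p \<partial>W) =
          (\<integral>\<^sup>+\<xi>. (\<Sum>n<m. ennreal (sq (T.eigvec n) \<xi>) * epowr (?h \<xi>) p) \<partial>W)"
        by (rule nn_integral_sum[symmetric]) measurable
      also have "\<dots> \<le> (\<integral>\<^sup>+\<xi>. ennreal P * (epowr (?h \<xi>) p * ennreal (1 / u \<xi>)) \<partial>W)"
      proof (rule nn_integral_mono)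
        fix \<xi>
        have "(\<Sum>n<m. ennreal (sq (T.eigvec n) \<xi>) * epowr (?h \<xi>) p) = (\<Sum>n<m. ennreal (sq (T.eigvec n) \<xi>)) * epowr (?h \<xi>) p"
          by (rule sum_distrib_right[symmetric])
        also have "(\<Sum>n<m. ennreal (sq (T.eigvec n) \<xi>)) = ennreal (\<Sum>n<m. sq (T.eigvec n) \<xi>)"
          by (rule sum_ennreal) simp
        also have "\<dots> * epowr (?h \<xi>) p \<le> ennreal (P / u \<xi>) * epowr (?h \<xi>) p"
          by (intro mult_right_mono ennreal_leI bessel) simp
        also have "ennreal (P / u \<xi>) = ennreal P * ennreal (1 / u \<xi>)"
          using P(1) u_pos[of \<xi>] by (simp add: ennreal_mult[symmetric])
        finally show "(\<Sum>n<m. ennreal (sq (T.eigvec n) \<xi>) * epowr (?h \<xi>) p) \<le> ennreal P * (epowr (?h \<xi>) p * ennreal (1 / u \<xi>))"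
          by (simp only: mult_ac)
      qed
      also have "\<dots> = ennreal P * (\<integral>\<^sup>+\<xi>. epowr (?h \<xi>) p * ennreal (1 / u \<xi>) \<partial>W)"
        by (intro nn_integral_cmult) measurable
      also have "\<dots> \<le> ennreal P * (ennreal A * ennreal I)"
        unfolding I(1)[symmetric] by (intro mult_left_mono A \<mu>) simp
      also have "ennreal (L powr p) * (ennreal P * (ennreal A * ennreal I)) = ennreal (c * I)"
        using P A I by (simp add: c_def ennreal_mult mult.assoc)
      finally have "ennreal (\<Sum>n<m. T.eigval n powr p) \<le> ennreal (c * I)" by (simp add: mult_left_mono)
      then show ?thesis using c I by simp
    qed
    have sum: "summable (\<lambda>n. T.eigval n powr p)" by (rule summableI_nonneg_bounded[OF _ partial]) simp
    have le: "(\<Sum>n. T.eigval n powr p) \<le> c * I" by (rule suminf_le_const[OF sum partial])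
    have mem: "toeplitz \<alpha> w \<mu> \<in> schatten_class p (fock \<alpha> w) (fock_ip \<alpha> w)"
      using comp sum by (simp add: schatten_class_def T.singular_values_eq)
    have conv: "toeplitz_converges \<alpha> w \<mu>" by (rule toeplitz_converges_if_carleson[OF M])
    have "toeplitz_schatten_norm p \<alpha> w \<mu> = ennreal ((\<Sum>n. T.eigval n powr p) powr (1 / p))"
      using mem conv by (simp add: toeplitz_schatten_norm_def schatten_norm_def T.singular_values_eq)
    also have "\<dots> \<le> ennreal ((c * I) powr (1 / p))"
      using le p by (intro ennreal_leI powr_mono2) (auto intro: suminf_nonneg[OF sum])
    also have "\<dots> = ennreal (c powr (1 / p)) * Lp_norm p (average_function w r \<mu>)"
      using c I by (simp add: Lp_norm_def nn_integral_lebesgue epowr_ennreal powr_mult ennreal_mult)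
    finally show ?thesis using mem conv by (simp add: toeplitz_in_schatten_def)
  qed
  moreover have "0 < c powr (1 / p)" using c by simp
  ultimately show ?thesis by blast
qed

text \<open>The value of \<open>T\<^sub>\<mu> B\<^sub>z\<close> at \<open>z\<close> is a multiple of the Berezin transform, so that boundedness of
  \<open>T\<^sub>\<mu>\<close> bounds the averages of \<open>\<mu>\<close>.\<close>

lemma carleson_if_toeplitz_compact:
  assumes \<delta>: "0 < \<delta>" "0 < c" "\<And>z \<xi>. dist z \<xi> < \<delta> \<Longrightarrow> c * K z \<le> sq (ker z) \<xi> * v z"
    and \<mu>: "sets \<mu> = sets borel" and conv: "toeplitz_converges \<alpha> w \<mu>"
    and comp: "compact_operator (fock \<alpha> w) (fock_ip \<alpha> w) (toeplitz \<alpha> w \<mu>)"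
  shows "\<exists>M. carleson \<mu> M"
proof -
  obtain M where M: "0 \<le> M" "\<And>f. f \<in> fock \<alpha> w \<Longrightarrow> F.nrm (toeplitz \<alpha> w \<mu> f) \<le> M * F.nrm f"
    using F.compact_operator_bounded[OF comp] by blast
  have Tm: "toeplitz \<alpha> w \<mu> f \<in> fock \<alpha> w" if "f \<in> fock \<alpha> w" for f
    using comp that linear_operatorD(1) unfolding compact_operator_def by blast
  have ber: "berezin \<alpha> w \<mu> z \<le> ennreal M" for z
  proof -
    have fock_integrand: "toeplitz_integrand \<alpha> w (ker z) z \<xi> = of_real (sq (ker z) \<xi>)" for \<xi>
      unfolding toeplitz_integrand_def sq_def complex_norm_square[symmetric] by simp
    \<comment> \<open>The assumed convergence of the Toeplitz integrals is what excludes the default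
      value 0 of a divergent Bochner integral here.\<close>
    have "integrable \<mu> (\<lambda>\<xi>. complex_of_real (sq (ker z) \<xi>))"
      using conv ker_mem[of z] unfolding toeplitz_converges_def fock_integrand[symmetric] by (simp add: eta_contract_eq)
    then have int: "integrable \<mu> (sq (ker z))" by (simp add: complex_of_real_integrable_eq)
    have "toeplitz \<alpha> w \<mu> (ker z) z = of_real (LINT \<xi>|\<mu>. sq (ker z) \<xi>)"
      by (simp add: toeplitz_def fock_integrand)
    moreover have "toeplitz \<alpha> w \<mu> (ker z) z = fock_ip \<alpha> w (toeplitz \<alpha> w \<mu> (ker z)) (ker z)"
      by (rule reproducing[OF Tm[OF ker_mem], symmetric])
    moreover have "cmod (fock_ip \<alpha> w (toeplitz \<alpha> w \<mu> (ker z)) (ker z)) \<le> M * K z"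
    proof -
      have "cmod (fock_ip \<alpha> w (toeplitz \<alpha> w \<mu> (ker z)) (ker z)) \<le> F.nrm (toeplitz \<alpha> w \<mu> (ker z)) * F.nrm (ker z)"
        by (rule F.cmod_ip_le[OF Tm[OF ker_mem] ker_mem])
      also have "\<dots> \<le> M * F.nrm (ker z) * F.nrm (ker z)" by (intro mult_right_mono M ker_mem) simp
      finally show ?thesis by (simp add: K_def power2_eq_square mult.assoc)
    qed
    ultimately have "\<bar>LINT \<xi>|\<mu>. sq (ker z) \<xi>\<bar> \<le> M * K z" by (metis norm_of_real)
    then have "N \<mu> (ker z) \<le> ennreal (M * K z)"
      unfolding N_def by (subst nn_integral_eq_integral[OF int]) (auto intro: ennreal_leI)
    then have "berezin \<alpha> w \<mu> z \<le> ennreal (M * K z) * ennreal (1 / K z)"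
      unfolding berezin_eq[OF \<mu>] by (rule mult_right_mono) simp
    also have "\<dots> = ennreal M" using K_pos[of z] M(1) by (simp add: ennreal_mult[symmetric])
    finally show ?thesis .
  qed
  define r where "r = min \<delta> R"
  have r: "0 < r" "r \<le> \<delta>" "r \<le> R" using \<delta> R by (auto simp: r_def)
  obtain A where A: "A > 0" "\<And>\<mu> z. sets \<mu> = sets borel \<Longrightarrow> average_function w r \<mu> z \<le> ennreal A * berezin \<alpha> w \<mu> z"
    using average_le_berezin[OF \<delta>(2,3) r] by blast
  have "ball_density \<mu> (r / 2) \<xi> \<le> ennreal (D * Cu * (A * M))" for \<xi>
  proof -
    have "ball_density \<mu> (r / 2) \<xi> \<le> ennreal (D * Cu) * average_function w r \<mu> \<xi>"
      using r by (intro ball_density_le_average_function \<mu>) auto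
    also have "\<dots> \<le> ennreal (D * Cu) * (ennreal A * ennreal M)"
      by (intro mult_left_mono order_trans[OF A(2)[OF \<mu>]] ber) auto
    also have "\<dots> = ennreal (D * Cu * (A * M))" using A M D Cu by (simp add: ennreal_mult)
    finally show ?thesis .
  qed
  then show ?thesis
    using A M D Cu by (intro carleson_if_ball_density_bounded[OF \<mu> r(1,3), of "D * Cu * (A * M)"]) auto
qed

lemma schatten_lower:
  assumes p: "1 \<le> p"
  shows "\<exists>A>0. \<forall>\<mu>. sets \<mu> = sets borel \<longrightarrow> Lp_norm p (berezin \<alpha> w \<mu>) \<le> ennreal A * toeplitz_schatten_norm p \<alpha> w \<mu>"
proof -
  obtain \<delta> c where \<delta>: "0 < \<delta>" "0 < c" "\<And>z \<xi>. dist z \<xi> < \<delta> \<Longrightarrow> c * K z \<le> sq (ker z) \<xi> * v z"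
    using near_diagonal by blast
  obtain G where G: "G > 0" "\<And>z. 1 \<le> G * (K z * exp (- \<alpha> * (cmod z)\<^sup>2) * v z)" using kernel_bounds by blast
  obtain B where B: "B > 0" "\<And>f. f holomorphic_on UNIV \<Longrightarrow> (\<integral>\<^sup>+z. ennreal (sq f z * v z) \<partial>lborel) \<le> ennreal B * N W f"
    using v_weighted_estimate by blast
  define a where "a = G * Cu * B"
  have a: "a > 0" using G B Cu by (simp add: a_def)
  have "Lp_norm p (berezin \<alpha> w \<mu>) \<le> ennreal (a powr (1 / p)) * toeplitz_schatten_norm p \<alpha> w \<mu>"
    if \<mu>: "sets \<mu> = sets borel" for \<mu>
  proof (cases "toeplitz_in_schatten p \<alpha> w \<mu>")
    case False
    then have "toeplitz_schatten_norm p \<alpha> w \<mu> = top"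
      by (auto simp: toeplitz_schatten_norm_def schatten_norm_def toeplitz_in_schatten_def)
    then show ?thesis using a by (simp add: ennreal_mult_top)
  next
    case True
    then have conv: "toeplitz_converges \<alpha> w \<mu>"
      and mem: "toeplitz \<alpha> w \<mu> \<in> schatten_class p (fock \<alpha> w) (fock_ip \<alpha> w)"
      by (simp_all add: toeplitz_in_schatten_def)
    then have comp: "compact_operator (fock \<alpha> w) (fock_ip \<alpha> w) (toeplitz \<alpha> w \<mu>)"
      by (simp add: schatten_class_def)
    \<comment> \<open>Again \<open>M\<close> is only qualitative: it gives access to the spectral
      theorem and does not enter \<open>a\<close>.\<close>
    obtain M where M: "carleson \<mu> M" using carleson_if_toeplitz_compact[OF \<delta> \<mu> conv comp] by blast
    interpret T: positive_compact_operator "fock \<alpha> w" "fock_ip \<alpha> w" "toeplitz \<alpha> w \<mu>"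
      by (rule positive_compact_toeplitz[OF M comp])
    have em: "T.eigvec n \<in> fock \<alpha> w" for n by (rule T.eigvec_mem)
    have eh: "T.eigvec n holomorphic_on UNIV" for n by (rule fockD(1)[OF em])
    have sum: "summable (\<lambda>n. T.eigval n powr p)"
      using mem by (simp add: schatten_class_def T.singular_values_eq)
    let ?S = "\<Sum>n. T.eigval n powr p"
    let ?b = "\<lambda>z n. (cmod (T.eigvec n z))\<^sup>2 / K z"
    have coeff: "(cmod (fock_ip \<alpha> w (ker z) (T.eigvec n)))\<^sup>2 = (cmod (T.eigvec n z))\<^sup>2" for n z
      using reproducing[OF em[of n], of z] F.form_commute[OF em[of n] ker_mem[of z]] by simp
    have pt: "epowr (berezin \<alpha> w \<mu> z) p \<le> (\<Sum>n. ennreal (?b z n) * ennreal (T.eigval n powr p))" for z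
    proof -
      \<comment> \<open>The normalised squared coefficients as a measure on the natural numbers. By
        Bessel its mass is at most one, so Jensen's inequality for integrals applies to the
        series.\<close>
      define m where "m = density (count_space UNIV) (\<lambda>n. ennreal (?b z n))"
      have im: "(\<integral>\<^sup>+n. g n \<partial>m) = (\<Sum>n. ennreal (?b z n) * g n)" for g :: "nat \<Rightarrow> ennreal"
        unfolding m_def by (subst nn_integral_density) (auto simp: nn_integral_count_space_nat)
      have gm: "g \<in> borel_measurable m" for g :: "nat \<Rightarrow> ennreal" by (simp add: m_def)
      have "emeasure m (space m) = (\<Sum>n. ennreal (?b z n))" using im[of "\<lambda>_. 1"] by simp
      also have "\<dots> \<le> ennreal 1"
        unfolding suminf_eq_SUP
      proof (rule SUP_least)
        fix n
        have "(\<Sum>i<n. (cmod (T.eigvec i z))\<^sup>2) \<le> K z"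
          using T.Bessel[OF ker_mem, of z n] by (simp add: coeff K_def)
        then have "(\<Sum>i<n. ?b z i) \<le> 1" using K_pos[of z] by (simp add: sum_divide_distrib[symmetric])
        then show "(\<Sum>i<n. ennreal (?b z i)) \<le> ennreal 1"
          using K_pos[of z] by (subst sum_ennreal) (auto intro: ennreal_leI less_imp_le)
      qed
      finally have mass: "emeasure m (space m) \<le> ennreal 1" .
      have "(\<lambda>k. T.eigval k * (cmod (T.eigvec k z))\<^sup>2) sums Re (fock_ip \<alpha> w (toeplitz \<alpha> w \<mu> (ker z)) (ker z))"
        using T.quad_sums[OF ker_mem, of z] by (simp add: coeff)
      also have "Re (fock_ip \<alpha> w (toeplitz \<alpha> w \<mu> (ker z)) (ker z)) = Re (gip \<mu> (ker z) (ker z))"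
        using toeplitz_form[OF M ker_mem] by simp
      finally have "(\<Sum>k. ennreal (T.eigval k * (cmod (T.eigvec k z))\<^sup>2)) = N \<mu> (ker z)"
        unfolding N_eq_gip[OF \<mu> fockD(1)[OF ker_mem] N_finite_if_carleson[OF M ker_mem]]
        by (intro suminf_ennreal_eq) auto
      then have "berezin \<alpha> w \<mu> z = (\<Sum>k. ennreal (T.eigval k * (cmod (T.eigvec k z))\<^sup>2)) * ennreal (1 / K z)"
        by (simp add: berezin_eq[OF \<mu>])
      also have "\<dots> = (\<Sum>k. ennreal (T.eigval k * (cmod (T.eigvec k z))\<^sup>2) * ennreal (1 / K z))"
        by (rule ennreal_suminf_multc[symmetric])
      also have "\<dots> = (\<Sum>k. ennreal (?b z k) * ennreal (T.eigval k))"
        using K_pos[of z] by (intro suminf_cong) (simp add: ennreal_mult[symmetric] mult_ac)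
      also have "\<dots> = (\<integral>\<^sup>+k. ennreal (T.eigval k) \<partial>m)" by (rule im[symmetric])
      finally have "epowr (berezin \<alpha> w \<mu> z) p = epowr (\<integral>\<^sup>+k. ennreal (T.eigval k) \<partial>m) p" by simp
      also have "\<dots> \<le> ennreal (1 powr (p - 1)) * (\<integral>\<^sup>+k. epowr (ennreal (T.eigval k)) p \<partial>m)"
        by (rule nn_integral_epowr_ge[OF gm _ mass p]) simp
      also have "\<dots> = (\<Sum>n. ennreal (?b z n) * ennreal (T.eigval n powr p))"
        by (simp add: im epowr_ennreal)
      finally show ?thesis .
    qed
    have bm [measurable]: "(\<lambda>z. ?b z n) \<in> borel_measurable borel" for n
    proof -
      have [measurable]: "T.eigvec n \<in> borel_measurable borel"
        by (intro borel_measurable_continuous_onI holomorphic_on_imp_continuous_on eh)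
      show ?thesis by measurable
    qed
    \<comment> \<open>The lower bound for \<open>K z\<close> turns \<open>1 / K z\<close> into the
      Gaussian times \<open>v z\<close>, and each eigenvector has Fock norm at most one. So every
      eigenvalue is charged the same amount \<open>a\<close>.\<close>
    have bint: "(\<integral>\<^sup>+z. ennreal (?b z n) \<partial>lborel) \<le> ennreal a" for n
    proof -
      note [measurable] = sq_measurable[OF eh]
      have "(\<integral>\<^sup>+z. ennreal (?b z n) \<partial>lborel) \<le> (\<integral>\<^sup>+z. ennreal (G * Cu) * ennreal (sq (T.eigvec n) z * u z) \<partial>lborel)"
      proof (rule nn_integral_mono)
        fix z
        let ?x = "(cmod (T.eigvec n z))\<^sup>2"
        have "?x * 1 \<le> ?x * (G * (K z * exp (- \<alpha> * (cmod z)\<^sup>2) * v z))" by (intro mult_left_mono G) simp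
        also have "\<dots> = K z * (G * v z * sq (T.eigvec n) z)" by (simp add: sq_def mult_ac)
        finally have "?b z n \<le> G * v z * sq (T.eigvec n) z" using K_pos[of z] by (simp add: field_simps)
        also have "\<dots> \<le> G * (Cu * u z) * sq (T.eigvec n) z"
          using G v_le_u[of z] by (intro mult_right_mono mult_left_mono) auto
        finally have "?b z n \<le> G * Cu * (sq (T.eigvec n) z * u z)" by (simp only: mult_ac)
        then show "ennreal (?b z n) \<le> ennreal (G * Cu) * ennreal (sq (T.eigvec n) z * u z)"
          using G Cu u_pos[of z] by (subst ennreal_mult[symmetric]) (auto intro: ennreal_leI)
      qed
      also have "\<dots> = ennreal (G * Cu) * (\<integral>\<^sup>+z. ennreal (sq (T.eigvec n) z * u z) \<partial>lborel)"
        by (intro nn_integral_cmult) measurable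
      also have "\<dots> \<le> ennreal (G * Cu) * (\<integral>\<^sup>+z. ennreal (sq (T.eigvec n) z * v z) \<partial>lborel)"
        by (intro mult_left_mono nn_integral_mono ennreal_leI u_le_v) auto
      also have "\<dots> \<le> ennreal (G * Cu) * (ennreal B * N W (T.eigvec n))"
        by (intro mult_left_mono B eh) auto
      also have "\<dots> \<le> ennreal (G * Cu) * (ennreal B * ennreal 1)"
        unfolding N_eq_nrm[OF em] using T.nrm_eigvec[of n] by (intro mult_left_mono ennreal_leI) auto
      also have "\<dots> = ennreal a" using G B Cu by (simp add: a_def ennreal_mult)
      finally show ?thesis .
    qed
    have "(\<integral>\<^sup>+z. epowr (berezin \<alpha> w \<mu> z) p \<partial>lborel) \<le>
        (\<integral>\<^sup>+z. (\<Sum>n. ennreal (?b z n) * ennreal (T.eigval n powr p)) \<partial>lborel)"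
      by (intro nn_integral_mono pt)
    also have "\<dots> = (\<Sum>n. \<integral>\<^sup>+z. ennreal (?b z n) * ennreal (T.eigval n powr p) \<partial>lborel)"
      by (intro nn_integral_suminf) measurable
    also have "\<dots> = (\<Sum>n. (\<integral>\<^sup>+z. ennreal (?b z n) \<partial>lborel) * ennreal (T.eigval n powr p))"
      by (intro suminf_cong nn_integral_multc) measurable
    also have "\<dots> \<le> (\<Sum>n. ennreal a * ennreal (T.eigval n powr p))"
      by (intro suminf_le mult_right_mono bint) auto
    also have "\<dots> = ennreal a * (\<Sum>n. ennreal (T.eigval n powr p))" by (rule ennreal_suminf_cmult)
    also have "(\<Sum>n. ennreal (T.eigval n powr p)) = ennreal ?S" by (rule suminf_ennreal2[OF _ sum]) simp
    finally have le: "(\<integral>\<^sup>+z. epowr (berezin \<alpha> w \<mu> z) p \<partial>lborel) \<le> ennreal a * ennreal ?S" .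
    have S0: "0 \<le> ?S" by (rule suminf_nonneg[OF sum]) simp
    have "Lp_norm p (berezin \<alpha> w \<mu>) \<le> epowr (ennreal a * ennreal ?S) (1 / p)"
      unfolding Lp_norm_def nn_integral_lebesgue using le p by (intro epowr_mono) auto
    also have "\<dots> = ennreal (a powr (1 / p)) * ennreal (?S powr (1 / p))"
      using a S0 p by (simp add: epowr_mult epowr_ennreal)
    also have "ennreal (?S powr (1 / p)) = toeplitz_schatten_norm p \<alpha> w \<mu>"
      using conv mem by (simp add: toeplitz_schatten_norm_def schatten_norm_def T.singular_values_eq)
    finally show ?thesis .
  qed
  moreover have "0 < a powr (1 / p)" using a by simp
  ultimately show ?thesis by blast
qed

lemma toeplitz_in_schatten_iff: "toeplitz_in_schatten p \<alpha> w \<mu> \<longleftrightarrow> toeplitz_schatten_norm p \<alpha> w \<mu> < top"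
  by (auto simp: toeplitz_schatten_norm_def schatten_norm_def toeplitz_in_schatten_def)

lemma schatten_characterization:
  "\<exists>\<delta>. 0 < \<delta> \<and> \<delta> < 1 \<and> (\<forall>p::real\<ge>1.
    (\<forall>\<mu>\<in>borel_measures.
       (toeplitz_in_schatten p \<alpha> w \<mu> \<longleftrightarrow> in_Lp p (berezin \<alpha> w \<mu>)) \<and>
       (in_Lp p (berezin \<alpha> w \<mu>) \<longleftrightarrow> (\<exists>r\<in>{0<..<\<delta>}. in_Lp p (average_function w r \<mu>))) \<and>
       (in_Lp p (berezin \<alpha> w \<mu>) \<longleftrightarrow> (\<forall>r\<in>{0<..<\<delta>}. in_Lp p (average_function w r \<mu>)))) \<and>
    (\<forall>r\<in>{0<..<\<delta>}.
       uniformly_comparable borel_measures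
         (toeplitz_schatten_norm p \<alpha> w) (\<lambda>\<mu>. Lp_norm p (berezin \<alpha> w \<mu>)) \<and>
       uniformly_comparable borel_measures
         (\<lambda>\<mu>. Lp_norm p (berezin \<alpha> w \<mu>)) (\<lambda>\<mu>. Lp_norm p (average_function w r \<mu>))))"
proof -
  obtain \<delta>0 c where \<delta>0: "0 < \<delta>0" "0 < c" "\<And>z \<xi>. dist z \<xi> < \<delta>0 \<Longrightarrow> c * K z \<le> sq (ker z) \<xi> * v z"
    using near_diagonal by blast
  \<comment> \<open>\<open>1 / 2\<close> ensures \<open>\<delta> < 1\<close>,
    \<open>\<delta>0\<close> the lower bound of the kernel, and \<open>R\<close> that disks lie in
    the squares of the weight condition.\<close>
  define \<delta> where "\<delta> = min (1 / 2) (min \<delta>0 R)"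
  have \<delta>: "0 < \<delta>" "\<delta> < 1" using \<delta>0 R by (auto simp: \<delta>_def)
  have main: "\<exists>x>0. \<exists>y>0. \<exists>s>0. \<exists>t>0. \<forall>\<mu>\<in>borel_measures.
      Lp_norm p (average_function w r \<mu>) \<le> ennreal x * Lp_norm p (berezin \<alpha> w \<mu>) \<and>
      Lp_norm p (berezin \<alpha> w \<mu>) \<le> ennreal y * Lp_norm p (average_function w r \<mu>) \<and>
      toeplitz_schatten_norm p \<alpha> w \<mu> \<le> ennreal s * Lp_norm p (average_function w r \<mu>) \<and>
      Lp_norm p (berezin \<alpha> w \<mu>) \<le> ennreal t * toeplitz_schatten_norm p \<alpha> w \<mu>"
    if p: "1 \<le> p" and rr: "r \<in> {0<..<\<delta>}" for p r
  proof -
    have r: "0 < r" "r \<le> \<delta>0" "r \<le> R" using rr by (auto simp: \<delta>_def)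
    obtain x where x: "x > 0" "\<And>\<mu> z. sets \<mu> = sets borel \<Longrightarrow> average_function w r \<mu> z \<le> ennreal x * berezin \<alpha> w \<mu> z"
      using average_le_berezin[OF \<delta>0(2,3) r] by blast
    obtain y where y: "y > 0" "\<And>\<mu>. sets \<mu> = sets borel \<Longrightarrow> sigma_finite_measure \<mu> \<Longrightarrow>
      (\<integral>\<^sup>+z. epowr (berezin \<alpha> w \<mu> z) p \<partial>lborel) \<le> ennreal y * (\<integral>\<^sup>+z. epowr (average_function w r \<mu> z) p \<partial>lborel)"
      using berezin_Lp[OF r(1,3) p] by blast
    obtain s where s: "s > 0" "\<And>\<mu>. sets \<mu> = sets borel \<Longrightarrow> Lp_norm p (average_function w r \<mu>) < top \<Longrightarrow>
      toeplitz_schatten_norm p \<alpha> w \<mu> \<le> ennreal s * Lp_norm p (average_function w r \<mu>)"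
      using schatten_upper[OF r(1,3) p] by blast
    obtain t where t: "t > 0" "\<And>\<mu>. sets \<mu> = sets borel \<Longrightarrow>
      Lp_norm p (berezin \<alpha> w \<mu>) \<le> ennreal t * toeplitz_schatten_norm p \<alpha> w \<mu>"
      using schatten_lower[OF p] by blast
    have 1: "Lp_norm p (average_function w r \<mu>) \<le> ennreal x * Lp_norm p (berezin \<alpha> w \<mu>)" if \<mu>: "sets \<mu> = sets borel" for \<mu>
    proof -
      note [measurable] = berezin_measurable[OF \<mu>]
      have "(\<integral>\<^sup>+z. epowr (average_function w r \<mu> z) p \<partial>lborel) \<le> (\<integral>\<^sup>+z. ennreal (x powr p) * epowr (berezin \<alpha> w \<mu> z) p \<partial>lborel)"
      proof (rule nn_integral_mono)
        fix z
        have "epowr (average_function w r \<mu> z) p \<le> epowr (ennreal x * berezin \<alpha> w \<mu> z) p"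
          using p by (intro epowr_mono x(2) \<mu>) simp
        then show "epowr (average_function w r \<mu> z) p \<le> ennreal (x powr p) * epowr (berezin \<alpha> w \<mu> z) p"
          using p x(1) by (simp add: epowr_mult epowr_ennreal)
      qed
      also have "\<dots> = ennreal (x powr p) * (\<integral>\<^sup>+z. epowr (berezin \<alpha> w \<mu> z) p \<partial>lborel)"
        by (intro nn_integral_cmult) measurable
      finally have "Lp_norm p (average_function w r \<mu>) \<le> ennreal ((x powr p) powr (1 / p)) * Lp_norm p (berezin \<alpha> w \<mu>)"
        using p by (intro Lp_norm_le_if_integral_le) auto
      then show ?thesis using p x(1) by (simp add: powr_powr)
    qed
    have 2: "Lp_norm p (berezin \<alpha> w \<mu>) \<le> ennreal (y powr (1 / p)) * Lp_norm p (average_function w r \<mu>)"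
      if \<mu>: "sets \<mu> = sets borel" for \<mu>
    \<comment> \<open>Sigma-finiteness of \<open>\<mu>\<close> is available only if the averages
      have finite norm; otherwise the right side is infinite because the constant is
      positive.\<close>
    proof (cases "Lp_norm p (average_function w r \<mu>) < top")
      case True
      then have fin: "(\<integral>\<^sup>+z. epowr (average_function w r \<mu> z) p \<partial>lborel) < top"
        using p by (simp add: Lp_norm_less_top_iff)
      obtain M0 where M0: "M0 \<ge> 0" "\<And>\<xi>. ball_density \<mu> (r / 2) \<xi> \<le> ennreal M0" using ball_density_finite[OF \<mu> r(1,3) p fin] by blast
      have "sigma_finite_measure \<mu>"
        by (rule sigma_finite_if_ball_density_finite[OF \<mu> _ le_less_trans[OF M0(2) ennreal_less_top]]) (use r in simp)
      then show ?thesis using p y(1) by (intro Lp_norm_le_if_integral_le y(2) \<mu>) auto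
    next
      case False
      then have "Lp_norm p (average_function w r \<mu>) = top" by (simp add: less_top[symmetric])
      then show ?thesis using y(1) by (simp add: ennreal_mult_top)
    qed
    have 3: "toeplitz_schatten_norm p \<alpha> w \<mu> \<le> ennreal s * Lp_norm p (average_function w r \<mu>)"
      if \<mu>: "sets \<mu> = sets borel" for \<mu>
    proof (cases "Lp_norm p (average_function w r \<mu>) < top")
      case False
      then have "Lp_norm p (average_function w r \<mu>) = top" by (simp add: less_top[symmetric])
      then show ?thesis using s(1) by (simp add: ennreal_mult_top)
    qed (rule s(2)[OF \<mu>])
    have y': "0 < y powr (1 / p)" using y(1) by simp
    show ?thesis
      by (rule exI[of _ x], rule conjI[OF x(1)], rule exI[of _ "y powr (1 / p)"], rule conjI[OF y'],
          rule exI[of _ s], rule conjI[OF s(1)], rule exI[of _ t], rule conjI[OF t(1)])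
        (auto simp: borel_measures_def intro: 1 2 3 t(2))
  qed
  have Lp_ber: "in_Lp p (berezin \<alpha> w \<mu>) \<longleftrightarrow> Lp_norm p (berezin \<alpha> w \<mu>) < top" if "\<mu> \<in> borel_measures" for \<mu> p
  proof -
    have "berezin \<alpha> w \<mu> \<in> borel_measurable lebesgue"
      by (intro measurable_completion) (use that berezin_measurable[of \<mu>] in \<open>simp add: borel_measures_def\<close>)
    then show ?thesis by (simp add: in_Lp_def)
  qed
  have Lp_av: "in_Lp p (average_function w r \<mu>) \<longleftrightarrow> Lp_norm p (average_function w r \<mu>) < top" if "\<mu> \<in> borel_measures" for \<mu> p r
  proof -
    have "average_function w r \<mu> \<in> borel_measurable lebesgue"
      by (intro measurable_completion) (use that average_function_measurable[of \<mu> r] in \<open>simp add: borel_measures_def\<close>)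
    then show ?thesis by (simp add: in_Lp_def)
  qed
  have fin_le: "X < top" if "X \<le> ennreal a * Y" "Y < top" for X Y :: ennreal and a
    using that by (meson ennreal_less_top ennreal_mult_less_top le_less_trans)
  have equiv: "(toeplitz_in_schatten p \<alpha> w \<mu> \<longleftrightarrow> in_Lp p (berezin \<alpha> w \<mu>)) \<and>
      (in_Lp p (berezin \<alpha> w \<mu>) \<longleftrightarrow> in_Lp p (average_function w r \<mu>))"
    if p: "1 \<le> p" and r: "r \<in> {0<..<\<delta>}" and \<mu>: "\<mu> \<in> borel_measures" for p r \<mu>
  proof -
    obtain x y s t where
      "Lp_norm p (average_function w r \<mu>) \<le> ennreal x * Lp_norm p (berezin \<alpha> w \<mu>)"
      "Lp_norm p (berezin \<alpha> w \<mu>) \<le> ennreal y * Lp_norm p (average_function w r \<mu>)"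
      "toeplitz_schatten_norm p \<alpha> w \<mu> \<le> ennreal s * Lp_norm p (average_function w r \<mu>)"
      "Lp_norm p (berezin \<alpha> w \<mu>) \<le> ennreal t * toeplitz_schatten_norm p \<alpha> w \<mu>"
      using main[OF p r] \<mu> by blast
    then show ?thesis
      unfolding Lp_ber[OF \<mu>] Lp_av[OF \<mu>] toeplitz_in_schatten_iff using fin_le by blast
  qed
  have comparable: "uniformly_comparable borel_measures
         (toeplitz_schatten_norm p \<alpha> w) (\<lambda>\<mu>. Lp_norm p (berezin \<alpha> w \<mu>)) \<and>
       uniformly_comparable borel_measures
         (\<lambda>\<mu>. Lp_norm p (berezin \<alpha> w \<mu>)) (\<lambda>\<mu>. Lp_norm p (average_function w r \<mu>))"
    if p: "1 \<le> p" and r: "r \<in> {0<..<\<delta>}" for p r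
  proof -
    obtain x y s t where c: "x > 0" "y > 0" "s > 0" "t > 0" and
      le: "\<And>\<mu>. \<mu> \<in> borel_measures \<Longrightarrow> Lp_norm p (average_function w r \<mu>) \<le> ennreal x * Lp_norm p (berezin \<alpha> w \<mu>)"
      "\<And>\<mu>. \<mu> \<in> borel_measures \<Longrightarrow> Lp_norm p (berezin \<alpha> w \<mu>) \<le> ennreal y * Lp_norm p (average_function w r \<mu>)"
      "\<And>\<mu>. \<mu> \<in> borel_measures \<Longrightarrow> toeplitz_schatten_norm p \<alpha> w \<mu> \<le> ennreal s * Lp_norm p (average_function w r \<mu>)"
      "\<And>\<mu>. \<mu> \<in> borel_measures \<Longrightarrow> Lp_norm p (berezin \<alpha> w \<mu>) \<le> ennreal t * toeplitz_schatten_norm p \<alpha> w \<mu>"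
      using main[OF p r] by blast
    have sx: "toeplitz_schatten_norm p \<alpha> w \<mu> \<le> ennreal (s * x) * Lp_norm p (berezin \<alpha> w \<mu>)" if \<mu>: "\<mu> \<in> borel_measures" for \<mu>
    proof -
      have "toeplitz_schatten_norm p \<alpha> w \<mu> \<le> ennreal s * (ennreal x * Lp_norm p (berezin \<alpha> w \<mu>))"
        by (rule order_trans[OF le(3)[OF \<mu>] mult_left_mono[OF le(1)[OF \<mu>]]]) simp
      then show ?thesis using c by (simp add: ennreal_mult mult.assoc)
    qed
    show ?thesis
      by (intro conjI uniformly_comparableI[OF c(4) mult_pos_pos[OF c(3,1)] le(4) sx]
          uniformly_comparableI[OF c(1,2) le(1,2)])
  qed
  \<comment> \<open>A sample radius: it shows that the range of radii is nonempty, which the first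
    equivalence and the passage between some and all radii need.\<close>
  have half: "\<delta> / 2 \<in> {0<..<\<delta>}" using \<delta> by simp
  show ?thesis
  proof (intro exI[of _ \<delta>] conjI allI impI ballI \<delta>)
    fix p :: real and \<mu> assume p: "1 \<le> p" and \<mu>: "\<mu> \<in> borel_measures"
    show "toeplitz_in_schatten p \<alpha> w \<mu> \<longleftrightarrow> in_Lp p (berezin \<alpha> w \<mu>)" using equiv[OF p half \<mu>] by simp
    show "in_Lp p (berezin \<alpha> w \<mu>) \<longleftrightarrow> (\<exists>r\<in>{0<..<\<delta>}. in_Lp p (average_function w r \<mu>))"
      using equiv[OF p _ \<mu>] half by metis
    show "in_Lp p (berezin \<alpha> w \<mu>) \<longleftrightarrow> (\<forall>r\<in>{0<..<\<delta>}. in_Lp p (average_function w r \<mu>))"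
      using equiv[OF p _ \<mu>] half by metis
  qed (use comparable in auto)
qed

end

section \<open>Restricted \<open>A\<^sub>q\<close> weights\<close>

lemma emeasure_lebesgue_square: "0 < r \<Longrightarrow> emeasure lebesgue (square a r) = ennreal (r\<^sup>2)"
proof -
  assume r: "0 < r"
  have "emeasure lborel (cbox a (a + Complex r r)) = ennreal (\<Prod>b\<in>Basis. (a + Complex r r - a) \<bullet> b)"
    using r by (intro emeasure_lborel_cbox) (auto simp: Basis_complex_def inner_complex_def)
  also have "(\<Prod>b\<in>Basis. (a + Complex r r - a) \<bullet> b) = r\<^sup>2"
    by (simp add: Basis_complex_def inner_complex_def power2_eq_square)
  finally show ?thesis unfolding square_def by simp
qed

lemma square_borel: "square a r \<in> sets borel"
  by (simp add: square_def)

lemma ball_subset_square: "ball z (r / 2) \<subseteq> square (z - Complex (r / 2) (r / 2)) r"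
proof
  fix x assume "x \<in> ball z (r / 2)"
  then have "cmod (z - x) < r / 2" by (simp add: dist_norm)
  then have "\<bar>Re (z - x)\<bar> < r / 2" "\<bar>Im (z - x)\<bar> < r / 2"
    using abs_Re_le_cmod[of "z - x"] abs_Im_le_cmod[of "z - x"] by linarith+
  then show "x \<in> square (z - Complex (r / 2) (r / 2)) r"
    unfolding square_def in_cbox_complex_iff abs_less_iff by (auto simp: field_simps)
qed

lemma set_nn_integral_neq_0:
  assumes "f \<in> borel_measurable M" "A \<in> sets M" "emeasure M A \<noteq> 0" "AE x in M. x \<in> A \<longrightarrow> f x \<noteq> 0"
  shows "(\<integral>\<^sup>+x\<in>A. f x \<partial>M) \<noteq> 0"
proof
  assume "(\<integral>\<^sup>+x\<in>A. f x \<partial>M) = 0"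
  then have "AE x in M. f x * indicator A x = 0"
    using assms by (subst (asm) nn_integral_0_iff_AE) auto
  with assms(4) have "AE x in M. x \<notin> A" by eventually_elim (auto simp: indicator_def)
  then have "A \<in> null_sets M" using AE_iff_null_sets[OF assms(2)] by simp
  then show False using assms(3) by (simp add: null_sets_def)
qed

lemma ennreal_divide_finite: "0 < b \<Longrightarrow> x / ennreal b < top \<Longrightarrow> x < top"
  by (cases x) (simp_all add: ennreal_top_divide)

text \<open>Hoelder's inequality is taken as Jensen's with exponent \<open>q\<close> for the measure
  with density \<open>w powr (- s)\<close> on the square, applied to \<open>\<phi>\<close>, which is
  \<open>h powr (1 / q)\<close> times \<open>w powr s\<close>. Its integral is that of
  \<open>h powr (1 / q)\<close>, the integral of its q-th power is that of \<open>h * w\<close>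
  since \<open>s * q - s = 1\<close>, and the mass raised to \<open>q - 1\<close> is the dual factor
  of the weight condition.\<close>

lemma restricted_weight_if_A_restricted:
  assumes \<alpha>: "0 < \<alpha>" and q: "1 < q" and w: "w \<in> A_restricted q"
  shows "\<exists>C R Q. restricted_weight \<alpha> w q C R Q"
proof -
  define q' where "q' = q / (q - 1)"
  define s where "s = q' / q"
  have s: "s = 1 / (q - 1)" using q by (simp add: s_def q'_def)
  have qq: "q / q' = q - 1" using q by (simp add: q'_def)
  obtain r where wt: "weight w" and r: "0 < r"
    and fin: "\<And>a. average (square a r) (\<lambda>z. ennreal (w z)) < \<infinity>"
      "\<And>a. average (square a r) (\<lambda>z. inverse (ennreal (w z powr s))) < \<infinity>"
    and sup: "(SUP a. average (square a r) (\<lambda>z. ennreal (w z)) *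
        epowr (average (square a r) (\<lambda>z. inverse (ennreal (w z powr s)))) (q - 1)) < \<infinity>"
    using w unfolding A_restricted_def Let_def q'_def[symmetric] s_def[symmetric] qq by auto
  define S where "S = (SUP a. average (square a r) (\<lambda>z. ennreal (w z)) *
        epowr (average (square a r) (\<lambda>z. inverse (ennreal (w z powr s)))) (q - 1))"
  obtain S' where S': "S = ennreal S'" "0 \<le> S'" using sup unfolding S_def[symmetric] by (cases S) auto
  \<comment> \<open>Passing from averages to integrals costs one area \<open>r^2\<close> for the
    weight and the power \<open>q - 1\<close> of it for the dual factor; adding 1 makes the constant
    visibly positive.\<close>
  define C where "C = S' * (r\<^sup>2) powr q + 1"
  define Q where "Q z = square (z - Complex (r / 2) (r / 2)) r" for z
  have Qb: "Q z \<in> sets borel" for z by (simp add: Q_def square_borel)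
  have Ql [measurable]: "Q z \<in> sets lebesgue" for z using Qb[of z] by (simp add: sets_completionI_sets)
  have area: "emeasure lebesgue (Q z) = ennreal (r\<^sup>2)" for z
    unfolding Q_def by (rule emeasure_lebesgue_square[OF r])
  note wm [measurable] = weight_measurable[OF wt]
  have w0: "0 \<le> w x" for x using wt by (simp add: weight_def)
  have Wq: "emeasure (borel_weight_measure w) (Q z) = (\<integral>\<^sup>+x\<in>Q z. ennreal (w x) \<partial>lebesgue)" for z
    by (rule emeasure_borel_weight_measure[OF wt Qb])
  define Y where "Y z = (\<integral>\<^sup>+x\<in>Q z. inverse (ennreal (w x powr s)) \<partial>lebesgue)" for z
  have Yfin: "Y z < top" for z
    using fin(2)[of "z - Complex (r / 2) (r / 2)"] r
    unfolding average_def Q_def[symmetric] area Y_def[symmetric] infinity_ennreal_def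
    by - (rule ennreal_divide_finite[of "r\<^sup>2"], auto)
  have Wfin: "emeasure (borel_weight_measure w) (Q z) < top" for z
    using fin(1)[of "z - Complex (r / 2) (r / 2)"] r
    unfolding average_def Q_def[symmetric] area Wq infinity_ennreal_def
    by - (rule ennreal_divide_finite[of "r\<^sup>2"], auto)
  \<comment> \<open>The inverse of 0 is \<open>\<infinity>\<close> in \<open>ennreal\<close>, so a
    finite dual average forces \<open>w\<close> to be positive almost everywhere on the
    square.\<close>
  have wpos: "AE x in lebesgue. x \<in> Q z \<longrightarrow> 0 < w x" for z
  proof -
    have "AE x in lebesgue. inverse (ennreal (w x powr s)) * indicator (Q z) x \<noteq> \<infinity>"
      using Yfin[of z] by (intro nn_integral_PInf_AE) (auto simp: Y_def)
    then show ?thesis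
      by eventually_elim (use w0 in \<open>auto simp: indicator_def less_le split: if_splits\<close>)
  qed
  have Wpos: "emeasure (borel_weight_measure w) (Q z) \<noteq> 0" for z
    unfolding Wq
  proof (rule set_nn_integral_neq_0)
    show "AE x in lebesgue. x \<in> Q z \<longrightarrow> ennreal (w x) \<noteq> 0" using wpos[of z] by eventually_elim auto
  qed (use area r in auto)
  have Ypos: "Y z \<noteq> 0" for z
    unfolding Y_def
  proof (rule set_nn_integral_neq_0)
    show "AE x in lebesgue. x \<in> Q z \<longrightarrow> inverse (ennreal (w x powr s)) \<noteq> 0" by simp
  qed (use area r in auto)
  have "restricted_weight \<alpha> w q C (r / 2) Q"
  proof
    show "0 < C" using S' by (simp add: C_def add_nonneg_pos)
    show "ball z (r / 2) \<subseteq> Q z" for z unfolding Q_def by (rule ball_subset_square)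
    show "0 < emeasure (borel_weight_measure w) (Q z)" for z using Wpos[of z] by (simp add: zero_less_iff_neq_zero)
  next
    fix z and h :: "complex \<Rightarrow> real" and t :: real
    assume h [measurable]: "h \<in> borel_measurable borel" and h0: "\<And>x. 0 \<le> h x" and t0: "0 \<le> t"
      and t: "ennreal t \<le> (\<integral>\<^sup>+x\<in>Q z. ennreal (h x powr (1 / q)) \<partial>lborel)"
    have hl [measurable]: "h \<in> borel_measurable lebesgue" by (rule measurable_completion) (use h in \<open>simp only: measurable_lborel2\<close>)
    define Y' where "Y' = enn2real (Y z)"
    have Y': "Y z = ennreal Y'" "0 < Y'"
      using Yfin[of z] Ypos[of z] by (auto simp: Y'_def enn2real_positive_iff zero_less_iff_neq_zero)
    define V where "V = enn2real (emeasure (borel_weight_measure w) (Q z))"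
    have V: "emeasure (borel_weight_measure w) (Q z) = ennreal V" "0 \<le> V"
      using Wfin[of z] by (auto simp: V_def)
    define m where "m = density lebesgue (\<lambda>x. inverse (ennreal (w x powr s)) * indicator (Q z) x)"
    define \<phi> where "\<phi> x = ennreal (h x powr (1 / q)) * ennreal (w x powr s)" for x
    have \<phi>m: "\<phi> \<in> borel_measurable lebesgue" unfolding \<phi>_def[abs_def] by measurable
    have im: "(\<integral>\<^sup>+x. g x \<partial>m) = (\<integral>\<^sup>+x. inverse (ennreal (w x powr s)) * indicator (Q z) x * g x \<partial>lebesgue)"
      if "g \<in> borel_measurable lebesgue" for g
      unfolding m_def using that by (intro nn_integral_density) auto
    have mass: "emeasure m (space m) \<le> ennreal Y'"
      using im[of "\<lambda>_. 1"] by (simp add: Y_def[symmetric] Y')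
    have I1: "(\<integral>\<^sup>+x. \<phi> x \<partial>m) = (\<integral>\<^sup>+x\<in>Q z. ennreal (h x powr (1 / q)) \<partial>lebesgue)"
      unfolding im[OF \<phi>m]
    proof (rule nn_integral_cong_AE)
      show "AE x in lebesgue. inverse (ennreal (w x powr s)) * indicator (Q z) x * \<phi> x =
          ennreal (h x powr (1 / q)) * indicator (Q z) x"
        using wpos[of z]
      proof eventually_elim
        case (elim x)
        have "inverse (ennreal (w x powr s)) * ennreal (w x powr s) = 1" if "0 < w x"
          using that by (simp add: inverse_ennreal ennreal_mult[symmetric])
        then have "inverse (ennreal (w x powr s)) * \<phi> x = ennreal (h x powr (1 / q))" if "x \<in> Q z"
          using elim that by (metis \<phi>_def mult.left_commute mult.right_neutral)
        then show ?case by (simp add: indicator_def)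
      qed
    qed
    have I2: "(\<integral>\<^sup>+x. epowr (\<phi> x) q \<partial>m) = (\<integral>\<^sup>+x\<in>Q z. ennreal (h x) \<partial>borel_weight_measure w)"
    proof -
      have "(\<integral>\<^sup>+x. epowr (\<phi> x) q \<partial>m) = (\<integral>\<^sup>+x. inverse (ennreal (w x powr s)) * indicator (Q z) x * epowr (\<phi> x) q \<partial>lebesgue)"
        by (rule im[OF measurable_epowr[OF \<phi>m]])
      also have "\<dots> = (\<integral>\<^sup>+x. ennreal (w x) * (ennreal (h x) * indicator (Q z) x) \<partial>lebesgue)"
      proof (rule nn_integral_cong_AE)
        show "AE x in lebesgue. inverse (ennreal (w x powr s)) * indicator (Q z) x * epowr (\<phi> x) q =
            ennreal (w x) * (ennreal (h x) * indicator (Q z) x)"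
          using wpos[of z]
        proof eventually_elim
          case (elim x)
          have "inverse (ennreal (w x powr s)) * epowr (\<phi> x) q = ennreal (w x) * ennreal (h x)" if "0 < w x"
          proof -
            have "epowr (\<phi> x) q = ennreal (h x) * ennreal (w x powr (s * q))"
              using q h0[of x] by (simp add: \<phi>_def epowr_mult epowr_ennreal powr_powr)
            moreover have "inverse (ennreal (w x powr s)) * ennreal (w x powr (s * q)) = ennreal (w x)"
            proof -
              have "s * q - s = s * (q - 1)" by (simp add: algebra_simps)
              also have "\<dots> = 1" using q by (simp add: s)
              finally have "s * q - s = 1" .
              then have "w x powr (s * q) / w x powr s = w x" using that by (simp add: powr_diff[symmetric])
              then show ?thesis using that by (simp add: inverse_ennreal ennreal_mult[symmetric] field_simps)
            qed
            ultimately show ?thesis by (metis mult.commute mult.left_commute)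
          qed
          then have "inverse (ennreal (w x powr s)) * epowr (\<phi> x) q = ennreal (w x) * ennreal (h x)" if "x \<in> Q z"
            using elim that by simp
          then show ?case by (simp add: indicator_def)
        qed
      qed
      also have "\<dots> = (\<integral>\<^sup>+x\<in>Q z. ennreal (h x) \<partial>borel_weight_measure w)"
        by (intro nn_integral_borel_weight_measure[OF wt, symmetric] borel_measurable_times_ennreal
            measurable_compose[OF h measurable_ennreal] borel_measurable_indicator Qb)
      finally show ?thesis .
    qed
    have "ennreal (t powr q) \<le> epowr (\<integral>\<^sup>+x. \<phi> x \<partial>m) q"
      using epowr_mono[OF _ t, of q] q t0 unfolding I1 nn_integral_lebesgue by (simp add: epowr_ennreal)
    also have "\<dots> \<le> ennreal (Y' powr (q - 1)) * (\<integral>\<^sup>+x. epowr (\<phi> x) q \<partial>m)"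
      using q \<phi>m by (intro nn_integral_epowr_ge[OF _ Y'(2) mass]) (auto simp: m_def)
    finally have "ennreal (t powr q) * ennreal V \<le>
        ennreal (Y' powr (q - 1)) * (\<integral>\<^sup>+x\<in>Q z. ennreal (h x) \<partial>borel_weight_measure w) * ennreal V"
      unfolding I2 by (rule mult_right_mono) simp
    also have "\<dots> = ennreal (V * Y' powr (q - 1)) * (\<integral>\<^sup>+x\<in>Q z. ennreal (h x) \<partial>borel_weight_measure w)"
      using V by (simp add: ennreal_mult mult_ac)
    also have "\<dots> \<le> ennreal C * (\<integral>\<^sup>+x\<in>Q z. ennreal (h x) \<partial>borel_weight_measure w)"
    proof (rule mult_right_mono[OF ennreal_leI])
      have "average (Q z) (\<lambda>z. ennreal (w z)) * epowr (average (Q z) (\<lambda>z. inverse (ennreal (w z powr s)))) (q - 1) \<le> S"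
        unfolding S_def Q_def by (rule SUP_upper2[of "z - Complex (r / 2) (r / 2)"]) auto
      also have "average (Q z) (\<lambda>z. ennreal (w z)) = ennreal (V / r\<^sup>2)"
        unfolding average_def area Wq[symmetric] V(1) using V r by (simp add: divide_ennreal)
      also have "average (Q z) (\<lambda>z. inverse (ennreal (w z powr s))) = ennreal (Y' / r\<^sup>2)"
        unfolding average_def area Y_def[symmetric] Y'(1) using Y' r by (simp add: divide_ennreal)
      finally have "ennreal (V / r\<^sup>2 * (Y' / r\<^sup>2) powr (q - 1)) \<le> ennreal S'"
        using V Y' r by (simp add: S' epowr_ennreal ennreal_mult[symmetric])
      then have "V / r\<^sup>2 * (Y' / r\<^sup>2) powr (q - 1) \<le> S'" using S' by simp
      moreover have "V / r\<^sup>2 * (Y' / r\<^sup>2) powr (q - 1) * (r\<^sup>2) powr q = V * Y' powr (q - 1)"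
        using r Y' by (simp add: powr_divide powr_diff)
      ultimately have "V * Y' powr (q - 1) \<le> S' * (r\<^sup>2) powr q" by (metis mult_right_mono powr_ge_zero)
      then show "V * Y' powr (q - 1) \<le> C" by (simp add: C_def)
    qed simp
    finally show "ennreal (t powr q) * emeasure (borel_weight_measure w) (Q z) \<le>
        ennreal C * (\<integral>\<^sup>+x\<in>Q z. ennreal (h x) \<partial>borel_weight_measure w)" unfolding V(1) .
  qed (use \<alpha> wt q r Qb Wfin in auto)
  then show ?thesis by blast
qed

text \<open>The essential supremum \<open>E z\<close> gives \<open>1 \<le> E z * w x\<close> almost
  everywhere on the square, so the integral of \<open>h\<close> is at most \<open>E z\<close> times
  that of \<open>h * w\<close>; multiplying by the mass of the square brings in the bounded
  product.\<close>

lemma restricted_weight_if_A1_restricted: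
  assumes \<alpha>: "0 < \<alpha>" and w: "w \<in> A1_restricted"
  shows "\<exists>C R Q. restricted_weight \<alpha> w 1 C R Q"
proof -
  let ?dual = "\<lambda>r a. esssup (restrict_space lebesgue (square a r)) (\<lambda>z. inverse (ennreal (w z)))"
  obtain r where wt: "weight w" and r: "0 < r"
    and fin: "\<And>a. average (square a r) (\<lambda>z. ennreal (w z)) < \<infinity>" "\<And>a. ?dual r a < \<infinity>"
    and sup: "(SUP a. average (square a r) (\<lambda>z. ennreal (w z)) * ?dual r a) < \<infinity>"
    using w unfolding A1_restricted_def Let_def by auto
  define S where "S = (SUP a. average (square a r) (\<lambda>z. ennreal (w z)) * ?dual r a)"
  obtain S' where S': "S = ennreal S'" "0 \<le> S'" using sup unfolding S_def[symmetric] by (cases S) auto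
  define C where "C = S' * r\<^sup>2 + 1"
  define Q where "Q z = square (z - Complex (r / 2) (r / 2)) r" for z
  define E where "E z = enn2real (?dual r (z - Complex (r / 2) (r / 2)))" for z
  have E: "?dual r (z - Complex (r / 2) (r / 2)) = ennreal (E z)" "0 \<le> E z" for z
    using fin(2)[of "z - Complex (r / 2) (r / 2)"] by (auto simp: E_def)
  have Qb: "Q z \<in> sets borel" for z by (simp add: Q_def square_borel)
  have Ql [measurable]: "Q z \<in> sets lebesgue" for z using Qb[of z] by (simp add: sets_completionI_sets)
  have area: "emeasure lebesgue (Q z) = ennreal (r\<^sup>2)" for z
    unfolding Q_def by (rule emeasure_lebesgue_square[OF r])
  note wm [measurable] = weight_measurable[OF wt]
  have w0: "0 \<le> w x" for x using wt by (simp add: weight_def)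
  have Wq: "emeasure (borel_weight_measure w) (Q z) = (\<integral>\<^sup>+x\<in>Q z. ennreal (w x) \<partial>lebesgue)" for z
    by (rule emeasure_borel_weight_measure[OF wt Qb])
  have Wfin: "emeasure (borel_weight_measure w) (Q z) < top" for z
    using fin(1)[of "z - Complex (r / 2) (r / 2)"] r
    unfolding average_def Q_def[symmetric] area Wq infinity_ennreal_def
    by - (rule ennreal_divide_finite[of "r\<^sup>2"], auto)
  have wE: "AE x in lebesgue. x \<in> Q z \<longrightarrow> 0 < w x \<and> 1 \<le> E z * w x" for z
  proof -
    have "AE x in restrict_space lebesgue (Q z). inverse (ennreal (w x)) \<le> ennreal (E z)"
      using esssup_AE[of "\<lambda>z. inverse (ennreal (w z))" "restrict_space lebesgue (Q z)"]
      unfolding Q_def E(1) .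
    then have "AE x in lebesgue. x \<in> Q z \<longrightarrow> inverse (ennreal (w x)) \<le> ennreal (E z)"
      by (subst (asm) AE_restrict_space_iff) auto
    then show ?thesis
    proof eventually_elim
      case (elim x)
      show ?case
      proof
        assume "x \<in> Q z"
        then have le: "inverse (ennreal (w x)) \<le> ennreal (E z)" using elim by simp
        have "w x \<noteq> 0" using le by (auto simp: top_unique)
        then have pos: "0 < w x" using w0[of x] by (simp add: less_le)
        then have "inverse (w x) \<le> E z" using le E(2)[of z] by (simp add: inverse_ennreal)
        then show "0 < w x \<and> 1 \<le> E z * w x" using pos by (simp add: field_simps)
      qed
    qed
  qed
  have Wpos: "emeasure (borel_weight_measure w) (Q z) \<noteq> 0" for z
    unfolding Wq
  proof (rule set_nn_integral_neq_0)
    show "AE x in lebesgue. x \<in> Q z \<longrightarrow> ennreal (w x) \<noteq> 0" using wE[of z] by eventually_elim auto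
  qed (use area r in auto)
  have "restricted_weight \<alpha> w 1 C (r / 2) Q"
  proof
    show "0 < C" using S' r by (simp add: C_def add_nonneg_pos)
    show "ball z (r / 2) \<subseteq> Q z" for z unfolding Q_def by (rule ball_subset_square)
    show "0 < emeasure (borel_weight_measure w) (Q z)" for z using Wpos[of z] by (simp add: zero_less_iff_neq_zero)
  next
    fix z and h :: "complex \<Rightarrow> real" and t :: real
    assume h [measurable]: "h \<in> borel_measurable borel" and h0: "\<And>x. 0 \<le> h x" and t0: "0 \<le> t"
      and t: "ennreal t \<le> (\<integral>\<^sup>+x\<in>Q z. ennreal (h x powr (1 / 1)) \<partial>lborel)"
    have hl [measurable]: "h \<in> borel_measurable lebesgue" by (rule measurable_completion) (use h in \<open>simp only: measurable_lborel2\<close>)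
    define V where "V = enn2real (emeasure (borel_weight_measure w) (Q z))"
    have V: "emeasure (borel_weight_measure w) (Q z) = ennreal V" "0 \<le> V"
      using Wfin[of z] by (auto simp: V_def)
    have "ennreal t \<le> (\<integral>\<^sup>+x\<in>Q z. ennreal (h x) \<partial>lebesgue)"
      using t h0 by (simp add: nn_integral_lebesgue)
    also have "\<dots> \<le> (\<integral>\<^sup>+x. ennreal (E z) * (ennreal (w x) * (ennreal (h x) * indicator (Q z) x)) \<partial>lebesgue)"
    proof (rule nn_integral_mono_AE)
      show "AE x in lebesgue. ennreal (h x) * indicator (Q z) x \<le>
          ennreal (E z) * (ennreal (w x) * (ennreal (h x) * indicator (Q z) x))"
        using wE[of z]
      proof eventually_elim
        case (elim x)
        have "h x \<le> E z * (w x * h x)" if "x \<in> Q z"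
          using elim that mult_right_mono[of 1 "E z * w x" "h x"] h0[of x] by simp
        then show ?case
          using E(2)[of z] w0[of x] h0[of x] by (auto simp: indicator_def ennreal_mult[symmetric] intro!: ennreal_leI)
      qed
    qed
    also have "\<dots> = ennreal (E z) * (\<integral>\<^sup>+x. ennreal (w x) * (ennreal (h x) * indicator (Q z) x) \<partial>lebesgue)"
      by (intro nn_integral_cmult) measurable
    also have "(\<integral>\<^sup>+x. ennreal (w x) * (ennreal (h x) * indicator (Q z) x) \<partial>lebesgue) =
        (\<integral>\<^sup>+x\<in>Q z. ennreal (h x) \<partial>borel_weight_measure w)"
      by (intro nn_integral_borel_weight_measure[OF wt, symmetric] borel_measurable_times_ennreal
            measurable_compose[OF h measurable_ennreal] borel_measurable_indicator Qb)
    finally have "ennreal t * ennreal V \<le> ennreal (E z) * (\<integral>\<^sup>+x\<in>Q z. ennreal (h x) \<partial>borel_weight_measure w) * ennreal V"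
      by (rule mult_right_mono) simp
    also have "\<dots> = ennreal (V * E z) * (\<integral>\<^sup>+x\<in>Q z. ennreal (h x) \<partial>borel_weight_measure w)"
      using V E(2)[of z] by (simp add: ennreal_mult mult_ac)
    also have "\<dots> \<le> ennreal C * (\<integral>\<^sup>+x\<in>Q z. ennreal (h x) \<partial>borel_weight_measure w)"
    proof (rule mult_right_mono[OF ennreal_leI])
      have "average (Q z) (\<lambda>z. ennreal (w z)) * ennreal (E z) \<le> S"
        unfolding S_def Q_def E(1)[symmetric] by (rule SUP_upper2[of "z - Complex (r / 2) (r / 2)"]) auto
      also have "average (Q z) (\<lambda>z. ennreal (w z)) = ennreal (V / r\<^sup>2)"
        unfolding average_def area Wq[symmetric] V(1) using V r by (simp add: divide_ennreal)
      finally have "ennreal (V / r\<^sup>2 * E z) \<le> ennreal S'"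
        using V E(2)[of z] r by (simp add: S' ennreal_mult[symmetric])
      then have "V / r\<^sup>2 * E z \<le> S'" using S' by simp
      then show "V * E z \<le> C" using r by (simp add: C_def field_simps)
    qed simp
    finally show "ennreal (t powr 1) * emeasure (borel_weight_measure w) (Q z) \<le>
        ennreal C * (\<integral>\<^sup>+x\<in>Q z. ennreal (h x) \<partial>borel_weight_measure w)" unfolding V(1) using t0 by simp
  qed (use \<alpha> wt r Qb Wfin in auto)
  then show ?thesis by blast
qed

theorem theorem1p4:
  fixes \<alpha> :: real and w :: "complex \<Rightarrow> real"
  assumes "\<alpha> > 0" and "w \<in> Ainf_restricted"
  shows "\<exists>\<delta>. 0 < \<delta> \<and> \<delta> < 1 \<and> (\<forall>p::real\<ge>1.
    (\<forall>\<mu>\<in>borel_measures.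
       (toeplitz_in_schatten p \<alpha> w \<mu> \<longleftrightarrow> in_Lp p (berezin \<alpha> w \<mu>)) \<and>
       (in_Lp p (berezin \<alpha> w \<mu>) \<longleftrightarrow> (\<exists>r\<in>{0<..<\<delta>}. in_Lp p (average_function w r \<mu>))) \<and>
       (in_Lp p (berezin \<alpha> w \<mu>) \<longleftrightarrow> (\<forall>r\<in>{0<..<\<delta>}. in_Lp p (average_function w r \<mu>)))) \<and>
    (\<forall>r\<in>{0<..<\<delta>}.
       uniformly_comparable borel_measures
         (toeplitz_schatten_norm p \<alpha> w) (\<lambda>\<mu>. Lp_norm p (berezin \<alpha> w \<mu>)) \<and>
       uniformly_comparable borel_measures
         (\<lambda>\<mu>. Lp_norm p (berezin \<alpha> w \<mu>)) (\<lambda>\<mu>. Lp_norm p (average_function w r \<mu>))))"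
proof -
  have "\<exists>q C R Q. restricted_weight \<alpha> w q C R Q"
    using assms restricted_weight_if_A_restricted[of \<alpha> _ w] restricted_weight_if_A1_restricted[of \<alpha> w]
    unfolding Ainf_restricted_def by blast
  then obtain q C R Q where "restricted_weight \<alpha> w q C R Q" by (elim exE)
  then show ?thesis by (rule restricted_weight.schatten_characterization)
qed

end
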